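(* (Digital option.) In the two-dimensional Black–Scholes model of the context let $H=K\mathbf 1_{\{S^1_T\ge S^2_T\}}$ with $K>0$. Put $X:=\sigma_1W^1_T-\sigma_2W^2_T$, $Y:=A_1W^1_T+A_2W^2_T$, $\tilde X:=\sigma_1\widetilde W^1_T-\sigma_2\widetilde W^2_T$, $\tilde Y:=A_1\widetilde W^1_T+A_2\widetilde W^2_T$. The vectors $(X,Y)$ and $(\tilde X,\tilde Y)$ are normally distributed under $P$ and $\tilde P$ respectively; denote by $f_{X,Y}$ the density of $(X,Y)$ under $P$ and by $\tilde f_{\tilde X,\tilde Y}$ the density of $(\tilde X,\tilde Y)$ under $\tilde P$. Then for $c\ge0$: (linear loss) $$\Psi_1(c)=K\int_b^{+\infty}\int_{\ln c-BT}^{+\infty}f_{X,Y}(x,y)\,dy\,dx,\qquad \Psi_2(c)=K\int_{\tilde b}^{+\infty}\int_{\ln c-\tilde BT}^{+\infty}\tilde f_{\tilde X,\tilde Y}(x,y)\,dy\,dx;$$ (power loss, $p>1$) $$\Psi^p_1(c)=\frac{K^p}{p}\int_b^{+\infty}\int_{-\infty}^{\ln\left(\frac{K^{p-1}}{c}\right)-BT}f_{X,Y}(x,y)\,dy\,dx+\frac1pc^{\frac p{p-1}}\int_b^{+\infty}\int_{\ln\left(\frac{K^{p-1}}{c}\right)-BT}^{+\infty}e^{-\frac{p(y+BT)}{p-1}}f_{X,Y}(x,y)\,dy\,dx,$$ $$\Psi^p_2(c)=K\int_{\tilde b}^{+\infty}\int_{\ln\left(\frac{K^{p-1}}{c}\right)-\tilde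 BT}^{+\infty}\tilde f_{\tilde X,\tilde Y}(x,y)\,dy\,dx-c^{\frac1{p-1}}\int_{\tilde b}^{+\infty}\int_{\ln\left(\frac{K^{p-1}}{c}\right)-\tilde BT}^{+\infty}e^{-\frac{y+\tilde BT}{p-1}}\tilde f_{\tilde X,\tilde Y}(x,y)\,dy\,dx.$$
   Context: Model. $T>0$; $(W^1,W^2)$ is a Wiener process under $P$ with positive definite correlation matrix $Q=\begin{pmatrix}1&\rho\\\rho&1\end{pmatrix}$. Stocks $dS^i_t=S^i_t(\alpha_i\,dt+\sigma_i\,dW^i_t)$, $i=1,2$, with $\alpha_i\in\mathbb R$, $\sigma_i>0$, and constant interest rate $r$. Let $\theta_i=\frac{\alpha_i-r}{\sigma_i}$, $\theta=(\theta_1,\theta_2)^T$, $\widetilde W^i_t=W^i_t+\theta_it$. The martingale measure $\tilde P$ has density $\tilde Z_T=e^{-A_1W^1_T-A_2W^2_T-BT}=e^{-A_1\widetilde W^1_T-A_2\widetilde W^2_T-\tilde BT}$ with respect to $P$, where $(A_1,A_2)^T=Q^{-1}\theta$, $B=\frac12|Q^{-1/2}\theta|^2$, $\tilde B=B-A_1\theta_1-A_2\theta_2$; under $\tilde P$, $\widetilde W=(\widetilde W^1,\widetilde W^2)$ is a Wiener process with correlation matrix $Q$. $\mathbf E,\tilde{\mathbf E}$ are expectations under $P,\tilde P$. Constants: $b=\ln\frac{S^2_0}{S^1_0}+\left(\alpha_2-\alpha_1-\frac12(\sigma_2^2-\sigma_1^2)\right)T$, $\tilde b=\ln\frac{S^2_0}{S^1_0}-\frac12(\sigma_2^2-\sigma_1^2)T$.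 Risk auxiliary functions. Linear loss $l(x)=x$: $\Psi_1(c)=\mathbf E[H\mathbf 1_{\{\tilde Z_T^{-1}\ge c\}}]$, $\Psi_2(c)=\tilde{\mathbf E}[H\mathbf 1_{\{\tilde Z_T^{-1}\ge c\}}]$. Power loss $l(x)=x^p/p$, $p>1$: with $\varphi_c:=\left\{1-\left(\frac{(c\tilde Z_T)^{1/(p-1)}}{H}\wedge1\right)\right\}\mathbf 1_{\{H>0\}}$, $\Psi^p_1(c)=\frac1p\mathbf E[((1-\varphi_c)H)^p]$ and $\Psi^p_2(c)=\tilde{\mathbf E}[H\varphi_c]$. Convention: $\ln0=-\infty$.
   Formalization: In the power-loss formulas the bound ln(K^{p-1}/c) is corrected to ln(c/K^{p-1}) (the printed one fails at c=0, where Ψ_1^p=0). Existence of the densities is claimed only if σ_1A_2+σ_2A_1≠0 (θ=0 gives Y=0, so no density); the formulas hold for any such densities. *)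

theory Defs
  imports "HOL-Probability.Probability"
begin

section \<open>Matrices\<close>

definition pos_def_matrix :: "real^'n^'n \<Rightarrow> bool" where
  "pos_def_matrix Q \<longleftrightarrow> transpose Q = Q \<and> (\<forall>x. x \<noteq> 0 \<longrightarrow> 0 < x \<bullet> (Q *v x))"

text \<open>\<open>Q\<^sup>-\<^sup>1\<^sup>/\<^sup>2\<close> for positive definite \<open>Q\<close>: the positive definite square root of \<open>Q\<^sup>-\<^sup>1\<close>.\<close>

definition matrix_inv_sqrt :: "real^'n^'n \<Rightarrow> real^'n^'n" where
  "matrix_inv_sqrt Q = (THE R. pos_def_matrix R \<and> R ** R = matrix_inv Q)"

definition corr_matrix :: "real \<Rightarrow> real^2^2" where
  "corr_matrix \<rho> = vector [vector [1, \<rho>], vector [\<rho>, 1]]"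


section \<open>Normal random vectors and Wiener processes\<close>

definition std_normal_measure :: "(real^'n) measure" where
  "std_normal_measure =
     density lborel (\<lambda>x. ennreal (exp (- (norm x)\<^sup>2 / 2) / (2 * pi) powr (real CARD('n) / 2)))"

text \<open>The law \<open>N(m, C)\<close> as the law of \<open>m + L Z\<close> with \<open>L L\<^sup>T = C\<close> and \<open>Z\<close> standard normal;
  singular \<open>C\<close> is allowed.\<close>

definition normal_vector ::
    "'a measure \<Rightarrow> ('a \<Rightarrow> real^'n) \<Rightarrow> real^'n \<Rightarrow> real^'n^'n \<Rightarrow> bool" where
  "normal_vector M V m C \<longleftrightarrow>
     V \<in> borel_measurable M \<and>
     (\<exists>L :: real^'n^'n. L ** transpose L = C \<and>
        distr M borel V = distr std_normal_measure borel (\<lambda>z. m + L *v z))"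

definition adapted_continuous ::
    "'a measure \<Rightarrow> (real \<Rightarrow> 'a measure) \<Rightarrow> real \<Rightarrow>
     (real \<Rightarrow> 'a \<Rightarrow> 'b::{second_countable_topology, metric_space}) \<Rightarrow> bool" where
  "adapted_continuous M F T X \<longleftrightarrow>
     (\<forall>t\<in>{0..T}. X t \<in> borel_measurable (F t)) \<and>
     (\<forall>\<omega>\<in>space M. continuous_on {0..T} (\<lambda>t. X t \<omega>))"

definition wiener_process ::
    "'a measure \<Rightarrow> (real \<Rightarrow> 'a measure) \<Rightarrow> real \<Rightarrow> real^'n^'n \<Rightarrow> (real \<Rightarrow> 'a \<Rightarrow> real^'n) \<Rightarrow> bool" where
  "wiener_process M F T Q W \<longleftrightarrow>
     adapted_continuous M F T W \<and>
     (AE \<omega> in M. W 0 \<omega> = 0) \<and>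
     (\<forall>s\<in>{0..T}. \<forall>t\<in>{s..T}.
        normal_vector M (\<lambda>\<omega>. W t \<omega> - W s \<omega>) 0 ((t - s) *\<^sub>R Q) \<and>
        prob_space.indep_set M (sets (F s))
          {(\<lambda>\<omega>. W t \<omega> - W s \<omega>) -` U \<inter> space M | U. U \<in> sets borel})"


section \<open>Stochastic differentials\<close>

definition converges_in_prob :: "'a measure \<Rightarrow> (nat \<Rightarrow> 'a \<Rightarrow> real) \<Rightarrow> ('a \<Rightarrow> real) \<Rightarrow> bool" where
  "converges_in_prob M X Y \<longleftrightarrow>
     (\<forall>n. X n \<in> borel_measurable M) \<and> Y \<in> borel_measurable M \<and>
     (\<forall>\<epsilon>>0. (\<lambda>n. measure M {\<omega> \<in> space M. \<epsilon> < \<bar>X n \<omega> - Y \<omega>\<bar>}) \<longlonglongrightarrow> 0)"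

text \<open>Partitions \<open>0 = \<pi> k 0 \<le> \<dots> \<le> \<pi> k (N k) = t\<close> with mesh tending to 0 as \<open>k\<close> grows.\<close>

definition vanishing_partitions :: "real \<Rightarrow> (nat \<Rightarrow> nat) \<Rightarrow> (nat \<Rightarrow> nat \<Rightarrow> real) \<Rightarrow> bool" where
  "vanishing_partitions t N \<pi> \<longleftrightarrow>
     (\<forall>k. \<pi> k 0 = 0 \<and> \<pi> k (N k) = t \<and> (\<forall>i<N k. \<pi> k i \<le> \<pi> k (Suc i))) \<and>
     (\<forall>\<delta>>0. \<forall>\<^sub>F k in sequentially. \<forall>i<N k. \<pi> k (Suc i) - \<pi> k i < \<delta>)"

text \<open>\<open>I = \<integral>\<^sub>0\<^sup>t \<phi> dW\<close> in the sense of Ito, for a continuous adapted integrand: the limit in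
  probability of the left-endpoint sums. For such integrands the limit exists, and it does not
  depend on the sequence of partitions. It determines \<open>I\<close> up to null sets.\<close>

definition ito_integral ::
    "'a measure \<Rightarrow> (real \<Rightarrow> 'a measure) \<Rightarrow> (real \<Rightarrow> 'a \<Rightarrow> real) \<Rightarrow> (real \<Rightarrow> 'a \<Rightarrow> real) \<Rightarrow>
     real \<Rightarrow> ('a \<Rightarrow> real) \<Rightarrow> bool" where
  "ito_integral M F W \<phi> t I \<longleftrightarrow>
     adapted_continuous M F t \<phi> \<and>
     (\<forall>N \<pi>. vanishing_partitions t N \<pi> \<longrightarrow>
        converges_in_prob M
          (\<lambda>k \<omega>. \<Sum>i<N k. \<phi> (\<pi> k i) \<omega> * (W (\<pi> k (Suc i)) \<omega> - W (\<pi> k i) \<omega>)) I)"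

text \<open>\<open>dX\<^sub>t = a\<^sub>t dt + \<beta>\<^sub>t dW\<^sub>t\<close> on \<open>[0, T]\<close>, for continuous adapted coefficients.\<close>

definition has_ito_differential ::
    "'a measure \<Rightarrow> (real \<Rightarrow> 'a measure) \<Rightarrow> real \<Rightarrow> (real \<Rightarrow> 'a \<Rightarrow> real) \<Rightarrow>
     (real \<Rightarrow> 'a \<Rightarrow> real) \<Rightarrow> (real \<Rightarrow> 'a \<Rightarrow> real) \<Rightarrow> (real \<Rightarrow> 'a \<Rightarrow> real) \<Rightarrow> bool" where
  "has_ito_differential M F T W X a \<beta> \<longleftrightarrow>
     adapted_continuous M F T X \<and> adapted_continuous M F T a \<and> adapted_continuous M F T \<beta> \<and>
     (\<forall>t\<in>{0..T}. \<exists>I. ito_integral M F W \<beta> t I \<and>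
        (AE \<omega> in M. X t \<omega> = X 0 \<omega> + (LBINT u=ereal 0..ereal t. a u \<omega>) + I \<omega>))"

definition black_scholes_2d ::
    "'a measure \<Rightarrow> (real \<Rightarrow> 'a measure) \<Rightarrow> real \<Rightarrow> real \<Rightarrow> real^2 \<Rightarrow> real^2 \<Rightarrow> real^2 \<Rightarrow>
     (real \<Rightarrow> 'a \<Rightarrow> real^2) \<Rightarrow> (real \<Rightarrow> 'a \<Rightarrow> real^2) \<Rightarrow> bool" where
  "black_scholes_2d P F T \<rho> \<alpha> \<sigma> s W S \<longleftrightarrow>
     prob_space P \<and> filtration (space P) F \<and> (\<forall>t. subalgebra P (F t)) \<and>
     0 < T \<and> pos_def_matrix (corr_matrix \<rho>) \<and> wiener_process P F T (corr_matrix \<rho>) W \<and>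
     (\<forall>i. 0 < \<sigma> $ i \<and> 0 < s $ i \<and>
        (\<forall>\<omega>\<in>space P. S 0 \<omega> $ i = s $ i) \<and>
        has_ito_differential P F T (\<lambda>t \<omega>. W t \<omega> $ i) (\<lambda>t \<omega>. S t \<omega> $ i)
          (\<lambda>t \<omega>. S t \<omega> $ i * \<alpha> $ i) (\<lambda>t \<omega>. S t \<omega> $ i * \<sigma> $ i))"


section \<open>Risk functions\<close>

text \<open>\<open>Z\<close> is the density of the martingale measure with respect to \<open>P\<close>, and \<open>H\<close> the claim.\<close>

definition mart_measure :: "'a measure \<Rightarrow> ('a \<Rightarrow> real) \<Rightarrow> 'a measure" where
  "mart_measure P Z = density P (\<lambda>\<omega>. ennreal (Z \<omega>))"

definition Psi1_lin :: "'a measure \<Rightarrow> ('a \<Rightarrow> real) \<Rightarrow> ('a \<Rightarrow> real) \<Rightarrow> real \<Rightarrow> real" where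
  "Psi1_lin P Z H c = (\<integral>\<omega>. H \<omega> * indicator {\<omega>. inverse (Z \<omega>) \<ge> c} \<omega> \<partial>P)"

definition Psi2_lin :: "'a measure \<Rightarrow> ('a \<Rightarrow> real) \<Rightarrow> ('a \<Rightarrow> real) \<Rightarrow> real \<Rightarrow> real" where
  "Psi2_lin P Z H c = (\<integral>\<omega>. H \<omega> * indicator {\<omega>. inverse (Z \<omega>) \<ge> c} \<omega> \<partial>mart_measure P Z)"

text \<open>For \<open>H \<omega> = K > 0\<close>, \<open>c > 0\<close> and \<open>Z \<omega> = exp (- (y + B T))\<close>, the minimum below is \<open>1\<close> exactly when
  \<open>y \<le> ln (c / K\<^sup>p\<^sup>-\<^sup>1) - B T\<close>.\<close>

definition phi_pow :: "real \<Rightarrow> ('a \<Rightarrow> real) \<Rightarrow> ('a \<Rightarrow> real) \<Rightarrow> real \<Rightarrow> 'a \<Rightarrow> real" where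
  "phi_pow p Z H c \<omega> =
     (1 - min ((c * Z \<omega>) powr (1 / (p - 1)) / H \<omega>) 1) * indicator {\<omega>. H \<omega> > 0} \<omega>"

definition Psi1_pow :: "real \<Rightarrow> 'a measure \<Rightarrow> ('a \<Rightarrow> real) \<Rightarrow> ('a \<Rightarrow> real) \<Rightarrow> real \<Rightarrow> real" where
  "Psi1_pow p P Z H c = 1 / p * (\<integral>\<omega>. ((1 - phi_pow p Z H c \<omega>) * H \<omega>) powr p \<partial>P)"

definition Psi2_pow :: "real \<Rightarrow> 'a measure \<Rightarrow> ('a \<Rightarrow> real) \<Rightarrow> ('a \<Rightarrow> real) \<Rightarrow> real \<Rightarrow> real" where
  "Psi2_pow p P Z H c = (\<integral>\<omega>. H \<omega> * phi_pow p Z H c \<omega> \<partial>mart_measure P Z)"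


section \<open>Densities and integration bounds\<close>

definition joint_density ::
    "'a measure \<Rightarrow> ('a \<Rightarrow> real) \<Rightarrow> ('a \<Rightarrow> real) \<Rightarrow> (real \<Rightarrow> real \<Rightarrow> real) \<Rightarrow> bool" where
  "joint_density M X Y f \<longleftrightarrow>
     (\<forall>x y. 0 \<le> f x y) \<and>
     distributed M lborel (\<lambda>\<omega>. (X \<omega>, Y \<omega>)) (\<lambda>(x, y). ennreal (f x y))"

text \<open>The logarithm on \<open>[0, \<infinity>)\<close> with \<open>ln 0 = -\<infinity>\<close>; the library has \<open>ln 0 = 0\<close>.\<close>

definition eln :: "real \<Rightarrow> ereal" where
  "eln x = (if x = 0 then -\<infinity> else ereal (ln x))"

end

theory Submission
  imports Defs
begin

text \<open>
  The main step is to recover \<open>S\<^sub>T\<close> from its stochastic differential. The process \<open>S\<close> is the limit in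
  probability of its Euler sums along uniform partitions, by the definition of the Ito integral and
  the convergence of Riemann sums. So is the geometric Brownian motion \<open>G\<close>, because up to their
  means, which are \<open>o(\<Delta>)\<close>, its one-step errors are orthogonal with second moments \<open>o(\<Delta>)\<close>. Hence the
  same holds for \<open>D = S - G\<close>. On the event \<open>A\<^sub>t\<close> that \<open>\<bar>D\<bar> \<le> b\<close> on \<open>[0, t]\<close>, the Euler sums of \<open>D\<close> are
  those of the bounded process \<open>D\<^sub>u 1(A\<^sub>u)\<close>, and orthogonality of the Brownian increments gives a Gronwall
  inequality for \<open>g(t) = E[D\<^sub>t\<^sup>2 1(A\<^sub>t)]\<close>. So \<open>g = 0\<close>, and \<open>D\<^sub>T = 0\<close> almost surely as \<open>b \<rightarrow> \<infinity>\<close>.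

  The event \<open>S\<^sup>1\<^sub>T \<ge> S\<^sup>2\<^sub>T\<close> is therefore almost surely \<open>X \<ge> b\<close>. Under the martingale measure the law of
  \<open>Wt T\<close> is found by a translation of the standard normal law, since \<open>W\<^sub>T = L z\<close> and
  \<open>exp (a \<bullet> z - \<bar>a\<bar>\<^sup>2/2)\<close> times the standard normal density is its translate by \<open>a\<close>.
\<close>

section \<open>Gaussian vectors\<close>

text \<open>The Ito integral enters only as a limit in probability of left-endpoint sums, so
  \<open>S\<close> comes without moment bounds and \<open>D\<close> could have infinite second
  moments. This is why mean squares are taken only of the localised, bounded process and only on
  finite sums over a fixed partition; passing to the limit then costs \<open>b\<^sup>2\<close> times
  a probability that tends to 0. The Gronwall argument stays discrete as well: a bound
  \<open>m * exp (l * t)\<close> for \<open>g\<close> is improved to half of itself, again and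
  again, so no integral of \<open>g\<close> is ever formed.

  The total mass of the standard normal measure is not computed: the increments of \<open>W\<close>
  under the probability measure \<open>P\<close> have an image of it as their law, and taking images
  preserves mass. The same remark shows that \<open>Pt\<close> is a probability measure.\<close>

lemma std_normal_tilt:
  fixes a :: "real^'n"
  shows "density std_normal_measure (\<lambda>z. ennreal (exp (a \<bullet> z - (norm a)\<^sup>2 / 2))) =
         distr std_normal_measure borel (\<lambda>z. z + a)"
proof -
  let ?c = "(2 * pi) powr (real CARD('n) / 2)"
  let ?h = "\<lambda>z::real^'n. exp (- (norm z)\<^sup>2 / 2) / ?c"
  have "?h (z - a) = ?h z * exp (a \<bullet> z - (norm a)\<^sup>2 / 2)" for z
    by (simp add: exp_add[symmetric] power2_norm_eq_inner inner_diff inner_commute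
        add_divide_distrib diff_divide_distrib)
  then have "density std_normal_measure (\<lambda>z. ennreal (exp (a \<bullet> z - (norm a)\<^sup>2 / 2))) =
      density lborel (\<lambda>z. ennreal (?h (z - a)))"
    unfolding std_normal_measure_def
    by (subst density_density_eq) (simp_all add: ennreal_mult[symmetric])
  also have "\<dots> = density (distr lborel borel ((+) a)) (\<lambda>z. ennreal (?h (z - a)))"
    by (simp add: lborel_distr_plus)
  also have "\<dots> = distr std_normal_measure borel (\<lambda>z. z + a)"
    by (subst density_distr) (simp_all add: std_normal_measure_def add.commute[of _ a])
  finally show ?thesis .
qed

lemma sets_std_normal [simp, measurable_cong]: "sets std_normal_measure = sets borel"
  and space_std_normal [simp]: "space std_normal_measure = UNIV"
  by (simp_all add: std_normal_measure_def)

text \<open>The tilt identity read for integrals, with the constant factor moved to the other side.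
  With \<open>f\<close> constant 1 it gives the Laplace transform, and with
  \<open>f z = a \<bullet> z\<close> the mean of
  \<open>exp (a \<bullet> z) * (a \<bullet> z)\<close>.\<close>

lemma integrable_std_normal_tilt:
  fixes a :: "real^'n" and f :: "real^'n \<Rightarrow> real"
  assumes [measurable]: "f \<in> borel_measurable borel"
  shows "integrable std_normal_measure (\<lambda>z. exp (a \<bullet> z) * f z) \<longleftrightarrow>
         integrable std_normal_measure (\<lambda>z. f (z + a))" (is ?I)
    and "(\<integral>z. exp (a \<bullet> z) * f z \<partial>std_normal_measure) =
         exp ((norm a)\<^sup>2 / 2) * (\<integral>z. f (z + a) \<partial>std_normal_measure)" (is ?E)
proof -
  let ?c = "exp (- ((norm a)\<^sup>2 / 2))"
  have *: "exp (a \<bullet> z - (norm a)\<^sup>2 / 2) * f z = ?c * (exp (a \<bullet> z) * f z)" for z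
    by (simp flip: exp_add mult.assoc)
  have "integrable std_normal_measure (\<lambda>z. f (z + a)) \<longleftrightarrow>
      integrable (density std_normal_measure (\<lambda>z. ennreal (exp (a \<bullet> z - (norm a)\<^sup>2 / 2)))) f"
    unfolding std_normal_tilt by (subst integrable_distr_eq) simp_all
  also have "\<dots> \<longleftrightarrow> integrable std_normal_measure (\<lambda>z. ?c * (exp (a \<bullet> z) * f z))"
    by (subst integrable_density) (simp_all add: *)
  also have "\<dots> \<longleftrightarrow> integrable std_normal_measure (\<lambda>z. exp (a \<bullet> z) * f z)"
    by (subst integrable_mult_left_iff) simp
  finally show ?I by simp
  have "(\<integral>z. f (z + a) \<partial>std_normal_measure) =
      (\<integral>z. f z \<partial>density std_normal_measure (\<lambda>z. ennreal (exp (a \<bullet> z - (norm a)\<^sup>2 / 2))))"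
    unfolding std_normal_tilt by (subst integral_distr) simp_all
  also have "\<dots> = (\<integral>z. ?c * (exp (a \<bullet> z) * f z) \<partial>std_normal_measure)"
    by (subst integral_density) (simp_all add: *)
  finally show ?E
    by (simp add: exp_minus field_simps)
qed

lemma matrix_vector_mult_borel [measurable]:
  fixes L :: "real^'n^'m"
  shows "(\<lambda>z. L *v z) \<in> borel_measurable borel"
  by (intro borel_measurable_continuous_onI linear_continuous_on matrix_vector_mul_bounded_linear)

text \<open>Both measures have the same image law, and images preserve total mass. From left to
  right this gives the Gaussian measure mass one; from right to left it shows that a changed measure
  is a probability.\<close>

lemma normal_vector_prob_space_iff:
  fixes V :: "'a \<Rightarrow> real^'n"
  assumes "normal_vector M V m C"
  shows "prob_space M \<longleftrightarrow> prob_space (std_normal_measure :: (real^'n) measure)"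
proof -
  obtain L :: "real^'n^'n"
    where V: "V \<in> borel_measurable M"
      and L: "distr M borel V = distr std_normal_measure borel (\<lambda>z. m + L *v z)"
    using assms unfolding normal_vector_def by blast
  have Lm: "(\<lambda>z. m + L *v z) \<in> borel_measurable std_normal_measure"
    by measurable
  have "prob_space M \<longleftrightarrow> prob_space (distr M borel V)"
    using V by (blast intro: prob_space.prob_space_distr prob_space_distrD)
  also have "\<dots> \<longleftrightarrow> prob_space (std_normal_measure :: (real^'n) measure)"
    unfolding L by (blast intro: prob_space.prob_space_distr prob_space_distrD Lm)
  finally show ?thesis .
qed

text \<open>The right side is the square of 2 sinh (x / 2), and |sinh y| is at least |y|. The two
  sides agree up to fourth order at 0, so a second moment bounded in this way through Laplace
  transforms loses nothing to first order in the variance.\<close>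

lemma square_le_exp_sum: "(x::real)\<^sup>2 \<le> exp x + exp (- x) - 2"
proof -
  have "\<bar>x / 2\<bar> \<le> \<bar>(exp (x / 2) - exp (- x / 2)) / 2\<bar>"
    using real_le_abs_sinh[of "x / 2"] by (simp add: exp_minus)
  then have "\<bar>x\<bar> \<le> \<bar>exp (x / 2) - exp (- x / 2)\<bar>"
    by simp
  then have "x\<^sup>2 \<le> (exp (x / 2) - exp (- x / 2))\<^sup>2"
    by (rule iffD1[OF abs_le_square_iff])
  also have "\<dots> = exp x + exp (- x) - 2"
    by (simp add: power2_eq_square algebra_simps exp_add[symmetric])
  finally show ?thesis .
qed

lemma abs_le_exp_sum: "\<bar>x::real\<bar> \<le> exp x + exp (- x)"
  using exp_ge_add_one_self[of x] exp_ge_add_one_self[of "- x"] exp_gt_zero[of x]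
    exp_gt_zero[of "- x"] by linarith

text \<open>The exponentials of \<open>a \<bullet> z\<close> and of its negative dominate both
  \<open>a \<bullet> z\<close> and its square, so integrability reduces to the Laplace transform.
  The last moment is the tilt identity, since translation by \<open>a\<close> turns
  \<open>a \<bullet> z\<close> into \<open>a \<bullet> z\<close> plus the squared norm of
  \<open>a\<close>.\<close>

lemma std_normal_moments:
  fixes a :: "real^'n"
  assumes "prob_space (std_normal_measure :: (real^'n) measure)"
  defines "v \<equiv> (norm a)\<^sup>2"
  shows "integrable std_normal_measure (\<lambda>z. exp (a \<bullet> z))"
    and "(\<integral>z. exp (a \<bullet> z) \<partial>std_normal_measure) = exp (v / 2)"
    and "integrable std_normal_measure (\<lambda>z. a \<bullet> z)"
    and "(\<integral>z. a \<bullet> z \<partial>std_normal_measure) = 0"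
    and "integrable std_normal_measure (\<lambda>z. (a \<bullet> z)\<^sup>2)"
    and "(\<integral>z. (a \<bullet> z)\<^sup>2 \<partial>std_normal_measure) \<le> 2 * (exp (v / 2) - 1)"
    and "integrable std_normal_measure (\<lambda>z. exp (a \<bullet> z) * (a \<bullet> z))"
    and "(\<integral>z. exp (a \<bullet> z) * (a \<bullet> z) \<partial>std_normal_measure) = v * exp (v / 2)"
proof -
  interpret prob_space "std_normal_measure :: (real^'n) measure" by fact
  have exp: "integrable std_normal_measure (\<lambda>z. exp (a \<bullet> z))"
    "(\<integral>z. exp (a \<bullet> z) \<partial>std_normal_measure) = exp ((norm a)\<^sup>2 / 2)" for a :: "real^'n"
    using integrable_std_normal_tilt[of "\<lambda>_. 1" a] prob_space by simp_all
  have int: "integrable std_normal_measure (\<lambda>z. a \<bullet> z)"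
    by (rule Bochner_Integration.integrable_bound[where f="\<lambda>z. exp (a \<bullet> z) + exp ((- a) \<bullet> z)"])
      (use abs_le_exp_sum[of "a \<bullet> _"] exp(1)[of a] exp(1)[of "- a"] in auto)
  have sq: "integrable std_normal_measure (\<lambda>z. (a \<bullet> z)\<^sup>2)"
  proof (rule Bochner_Integration.integrable_bound)
    show "integrable std_normal_measure (\<lambda>z. exp (a \<bullet> z) + exp ((- a) \<bullet> z) - 2)"
      using exp(1)[of a] exp(1)[of "- a"] by (intro Bochner_Integration.integrable_diff
          Bochner_Integration.integrable_add) auto
    show "AE z in std_normal_measure. norm ((a \<bullet> z)\<^sup>2) \<le> norm (exp (a \<bullet> z) + exp ((- a) \<bullet> z) - 2)"
      using square_le_exp_sum[of "a \<bullet> _"] by (intro AE_I2) (auto intro: order_trans[OF _ abs_ge_self])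
  qed simp
  have mean: "(\<integral>z. a \<bullet> z \<partial>std_normal_measure) = 0"
  proof -
    \<comment> \<open>The density is even and Lebesgue measure is invariant under reflection, so the
      mean equals its own negative.\<close>
    have "distr std_normal_measure borel (\<lambda>z::real^'n. - z) =
        density (distr lborel borel uminus)
          (\<lambda>z::real^'n. ennreal (exp (- (norm z)\<^sup>2 / 2) / (2 * pi) powr (real CARD('n) / 2)))"
      by (subst density_distr) (simp_all add: std_normal_measure_def)
    moreover have "distr lborel borel uminus = (lborel :: (real^'n) measure)"
      using lborel_affine[of "-1" "0 :: real^'n"] by (simp add: density_1)
    ultimately have "distr std_normal_measure borel (\<lambda>z::real^'n. - z) = std_normal_measure"
      by (simp add: std_normal_measure_def)
    then have "(\<integral>z. a \<bullet> z \<partial>std_normal_measure) =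
      (\<integral>z. a \<bullet> z \<partial>distr std_normal_measure borel (\<lambda>z::real^'n. - z))"
      by simp
    also have "\<dots> = (\<integral>z. a \<bullet> (- z) \<partial>std_normal_measure)"
      by (subst integral_distr) auto
    finally show ?thesis by simp
  qed
  show "integrable std_normal_measure (\<lambda>z. exp (a \<bullet> z))"
    "(\<integral>z. exp (a \<bullet> z) \<partial>std_normal_measure) = exp (v / 2)"
    unfolding v_def by (fact exp)+
  show "integrable std_normal_measure (\<lambda>z. a \<bullet> z)"
    "(\<integral>z. a \<bullet> z \<partial>std_normal_measure) = 0"
    "integrable std_normal_measure (\<lambda>z. (a \<bullet> z)\<^sup>2)"
    by fact+
  have "(\<integral>z. (a \<bullet> z)\<^sup>2 \<partial>std_normal_measure) \<le>
      (\<integral>z. exp (a \<bullet> z) + exp ((- a) \<bullet> z) - 2 \<partial>std_normal_measure)"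
    using square_le_exp_sum[of "a \<bullet> _"] sq exp(1)[of a] exp(1)[of "- a"] by (intro integral_mono) auto
  also have "\<dots> = 2 * (exp (v / 2) - 1)"
    using exp[of a] exp[of "- a"] prob_space by (simp add: v_def)
  finally show "(\<integral>z. (a \<bullet> z)\<^sup>2 \<partial>std_normal_measure) \<le> 2 * (exp (v / 2) - 1)" .
  show "integrable std_normal_measure (\<lambda>z. exp (a \<bullet> z) * (a \<bullet> z))"
    "(\<integral>z. exp (a \<bullet> z) * (a \<bullet> z) \<partial>std_normal_measure) = v * exp (v / 2)"
    using integrable_std_normal_tilt[of "\<lambda>z. a \<bullet> z" a] int mean prob_space
    by (simp_all add: inner_add_right v_def power2_norm_eq_inner)
qed

text \<open>The second moment is \<open>v\<close>; the upper bound, which agrees with \<open>v\<close> to first order, suffices.\<close>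

lemma normal_vector_moments:
  fixes V :: "'a \<Rightarrow> real^'n" and u :: "real^'n"
  assumes M: "prob_space M" and V: "normal_vector M V 0 C"
  defines "v \<equiv> u \<bullet> (C *v u)" and "\<xi> \<equiv> (\<lambda>\<omega>. u \<bullet> V \<omega>)"
  shows "integrable M (\<lambda>\<omega>. exp (\<xi> \<omega>))" "(\<integral>\<omega>. exp (\<xi> \<omega>) \<partial>M) = exp (v / 2)"
    and "integrable M \<xi>" "(\<integral>\<omega>. \<xi> \<omega> \<partial>M) = 0"
    and "integrable M (\<lambda>\<omega>. (\<xi> \<omega>)\<^sup>2)" "(\<integral>\<omega>. (\<xi> \<omega>)\<^sup>2 \<partial>M) \<le> 2 * (exp (v / 2) - 1)"
    and "integrable M (\<lambda>\<omega>. exp (\<xi> \<omega>) * \<xi> \<omega>)"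
    and "(\<integral>\<omega>. exp (\<xi> \<omega>) * \<xi> \<omega> \<partial>M) = v * exp (v / 2)"
proof -
  obtain L :: "real^'n^'n"
    where V: "V \<in> borel_measurable M" and LC: "L ** transpose L = C"
      and L: "distr M borel V = distr std_normal_measure borel (\<lambda>z. 0 + L *v z)"
    using V unfolding normal_vector_def by blast
  \<comment> \<open>With this \<open>a\<close> the variable \<open>u \<bullet> V\<close> has the law
    of \<open>a \<bullet> z\<close> for standard normal \<open>z\<close>, and \<open>v\<close> is
    the squared norm of \<open>a\<close>.\<close>
  define a where "a = transpose L *v u"
  have a: "a \<bullet> z = u \<bullet> (L *v z)" for z
    by (simp add: a_def dot_lmul_matrix)
  have v: "v = (norm a)\<^sup>2"
    by (simp add: power2_norm_eq_inner v_def LC[symmetric] a)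
      (simp add: a_def matrix_vector_mul_assoc[symmetric])
  note std = std_normal_moments[OF iffD1[OF normal_vector_prob_space_iff[OF assms(2)] M], of a,
      folded v, unfolded a]
  have int: "integrable M (\<lambda>\<omega>. g (V \<omega>)) \<longleftrightarrow> integrable std_normal_measure (\<lambda>z. g (L *v z))"
    and lint: "(\<integral>\<omega>. g (V \<omega>) \<partial>M) = (\<integral>z. g (L *v z) \<partial>std_normal_measure)"
    if [measurable]: "g \<in> borel_measurable borel" for g :: "real^'n \<Rightarrow> real"
  proof -
    have "integrable M (\<lambda>\<omega>. g (V \<omega>)) \<longleftrightarrow> integrable (distr M borel V) g"
      using V by (subst integrable_distr_eq) auto
    also have "\<dots> \<longleftrightarrow> integrable std_normal_measure (\<lambda>z. g (0 + L *v z))"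
      unfolding L by (subst integrable_distr_eq) auto
    finally show "integrable M (\<lambda>\<omega>. g (V \<omega>)) \<longleftrightarrow> integrable std_normal_measure (\<lambda>z. g (L *v z))"
      by simp
    have "(\<integral>\<omega>. g (V \<omega>) \<partial>M) = (\<integral>x. g x \<partial>distr M borel V)"
      using V by (subst integral_distr) auto
    also have "\<dots> = (\<integral>z. g (0 + L *v z) \<partial>std_normal_measure)"
      unfolding L by (subst integral_distr) auto
    finally show "(\<integral>\<omega>. g (V \<omega>) \<partial>M) = (\<integral>z. g (L *v z) \<partial>std_normal_measure)"
      by simp
  qed
  show "integrable M (\<lambda>\<omega>. exp (\<xi> \<omega>))" "(\<integral>\<omega>. exp (\<xi> \<omega>) \<partial>M) = exp (v / 2)"
    "integrable M \<xi>" "(\<integral>\<omega>. \<xi> \<omega> \<partial>M) = 0"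
    "integrable M (\<lambda>\<omega>. (\<xi> \<omega>)\<^sup>2)" "(\<integral>\<omega>. (\<xi> \<omega>)\<^sup>2 \<partial>M) \<le> 2 * (exp (v / 2) - 1)"
    "integrable M (\<lambda>\<omega>. exp (\<xi> \<omega>) * \<xi> \<omega>)"
    "(\<integral>\<omega>. exp (\<xi> \<omega>) * \<xi> \<omega> \<partial>M) = v * exp (v / 2)"
    unfolding \<xi>_def
    using std int[of "\<lambda>x. exp (u \<bullet> x)"] lint[of "\<lambda>x. exp (u \<bullet> x)"]
      int[of "\<lambda>x. u \<bullet> x"] lint[of "\<lambda>x. u \<bullet> x"] int[of "\<lambda>x. (u \<bullet> x)\<^sup>2"] lint[of "\<lambda>x. (u \<bullet> x)\<^sup>2"]
      int[of "\<lambda>x. exp (u \<bullet> x) * (u \<bullet> x)"] lint[of "\<lambda>x. exp (u \<bullet> x) * (u \<bullet> x)"]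
    by simp_all
qed

section \<open>The correlation matrix\<close>

text \<open>The quadratic form takes the values 2 (1 + \<rho>) and 2 (1 - \<rho>) on the vectors (1,
  1) and (1, -1).\<close>

lemma pos_def_corr_matrixD:
  assumes "pos_def_matrix (corr_matrix \<rho>)"
  shows "0 < 1 + \<rho>" "0 < 1 - \<rho>"
proof -
  have "(vector [1, 1] :: real^2) \<noteq> 0" "(vector [1, -1] :: real^2) \<noteq> 0"
    by (simp_all add: vec_eq_iff forall_2)
  then have "0 < (vector [1, 1] :: real^2) \<bullet> (corr_matrix \<rho> *v vector [1, 1])"
    "0 < (vector [1, -1] :: real^2) \<bullet> (corr_matrix \<rho> *v vector [1, -1])"
    using assms unfolding pos_def_matrix_def by blast+
  then show "0 < 1 + \<rho>" "0 < 1 - \<rho>"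
    by (simp_all add: corr_matrix_def inner_vec_def matrix_vector_mult_def sum_2)
qed

lemma matrix_inv_unique:
  fixes M N :: "real^'n^'n"
  assumes "M ** N = mat 1"
  shows "matrix_inv M = N"
proof -
  have "\<exists>A'. M ** A' = mat 1 \<and> A' ** M = mat 1"
    using assms matrix_left_right_inverse by blast
  then have "matrix_inv M ** M = mat 1"
    unfolding matrix_inv_def by (rule someI2_ex) blast
  then have "matrix_inv M ** (M ** N) = N"
    by (simp add: matrix_mul_assoc)
  then show ?thesis
    by (simp add: assms)
qed

lemma matrix_inv_corr_matrix:
  assumes "0 < 1 + \<rho>" "0 < 1 - \<rho>"
  shows "matrix_inv (corr_matrix \<rho>) =
    vector [vector [1 / (1 - \<rho>\<^sup>2), - \<rho> / (1 - \<rho>\<^sup>2)], vector [- \<rho> / (1 - \<rho>\<^sup>2), 1 / (1 - \<rho>\<^sup>2)]]"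
      (is "_ = ?R")
    and "corr_matrix \<rho> ** matrix_inv (corr_matrix \<rho>) = mat 1"
proof -
  have "1 - \<rho>\<^sup>2 = (1 + \<rho>) * (1 - \<rho>)"
    by (simp add: power2_eq_square algebra_simps)
  then have "1 - \<rho>\<^sup>2 \<noteq> 0"
    using assms by simp
  then have R: "corr_matrix \<rho> ** ?R = mat 1"
    by (simp add: vec_eq_iff forall_2 corr_matrix_def matrix_matrix_mult_def sum_2 mat_def)
      (simp add: field_simps power2_eq_square)
  then show "matrix_inv (corr_matrix \<rho>) = ?R"
    by (rule matrix_inv_unique)
  then show "corr_matrix \<rho> ** matrix_inv (corr_matrix \<rho>) = mat 1"
    using R by simp
qed

text \<open>Uniqueness of the positive definite square root in coordinates. Here \<open>x\<close>,
  \<open>y\<close>, \<open>z\<close> are the entries of a symmetric matrix R, the first four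
  inequalities test R on the unit vectors, on (1, 1) and on (1, -1), and \<open>e\<close> lists the
  entries of R^2. Equal diagonal entries of R^2 force \<open>x = z\<close>; then
  \<open>x + y\<close> and \<open>x - y\<close> are the eigenvalues of R, nonnegative with squares
  \<open>k\<^sup>2\<close> and \<open>l\<^sup>2\<close>.\<close>

lemma symmetric_sqrt_2x2:
  fixes x y z k l :: real
  assumes "0 < x" "0 < z" "0 < x + 2 * y + z" "0 < x - 2 * y + z" "0 < k" "0 < l"
    and e: "x\<^sup>2 + y\<^sup>2 = (k\<^sup>2 + l\<^sup>2) / 2" "z\<^sup>2 + y\<^sup>2 = (k\<^sup>2 + l\<^sup>2) / 2" "y * (x + z) = (k\<^sup>2 - l\<^sup>2) / 2"
  shows "x = (k + l) / 2 \<and> y = (k - l) / 2 \<and> z = (k + l) / 2"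
proof -
  have "x\<^sup>2 = z\<^sup>2"
    using e(1,2) by simp
  then have d: "z = x"
    using assms(1,2) power2_eq_imp_eq[of x z] by linarith
  have "(x + y)\<^sup>2 = k\<^sup>2" "(x - y)\<^sup>2 = l\<^sup>2"
    using e(1,3) unfolding d power2_sum power2_diff by (simp_all add: algebra_simps)
  moreover have "0 \<le> x + y" "0 \<le> x - y"
    using assms(3,4) d by simp_all
  ultimately have "x + y = k" "x - y = l"
    using power2_eq_imp_eq[of "x + y" k] power2_eq_imp_eq[of "x - y" l] assms(5,6) by linarith+
  then show ?thesis
    using d by (simp add: field_simps)
qed

text \<open>\<open>(1, 1)\<close> and \<open>(1, -1)\<close> are eigenvectors of \<open>Q\<close>, with eigenvalues \<open>1 + \<rho>\<close> and \<open>1 - \<rho>\<close>.\<close>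

lemma matrix_inv_sqrt_corr_matrix:
  assumes "0 < 1 + \<rho>" "0 < 1 - \<rho>"
  defines "R \<equiv> matrix_inv_sqrt (corr_matrix \<rho>)"
  shows "pos_def_matrix R" "R ** R = matrix_inv (corr_matrix \<rho>)"
proof -
  \<comment> \<open>The eigenvalues of the inverse square root on (1, 1) and (1, -1). The matrix
    \<open>R0\<close> below has these eigenvalues on these vectors.\<close>
  define k l where "k = 1 / sqrt (1 + \<rho>)" and "l = 1 / sqrt (1 - \<rho>)"
  define R0 :: "real^2^2"
    where "R0 = vector [vector [(k + l) / 2, (k - l) / 2], vector [(k - l) / 2, (k + l) / 2]]"
  have kl: "0 < k" "0 < l" "k\<^sup>2 = 1 / (1 + \<rho>)" "l\<^sup>2 = 1 / (1 - \<rho>)"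
    using assms by (simp_all add: k_def l_def power_divide)
  have "1 - \<rho>\<^sup>2 = (1 + \<rho>) * (1 - \<rho>)"
    by (simp add: power2_eq_square algebra_simps)
  then have pq: "1 / (1 - \<rho>\<^sup>2) = (k\<^sup>2 + l\<^sup>2) / 2" "- \<rho> / (1 - \<rho>\<^sup>2) = (k\<^sup>2 - l\<^sup>2) / 2"
    using assms by (simp_all add: kl divide_simps)
  have inv: "matrix_inv (corr_matrix \<rho>) = vector [vector [(k\<^sup>2 + l\<^sup>2) / 2, (k\<^sup>2 - l\<^sup>2) / 2],
      vector [(k\<^sup>2 - l\<^sup>2) / 2, (k\<^sup>2 + l\<^sup>2) / 2]]"
    using matrix_inv_corr_matrix(1)[OF assms(1,2)] by (simp only: pq)
  have R0: "R0 ** R0 = matrix_inv (corr_matrix \<rho>)"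
    unfolding inv R0_def
    by (simp add: vec_eq_iff forall_2 matrix_matrix_mult_def sum_2)
      (simp add: field_simps power2_eq_square)
  have pos: "pos_def_matrix R0"
    unfolding pos_def_matrix_def
  proof (intro conjI allI impI)
    show "transpose R0 = R0"
      by (simp add: R0_def transpose_def vec_eq_iff forall_2)
    fix x :: "real^2" assume "x \<noteq> 0"
    then have "x $ 1 + x $ 2 \<noteq> 0 \<or> x $ 1 - x $ 2 \<noteq> 0"
      by (auto simp: vec_eq_iff forall_2)
    \<comment> \<open>Twice the quadratic form of \<open>R0\<close>, diagonalised by the coordinates
      along the two eigenvectors.\<close>
    then have "0 < k * (x $ 1 + x $ 2)\<^sup>2 + l * (x $ 1 - x $ 2)\<^sup>2"
      using kl(1,2) by (auto intro: add_pos_nonneg add_nonneg_pos)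
    also have "\<dots> = 2 * (x \<bullet> (R0 *v x))"
      by (simp add: R0_def inner_vec_def matrix_vector_mult_def sum_2 power2_eq_square field_simps)
    finally show "0 < x \<bullet> (R0 *v x)" by simp
  qed
  \<comment> \<open>\<open>matrix_inv_sqrt\<close> is a definite description, so its value is known
    only after every competitor has been excluded.\<close>
  have unique: "R' = R0" if R': "pos_def_matrix R'" "R' ** R' = matrix_inv (corr_matrix \<rho>)" for R'
  proof -
    have sym: "R' $ 2 $ 1 = R' $ 1 $ 2"
    proof -
      have "transpose R' $ 1 $ 2 = R' $ 1 $ 2"
        using R'(1) by (simp add: pos_def_matrix_def)
      then show ?thesis by (simp add: transpose_def)
    qed
    have ax: "0 < x \<bullet> (R' *v x)" if "x \<noteq> 0" for x
      using R'(1) that unfolding pos_def_matrix_def by blast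
    have "(axis 1 1 :: real^2) \<noteq> 0" "(axis 2 1 :: real^2) \<noteq> 0"
      "(vector [1, 1] :: real^2) \<noteq> 0" "(vector [1, -1] :: real^2) \<noteq> 0"
      by (simp_all add: vec_eq_iff forall_2 axis_eq_0_iff)
    note this[THEN ax]
    then have p: "0 < R' $ 1 $ 1" "0 < R' $ 2 $ 2"
        "0 < R' $ 1 $ 1 + 2 * R' $ 1 $ 2 + R' $ 2 $ 2" "0 < R' $ 1 $ 1 - 2 * R' $ 1 $ 2 + R' $ 2 $ 2"
      by (simp_all add: inner_vec_def matrix_vector_mult_def sum_2 axis_def sym)
    have "R' $ 1 $ 1 = (k + l) / 2 \<and> R' $ 1 $ 2 = (k - l) / 2 \<and> R' $ 2 $ 2 = (k + l) / 2"
    proof (rule symmetric_sqrt_2x2)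
      have "(R' ** R') $ i $ j = vector [vector [(k\<^sup>2 + l\<^sup>2) / 2, (k\<^sup>2 - l\<^sup>2) / 2],
          vector [(k\<^sup>2 - l\<^sup>2) / 2, (k\<^sup>2 + l\<^sup>2) / 2]] $ i $ j" for i j
        by (simp only: R'(2) inv)
      from this[of 1 1] this[of 2 2] this[of 1 2]
      show "(R' $ 1 $ 1)\<^sup>2 + (R' $ 1 $ 2)\<^sup>2 = (k\<^sup>2 + l\<^sup>2) / 2"
        "(R' $ 2 $ 2)\<^sup>2 + (R' $ 1 $ 2)\<^sup>2 = (k\<^sup>2 + l\<^sup>2) / 2"
        "R' $ 1 $ 2 * (R' $ 1 $ 1 + R' $ 2 $ 2) = (k\<^sup>2 - l\<^sup>2) / 2"
        by (simp_all add: matrix_matrix_mult_def sum_2 sym power2_eq_square distrib_left mult.commute add.commute)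
    qed (fact p kl(1,2))+
    then show ?thesis
      using sym by (simp add: vec_eq_iff forall_2 R0_def)
  qed
  have "R = R0"
    unfolding R_def matrix_inv_sqrt_def using R0 pos unique by (intro the_equality) blast+
  then show "pos_def_matrix R" "R ** R = matrix_inv (corr_matrix \<rho>)"
    using R0 pos by simp_all
qed

text \<open>The root is symmetric, so one factor moves across the inner product and the square
  appears. At \<theta> this identifies \<open>2 * B\<close> with
  \<open>A \<bullet> \<theta>\<close>, the normalisation that makes \<open>Z\<close> a Gaussian
  tilt.\<close>

lemma norm_matrix_inv_sqrt_corr_matrix:
  assumes "pos_def_matrix (corr_matrix \<rho>)"
  shows "(norm (matrix_inv_sqrt (corr_matrix \<rho>) *v x))\<^sup>2 = x \<bullet> (matrix_inv (corr_matrix \<rho>) *v x)"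
proof -
  let ?R = "matrix_inv_sqrt (corr_matrix \<rho>)"
  note R = matrix_inv_sqrt_corr_matrix[OF pos_def_corr_matrixD[OF assms]]
  have "transpose ?R = ?R"
    using R(1) by (simp add: pos_def_matrix_def)
  then have "(?R *v x) \<bullet> (?R *v x) = x \<bullet> (?R *v (?R *v x))"
    by (metis dot_lmul_matrix vector_transpose_matrix)
  then show ?thesis
    by (simp add: power2_norm_eq_inner R(2)[symmetric] matrix_vector_mul_assoc)
qed

section \<open>Riemann sums and convergence in probability\<close>

text \<open>The primitive \<open>F\<close> splits the integral over the partition intervals. On each
  of them the mean value theorem and uniform continuity bound the error by \<open>e'\<close> times
  the length.\<close>

lemma uniform_riemann_sums_tendsto:
  fixes f :: "real \<Rightarrow> real"
  assumes t: "0 \<le> t" and f: "continuous_on {0..t} f"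
  shows "(\<lambda>n. \<Sum>i<Suc n. f (t * real i / real (Suc n)) * (t / real (Suc n)))
    \<longlonglongrightarrow> (LBINT u=ereal 0..ereal t. f u)"
proof (rule metric_LIMSEQ_I)
  define \<pi> where "\<pi> n i = t * real i / real (Suc n)" for n i
  define F where "F x = integral {0..x} f" for x
  have F: "(F has_derivative (\<lambda>h. h * f x)) (at x within {0..t})" if "x \<in> {0..t}" for x
    using integral_has_vector_derivative[OF f that]
    by (simp add: F_def[abs_def] has_vector_derivative_def)
  have "set_integrable lborel {0..t} f"
    using borel_integrable_atLeastAtMost'[OF f] .
  then have int: "(LBINT u=ereal 0..ereal t. f u) = F t"
    using t by (simp add: F_def interval_integral_eq_integral)
  fix e :: real assume "0 < e"
  \<comment> \<open>The denominator is \<open>t + 1\<close> because \<open>t\<close> may be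
    0.\<close>
  define e' where "e' = e / (t + 1) / 2"
  have e': "0 < e'" "e' * t < e"
    using \<open>0 < e\<close> t by (simp_all add: e'_def field_simps) (simp add: add_nonneg_pos)
  have "uniformly_continuous_on {0..t} f"
    using f by (simp add: compact_uniformly_continuous)
  then obtain d where d: "0 < d"
    "\<And>x y. x \<in> {0..t} \<Longrightarrow> y \<in> {0..t} \<Longrightarrow> dist y x < d \<Longrightarrow> dist (f y) (f x) < e'"
    unfolding uniformly_continuous_on_def using e'(1) by blast
  obtain N :: nat where N: "t / d < real N"
    using reals_Archimedean2 by blast
  have "dist (\<Sum>i<Suc n. f (\<pi> n i) * (t / real (Suc n))) (F t) < e" if "N \<le> n" for n
  proof -
    let ?D = "t / real (Suc n)"
    have "t / d < real (Suc n)"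
      using N that by linarith
    then have D: "?D < d" "0 \<le> ?D"
      using d(1) t by (simp_all add: field_simps)
    have step: "\<bar>F (\<pi> n (Suc i)) - F (\<pi> n i) - f (\<pi> n i) * ?D\<bar> \<le> e' * ?D" if "i < Suc n" for i
    proof -
      have diff: "\<pi> n (Suc i) - \<pi> n i = ?D"
        by (simp add: \<pi>_def diff_divide_distrib[symmetric] distrib_left)
      then have le: "\<pi> n i \<le> \<pi> n (Suc i)"
        using D(2) by linarith
      have "t * real (Suc i) \<le> t * real (Suc n)"
        using t that by (intro mult_left_mono) auto
      then have in0t: "0 \<le> \<pi> n i" "\<pi> n (Suc i) \<le> t"
        using t by (simp_all add: \<pi>_def field_simps)
      obtain x where x: "x \<in> {\<pi> n i..\<pi> n (Suc i)}"
        "F (\<pi> n (Suc i)) - F (\<pi> n i) = (\<pi> n (Suc i) - \<pi> n i) * f x"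
        using mvt_very_simple[of "\<pi> n i" "\<pi> n (Suc i)" F "\<lambda>x h. h * f x"] le in0t
        by (smt (verit) F atLeastAtMost_iff has_derivative_subset subsetI)
      have "dist (f x) (f (\<pi> n i)) < e'"
        using x(1) D diff le in0t by (intro d(2)) (auto simp: dist_real_def)
      then have "\<bar>(f x - f (\<pi> n i)) * ?D\<bar> \<le> e' * ?D"
        unfolding abs_mult abs_of_nonneg[OF D(2)] using D(2)
        by (intro mult_right_mono) (auto simp: dist_real_def)
      then show ?thesis
        unfolding x(2) diff by (simp add: algebra_simps)
    qed
    have "F t = (\<Sum>i<Suc n. F (\<pi> n (Suc i)) - F (\<pi> n i))"
      by (subst sum_lessThan_telescope) (simp add: \<pi>_def F_def)
    then have "\<bar>F t - (\<Sum>i<Suc n. f (\<pi> n i) * ?D)\<bar>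
        = \<bar>\<Sum>i<Suc n. F (\<pi> n (Suc i)) - F (\<pi> n i) - f (\<pi> n i) * ?D\<bar>"
      by (simp only: sum_subtractf)
    also have "\<dots> \<le> (\<Sum>i<Suc n. e' * ?D)"
      using step by (intro order_trans[OF sum_abs] sum_mono) auto
    also have "\<dots> = e' * t"
      by (simp add: field_simps)
    finally show ?thesis
      using e'(2) by (simp add: dist_real_def abs_minus_commute)
  qed
  then show "\<exists>N. \<forall>n\<ge>N. dist (\<Sum>i<Suc n. f (t * real i / real (Suc n)) * (t / real (Suc n)))
      (LBINT u=ereal 0..ereal t. f u) < e"
    unfolding int \<pi>_def by blast
qed

text \<open>The Ito integral is specified through all vanishing partitions, and the Euler sums need
  this instance. The count \<open>Suc n\<close> avoids a partition with no intervals.\<close>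

lemma vanishing_uniform_partitions:
  assumes "0 \<le> t"
  shows "vanishing_partitions t Suc (\<lambda>n i. t * real i / real (Suc n))"
  unfolding vanishing_partitions_def
proof (intro conjI allI impI)
  fix k i show "t * real i / real (Suc k) \<le> t * real (Suc i) / real (Suc k)"
    using assms by (intro divide_right_mono mult_left_mono) auto
next
  fix \<delta> :: real assume "0 < \<delta>"
  have "(\<lambda>k. t / real (Suc k)) \<longlonglongrightarrow> 0"
    by (rule LIMSEQ_Suc) (rule lim_const_over_n)
  then have "\<forall>\<^sub>F k in sequentially. t / real (Suc k) < \<delta>"
    using \<open>0 < \<delta>\<close> by (rule order_tendstoD(2))
  then show "\<forall>\<^sub>F k in sequentially. \<forall>i<Suc k. t * real (Suc i) / real (Suc k) - t * real i / real (Suc k) < \<delta>"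
    by eventually_elim (simp add: diff_divide_distrib[symmetric] distrib_left)
qed auto

text \<open>Dominated convergence for the indicators of the exceptional events, which are eventually
  0 along almost every path.\<close>

lemma (in prob_space) AE_tendsto_imp_in_prob:
  fixes X :: "nat \<Rightarrow> 'a \<Rightarrow> real"
  assumes [measurable]: "\<And>n. X n \<in> borel_measurable M"
    and lim: "AE \<omega> in M. (\<lambda>n. X n \<omega>) \<longlonglongrightarrow> 0" and "0 < \<delta>"
  shows "(\<lambda>n. prob {\<omega> \<in> space M. \<delta> < \<bar>X n \<omega>\<bar>}) \<longlonglongrightarrow> 0"
proof -
  have "(\<lambda>n. \<integral>\<omega>. indicator {\<omega> \<in> space M. \<delta> < \<bar>X n \<omega>\<bar>} \<omega> \<partial>M) \<longlonglongrightarrow> (\<integral>\<omega>. (0::real) \<partial>M)"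
  proof (rule integral_dominated_convergence[where w="\<lambda>_. 1"])
    show "AE \<omega> in M. (\<lambda>n. indicator {\<omega> \<in> space M. \<delta> < \<bar>X n \<omega>\<bar>} \<omega> :: real) \<longlonglongrightarrow> 0"
      using lim
    proof eventually_elim
      fix \<omega> assume "(\<lambda>n. X n \<omega>) \<longlonglongrightarrow> 0"
      then have "(\<lambda>n. \<bar>X n \<omega>\<bar>) \<longlonglongrightarrow> 0"
        by (rule tendsto_rabs_zero)
      then have "\<forall>\<^sub>F n in sequentially. \<bar>X n \<omega>\<bar> < \<delta>"
        using \<open>0 < \<delta>\<close> by (rule order_tendstoD(2))
      then show "(\<lambda>n. indicator {\<omega> \<in> space M. \<delta> < \<bar>X n \<omega>\<bar>} \<omega> :: real) \<longlonglongrightarrow> 0"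
        by (intro tendsto_eventually) (auto elim!: eventually_mono)
    qed
  qed (auto split: split_indicator)
  then show ?thesis
    by simp
qed

text \<open>The preimages under \<open>V\<close> already form a sigma-algebra, so it contains the
  one generated by \<open>h (V \<omega>)\<close>. Independence thus passes to \<xi> and
  \<open>h (V \<omega>)\<close>, and the product rule for independent variables applies.\<close>

lemma (in prob_space) indep_set_expectation_mult:
  fixes V :: "'a \<Rightarrow> 'b::topological_space" and \<xi> :: "'a \<Rightarrow> real"
  assumes G: "subalgebra M G" and V [measurable]: "V \<in> borel_measurable M"
    and indep: "indep_set (sets G) {V -` U \<inter> space M | U. U \<in> sets borel}"
    and \<xi>: "\<xi> \<in> borel_measurable G" and h [measurable]: "h \<in> borel_measurable borel"
    and int: "integrable M \<xi>" "integrable M (\<lambda>\<omega>. h (V \<omega>))"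
  shows "integrable M (\<lambda>\<omega>. \<xi> \<omega> * h (V \<omega>))"
    and "expectation (\<lambda>\<omega>. \<xi> \<omega> * h (V \<omega>)) = expectation \<xi> * expectation (\<lambda>\<omega>. h (V \<omega>) :: real)"
proof -
  have spG: "space G = space M"
    using G by (simp add: subalgebra_def)
  have \<xi>M [measurable]: "\<xi> \<in> borel_measurable M"
    using G \<xi> by (rule measurable_from_subalg)
  have "indep_var borel \<xi> borel (\<lambda>\<omega>. h (V \<omega>))"
    unfolding indep_var_eq
  proof (intro conjI)
    have 1: "sigma_sets (space M) {\<xi> -` A \<inter> space M | A. A \<in> sets borel} \<subseteq> sets G"
      using measurable_sets[OF \<xi>] by (auto simp: spG[symmetric] intro!: sets.sigma_sets_subset)
    have "sigma_algebra (space M) {V -` U \<inter> space M | U. U \<in> sets borel}"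
      using sets.sigma_algebra_axioms[of "vimage_algebra (space M) V borel"]
      by (simp add: sets_vimage_algebra2)
    then have 2: "sigma_sets (space M) {(\<lambda>\<omega>. h (V \<omega>)) -` A \<inter> space M | A. A \<in> sets borel}
        \<subseteq> {V -` U \<inter> space M | U. U \<in> sets borel}"
    proof (rule sigma_algebra.sigma_sets_subset, safe)
      fix A :: "real set" assume "A \<in> sets borel"
      then have "h -` A \<in> sets borel"
        using measurable_sets[OF h] by fastforce
      then show "\<exists>U. (\<lambda>\<omega>. h (V \<omega>)) -` A \<inter> space M = V -` U \<inter> space M \<and> U \<in> sets borel"
        by (intro exI[of _ "h -` A"]) auto
    qed
    show "indep_set (sigma_sets (space M) {\<xi> -` A \<inter> space M | A. A \<in> sets borel})
        (sigma_sets (space M) {(\<lambda>\<omega>. h (V \<omega>)) -` A \<inter> space M | A. A \<in> sets borel})"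
      using indep 1 2 unfolding indep_set_def
      by (rule_tac indep_sets_mono_sets) (auto split: bool.split)
  qed auto
  then show "integrable M (\<lambda>\<omega>. \<xi> \<omega> * h (V \<omega>))"
    "expectation (\<lambda>\<omega>. \<xi> \<omega> * h (V \<omega>)) = expectation \<xi> * expectation (\<lambda>\<omega>. h (V \<omega>))"
    using int by (auto intro: indep_var_integrable indep_var_lebesgue_integral)
qed

section \<open>Elementary estimates for sums and mean squares\<close>

lemma sum_square_le:
  fixes a :: "nat \<Rightarrow> real"
  shows "(\<Sum>i<n. a i)\<^sup>2 \<le> real n * (\<Sum>i<n. (a i)\<^sup>2)"
  using Cauchy_Schwarz_ineq_sum[of "\<lambda>_. 1" a "{..<n}"] by simp

lemma square_add_le: "((x::real) + y)\<^sup>2 \<le> 2 * x\<^sup>2 + 2 * y\<^sup>2"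
  using sum_squares_bound[of x y] by (simp add: power2_sum)

text \<open>Because 1 + x is at most exp x, each term is at most the increment of
  \<open>exp (l * u) / l\<close> over its interval, and the increments telescope. The factor
  \<open>1 / l\<close> is what makes the exponential weight effective in the Gronwall
  argument.\<close>

lemma left_riemann_sum_exp_le:
  fixes l t :: real
  assumes "0 < l"
  shows "(\<Sum>i<Suc n. t / real (Suc n) * exp (l * (t * real i / real (Suc n)))) \<le> exp (l * t) / l"
proof -
  let ?\<tau> = "\<lambda>i. t * real i / real (Suc n)" and ?D = "t / real (Suc n)"
  have "?D * exp (l * ?\<tau> i) \<le> exp (l * ?\<tau> (Suc i)) / l - exp (l * ?\<tau> i) / l" for i
  proof -
    have "?\<tau> (Suc i) = ?\<tau> i + ?D"
      by (simp add: add_divide_distrib distrib_left)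
    then have "exp (l * ?\<tau> (Suc i)) = exp (l * ?\<tau> i) * exp (l * ?D)"
      by (simp only: exp_add distrib_left)
    moreover have "exp (l * ?\<tau> i) * (1 + l * ?D) \<le> exp (l * ?\<tau> i) * exp (l * ?D)"
      by (intro mult_left_mono exp_ge_add_one_self) auto
    ultimately have "l * (?D * exp (l * ?\<tau> i)) \<le> exp (l * ?\<tau> (Suc i)) - exp (l * ?\<tau> i)"
      by (simp add: algebra_simps)
    then show ?thesis
      using \<open>0 < l\<close> by (simp only: diff_divide_distrib[symmetric] pos_le_divide_eq mult.commute)
  qed
  then have "(\<Sum>i<Suc n. ?D * exp (l * ?\<tau> i)) \<le>
      (\<Sum>i<Suc n. exp (l * ?\<tau> (Suc i)) / l - exp (l * ?\<tau> i) / l)"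
    by (rule sum_mono)
  also have "\<dots> = exp (l * t) / l - 1 / l"
    by (subst sum_lessThan_telescope) simp
  also have "\<dots> \<le> exp (l * t) / l"
    using \<open>0 < l\<close> by simp
  finally show ?thesis .
qed

text \<open>Errors of order o(\<Delta>), one for each of the \<open>Suc n\<close> steps of length
  \<Delta> = t / (n + 1), add up to o(1).\<close>

lemma tendsto_scaled_at_zero:
  fixes f :: "real \<Rightarrow> real"
  assumes "(f has_real_derivative 0) (at 0)" "f 0 = 0" "t \<noteq> 0"
  shows "(\<lambda>n. real (Suc n) * f (t / real (Suc n))) \<longlonglongrightarrow> 0"
proof -
  have "((\<lambda>x. f x / x) \<longlongrightarrow> 0) (at 0)"
    using assms(1,2) by (simp add: has_field_derivative_iff)
  moreover have "filterlim (\<lambda>n. t / real (Suc n)) (at 0) sequentially"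
    using LIMSEQ_Suc[OF lim_const_over_n[of t]] \<open>t \<noteq> 0\<close> by (simp add: filterlim_at)
  ultimately have "(\<lambda>n. f (t / real (Suc n)) / (t / real (Suc n))) \<longlonglongrightarrow> 0"
    by (rule filterlim_compose)
  from tendsto_mult_left[OF this, of t] show ?thesis
    using \<open>t \<noteq> 0\<close> by (simp add: mult.commute)
qed

lemma integrable_mult_squares:
  fixes f g :: "'a \<Rightarrow> real"
  assumes "f \<in> borel_measurable M" "g \<in> borel_measurable M"
    and "integrable M (\<lambda>\<omega>. (f \<omega>)\<^sup>2)" "integrable M (\<lambda>\<omega>. (g \<omega>)\<^sup>2)"
  shows "integrable M (\<lambda>\<omega>. f \<omega> * g \<omega>)"
proof (rule Bochner_Integration.integrable_bound[OF Bochner_Integration.integrable_add[OF assms(3,4)]])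
  have "\<bar>a * b\<bar> \<le> a\<^sup>2 + b\<^sup>2" for a b :: real
    using sum_squares_bound[of "\<bar>a\<bar>" "\<bar>b\<bar>"] abs_ge_zero[of "a * b"] unfolding abs_mult power2_abs by linarith
  then show "AE \<omega> in M. norm (f \<omega> * g \<omega>) \<le> norm ((f \<omega>)\<^sup>2 + (g \<omega>)\<^sup>2)"
    by (intro AE_I2) simp
qed (use assms in measurable)

text \<open>Chebyshev's inequality: the indicator of the event is at most
  \<open>(U n \<omega>)\<^sup>2 / \<delta>\<^sup>2\<close>.\<close>

lemma (in prob_space) mean_square_tendsto_imp_in_prob:
  fixes U :: "nat \<Rightarrow> 'a \<Rightarrow> real"
  assumes [measurable]: "\<And>n. U n \<in> borel_measurable M"
    and int: "\<And>n. integrable M (\<lambda>\<omega>. (U n \<omega>)\<^sup>2)"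
    and le: "\<And>n. expectation (\<lambda>\<omega>. (U n \<omega>)\<^sup>2) \<le> c n" and c: "c \<longlonglongrightarrow> 0" and "0 < \<delta>"
  shows "(\<lambda>n. prob {\<omega> \<in> space M. \<delta> < \<bar>U n \<omega>\<bar>}) \<longlonglongrightarrow> 0"
proof (rule tendsto_sandwich[where f="\<lambda>_. 0" and h="\<lambda>n. c n / \<delta>\<^sup>2"])
  show "\<forall>\<^sub>F n in sequentially. prob {\<omega> \<in> space M. \<delta> < \<bar>U n \<omega>\<bar>} \<le> c n / \<delta>\<^sup>2"
  proof (intro always_eventually allI)
    fix n
    let ?A = "{\<omega> \<in> space M. \<delta> < \<bar>U n \<omega>\<bar>}"
    have "prob ?A = expectation (indicator ?A)"
      by simp
    also have "\<dots> \<le> expectation (\<lambda>\<omega>. (U n \<omega>)\<^sup>2 / \<delta>\<^sup>2)"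
    proof (rule integral_mono)
      fix \<omega> assume "\<omega> \<in> space M"
      have "1 \<le> (U n \<omega>)\<^sup>2 / \<delta>\<^sup>2" if "\<delta> < \<bar>U n \<omega>\<bar>"
        using that \<open>0 < \<delta>\<close> power_mono[of \<delta> "\<bar>U n \<omega>\<bar>" 2] by simp
      then show "indicator ?A \<omega> \<le> (U n \<omega>)\<^sup>2 / \<delta>\<^sup>2"
        by (auto split: split_indicator)
    next
      show "integrable M (indicator ?A :: 'a \<Rightarrow> real)"
        by (intro integrable_real_indicator) (auto simp: emeasure_eq_measure)
    qed (use int in auto)
    also have "\<dots> \<le> c n / \<delta>\<^sup>2"
      using le[of n] by (simp add: divide_right_mono)
    finally show "prob ?A \<le> c n / \<delta>\<^sup>2" .
  qed
  show "(\<lambda>n. c n / \<delta>\<^sup>2) \<longlonglongrightarrow> 0"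
    using c by (rule tendsto_divide_zero)
qed auto

lemma (in prob_space) tendsto_in_prob_diff:
  fixes U V :: "nat \<Rightarrow> 'a \<Rightarrow> real"
  assumes [measurable]: "\<And>n. U n \<in> borel_measurable M" "\<And>n. V n \<in> borel_measurable M"
    and lim: "(\<lambda>n. prob {\<omega> \<in> space M. \<delta> / 2 < \<bar>U n \<omega>\<bar>}) \<longlonglongrightarrow> 0"
      "(\<lambda>n. prob {\<omega> \<in> space M. \<delta> / 2 < \<bar>V n \<omega>\<bar>}) \<longlonglongrightarrow> 0"
  shows "(\<lambda>n. prob {\<omega> \<in> space M. \<delta> < \<bar>U n \<omega> - V n \<omega>\<bar>}) \<longlonglongrightarrow> 0"
proof (rule tendsto_sandwich[where f="\<lambda>_. 0"])
  let ?A = "\<lambda>n. {\<omega> \<in> space M. \<delta> / 2 < \<bar>U n \<omega>\<bar>}" and ?B = "\<lambda>n. {\<omega> \<in> space M. \<delta> / 2 < \<bar>V n \<omega>\<bar>}"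
  show "(\<lambda>n. prob (?A n) + prob (?B n)) \<longlonglongrightarrow> 0"
    using tendsto_add[OF lim] by simp
  have AB: "?A n \<in> events" "?B n \<in> events" for n
    by measurable
  have split: "\<delta> / 2 < \<bar>y\<bar> \<or> \<delta> / 2 < \<bar>z\<bar>" if "\<delta> < \<bar>y - z\<bar>" for y z :: real
    using that by linarith
  have "prob {\<omega> \<in> space M. \<delta> < \<bar>U n \<omega> - V n \<omega>\<bar>} \<le> prob (?A n \<union> ?B n)" for n
    using AB by (intro finite_measure_mono) (use split in blast)+
  then show "\<forall>\<^sub>F n in sequentially. prob {\<omega> \<in> space M. \<delta> < \<bar>U n \<omega> - V n \<omega>\<bar>} \<le> prob (?A n) + prob (?B n)"
    using measure_Un_le[OF AB] by (intro always_eventually allI) (rule order_trans)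
qed auto

section \<open>Geometric Brownian motion\<close>

text \<open>Each stock is driven by a single coordinate of \<open>W\<close>, while its price is
  adapted to a filtration common to both coordinates. The vector process is therefore kept, with its
  independence from \<open>F s\<close>, and one coordinate of unit variance is singled out.\<close>

locale scalar_brownian = prob_space M for M :: "'a measure" +
  fixes F :: "real \<Rightarrow> 'a measure" and T :: real and Q :: "real^'n^'n"
    and W :: "real \<Rightarrow> 'a \<Rightarrow> real^'n" and k :: 'n
  assumes filt: "filtration (space M) F" and subalg: "\<And>t. subalgebra M (F t)"
    and wiener: "wiener_process M F T Q W" and unit_variance: "Q $ k $ k = 1" and T_pos: "0 < T"
begin

section \<open>Increments of one Brownian coordinate\<close>

definition w :: "real \<Rightarrow> 'a \<Rightarrow> real" where
  "w t \<omega> = W t \<omega> $ k"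

lemma F_measurable_mono:
  "s \<le> t \<Longrightarrow> f \<in> borel_measurable (F s) \<Longrightarrow> f \<in> borel_measurable (F t)"
  using filtration.sets_F_mono[OF filt, of s t] filtration.space_F[OF filt]
  by (intro measurable_from_subalg[of "F t" "F s" f]) (auto simp: subalgebra_def)

lemma F_measurable_M: "f \<in> borel_measurable (F t) \<Longrightarrow> f \<in> borel_measurable M"
  using subalg by (rule measurable_from_subalg)

lemma W_measurable: "t \<in> {0..T} \<Longrightarrow> W t \<in> borel_measurable (F t)"
  using wiener by (simp add: wiener_process_def adapted_continuous_def)

lemma w_measurable: "t \<in> {0..T} \<Longrightarrow> w t \<in> borel_measurable (F t)"
  unfolding w_def[abs_def] using W_measurable
  by (intro borel_measurable_continuous_on[where f="\<lambda>x. x $ k"]) (auto intro!: continuous_intros)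

lemma increment_measurable:
  assumes "0 \<le> s" "s \<le> t" "t \<le> T"
  shows "(\<lambda>\<omega>. w t \<omega> - w s \<omega>) \<in> borel_measurable (F t)"
  using assms w_measurable by (intro borel_measurable_diff) (auto intro: F_measurable_mono[of s t])

text \<open>Independence of increments enters all later estimates in this form: what is known at
  time \<open>s\<close> factors out of the expectation.\<close>

lemma increment_mult:
  fixes \<xi> :: "'a \<Rightarrow> real" and h :: "real \<Rightarrow> real"
  assumes st: "0 \<le> s" "s \<le> t" "t \<le> T"
    and \<xi>: "\<xi> \<in> borel_measurable (F s)" "integrable M \<xi>"
    and h: "h \<in> borel_measurable borel" "integrable M (\<lambda>\<omega>. h (w t \<omega> - w s \<omega>))"
  shows "integrable M (\<lambda>\<omega>. \<xi> \<omega> * h (w t \<omega> - w s \<omega>))"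
    and "expectation (\<lambda>\<omega>. \<xi> \<omega> * h (w t \<omega> - w s \<omega>)) =
      expectation \<xi> * expectation (\<lambda>\<omega>. h (w t \<omega> - w s \<omega>))"
proof -
  let ?V = "\<lambda>\<omega>. W t \<omega> - W s \<omega>"
  have nv: "normal_vector M ?V 0 ((t - s) *\<^sub>R Q)"
    and ind: "indep_set (sets (F s)) {?V -` U \<inter> space M | U. U \<in> sets borel}"
    using wiener st unfolding wiener_process_def by auto
  have V: "?V \<in> borel_measurable M"
    using nv by (simp add: normal_vector_def)
  have h': "(\<lambda>v. h (v $ k)) \<in> borel_measurable borel"
    using h(1) by measurable
  show "integrable M (\<lambda>\<omega>. \<xi> \<omega> * h (w t \<omega> - w s \<omega>))"
    "expectation (\<lambda>\<omega>. \<xi> \<omega> * h (w t \<omega> - w s \<omega>)) =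
      expectation \<xi> * expectation (\<lambda>\<omega>. h (w t \<omega> - w s \<omega>))"
    using indep_set_expectation_mult[OF subalg V ind \<xi>(1) h' \<xi>(2)] h(2) by (simp_all add: w_def)
qed

lemma increment_moments:
  assumes st: "0 \<le> s" "s \<le> t" "t \<le> T"
  defines "y \<equiv> (\<lambda>l \<omega>. l * (w t \<omega> - w s \<omega>))"
  shows "integrable M (\<lambda>\<omega>. exp (y l \<omega>))"
    and "expectation (\<lambda>\<omega>. exp (y l \<omega>)) = exp (l\<^sup>2 * (t - s) / 2)"
    and "integrable M (y l)"
    and "expectation (y l) = 0"
    and "integrable M (\<lambda>\<omega>. (y l \<omega>)\<^sup>2)"
    and "expectation (\<lambda>\<omega>. (y l \<omega>)\<^sup>2) \<le> 2 * (exp (l\<^sup>2 * (t - s) / 2) - 1)"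
    and "integrable M (\<lambda>\<omega>. exp (y l \<omega>) * y l \<omega>)"
    and "expectation (\<lambda>\<omega>. exp (y l \<omega>) * y l \<omega>) = l\<^sup>2 * (t - s) * exp (l\<^sup>2 * (t - s) / 2)"
proof -
  have nv: "normal_vector M (\<lambda>\<omega>. W t \<omega> - W s \<omega>) 0 ((t - s) *\<^sub>R Q)"
    using wiener st unfolding wiener_process_def by auto
  have y: "axis k l \<bullet> (W t \<omega> - W s \<omega>) = y l \<omega>" for \<omega>
    by (simp add: inner_axis' y_def w_def)
  have "(((t - s) *\<^sub>R Q) *v axis k l) $ k = (t - s) * l"
    by (simp add: matrix_vector_mult_def axis_def if_distrib unit_variance cong: if_cong)
  then have "axis k l \<bullet> (((t - s) *\<^sub>R Q) *v axis k l) = l\<^sup>2 * (t - s)"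
    by (simp add: inner_axis' power2_eq_square)
  note normal_vector_moments[OF prob_space_axioms nv, of "axis k l", unfolded this y]
  then show "integrable M (\<lambda>\<omega>. exp (y l \<omega>))"
    "expectation (\<lambda>\<omega>. exp (y l \<omega>)) = exp (l\<^sup>2 * (t - s) / 2)"
    "integrable M (y l)" "expectation (y l) = 0" "integrable M (\<lambda>\<omega>. (y l \<omega>)\<^sup>2)"
    "expectation (\<lambda>\<omega>. (y l \<omega>)\<^sup>2) \<le> 2 * (exp (l\<^sup>2 * (t - s) / 2) - 1)"
    "integrable M (\<lambda>\<omega>. exp (y l \<omega>) * y l \<omega>)"
    "expectation (\<lambda>\<omega>. exp (y l \<omega>) * y l \<omega>) = l\<^sup>2 * (t - s) * exp (l\<^sup>2 * (t - s) / 2)"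
    by simp_all
qed

text \<open>A discrete Ito isometry. When the last term is split off, the earlier sum times
  \<open>\<xi> m\<close> is known at time \<open>\<tau> m\<close>, whereas \<open>h\<close> of the
  next increment is independent of it with mean 0, so the cross term vanishes. A general
  \<open>h\<close> covers both the increment itself and the centred one-step error of the Euler
  scheme.\<close>

lemma orthogonal_increments:
  fixes \<tau> :: "nat \<Rightarrow> real" and \<xi> :: "nat \<Rightarrow> 'a \<Rightarrow> real" and h :: "real \<Rightarrow> real"
  defines "d \<equiv> (\<lambda>i \<omega>. w (\<tau> (Suc i)) \<omega> - w (\<tau> i) \<omega>)"
  assumes \<tau>: "\<And>i. i < n \<Longrightarrow> 0 \<le> \<tau> i \<and> \<tau> i \<le> \<tau> (Suc i) \<and> \<tau> (Suc i) \<le> T"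
    and \<xi>: "\<And>i. i < n \<Longrightarrow> \<xi> i \<in> borel_measurable (F (\<tau> i))"
      "\<And>i. i < n \<Longrightarrow> integrable M (\<lambda>\<omega>. (\<xi> i \<omega>)\<^sup>2)"
    and h [measurable]: "h \<in> borel_measurable borel"
    and hint: "\<And>i. i < n \<Longrightarrow> integrable M (\<lambda>\<omega>. (h (d i \<omega>))\<^sup>2)"
    and hmean: "\<And>i. i < n \<Longrightarrow> expectation (\<lambda>\<omega>. h (d i \<omega>)) = 0"
  shows "integrable M (\<lambda>\<omega>. (\<Sum>i<n. \<xi> i \<omega> * h (d i \<omega>))\<^sup>2)"
    and "expectation (\<lambda>\<omega>. (\<Sum>i<n. \<xi> i \<omega> * h (d i \<omega>))\<^sup>2) =
      (\<Sum>i<n. expectation (\<lambda>\<omega>. (\<xi> i \<omega>)\<^sup>2) * expectation (\<lambda>\<omega>. (h (d i \<omega>))\<^sup>2))"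
proof -
  let ?S = "\<lambda>m \<omega>. \<Sum>i<m. \<xi> i \<omega> * h (d i \<omega>)"
  have "?S m \<in> borel_measurable (F (\<tau> m)) \<and> integrable M (\<lambda>\<omega>. (?S m \<omega>)\<^sup>2) \<and>
      expectation (\<lambda>\<omega>. (?S m \<omega>)\<^sup>2) =
      (\<Sum>i<m. expectation (\<lambda>\<omega>. (\<xi> i \<omega>)\<^sup>2) * expectation (\<lambda>\<omega>. (h (d i \<omega>))\<^sup>2))" if "m \<le> n" for m
    using that
  proof (induction m)
    case (Suc m)
    then have m: "m < n" by simp
    note t = \<tau>[OF m, THEN conjunct1] \<tau>[OF m, THEN conjunct2, THEN conjunct1]
      \<tau>[OF m, THEN conjunct2, THEN conjunct2]
    have SF: "?S m \<in> borel_measurable (F (\<tau> m))" and Sint: "integrable M (\<lambda>\<omega>. (?S m \<omega>)\<^sup>2)"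
      and SE: "expectation (\<lambda>\<omega>. (?S m \<omega>)\<^sup>2) =
        (\<Sum>i<m. expectation (\<lambda>\<omega>. (\<xi> i \<omega>)\<^sup>2) * expectation (\<lambda>\<omega>. (h (d i \<omega>))\<^sup>2))"
      using Suc by auto
    have dF: "d m \<in> borel_measurable (F (\<tau> (Suc m)))"
      unfolding d_def using t by (rule increment_measurable)
    have hM: "(\<lambda>\<omega>. h (d m \<omega>)) \<in> borel_measurable M"
      using F_measurable_M[OF dF] by measurable
    have \<eta>int: "integrable M (\<lambda>\<omega>. h (d m \<omega>))"
      using hM hint[OF m] by (rule square_integrable_imp_integrable)
    have SM: "?S m \<in> borel_measurable M" "\<xi> m \<in> borel_measurable M"
      using F_measurable_M SF \<xi>(1)[OF m] by blast+
    have S\<xi>: "integrable M (\<lambda>\<omega>. ?S m \<omega> * \<xi> m \<omega>)"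
      using SM Sint \<xi>(2)[OF m] by (rule integrable_mult_squares)
    have cross: "integrable M (\<lambda>\<omega>. (?S m \<omega> * \<xi> m \<omega>) * h (d m \<omega>))"
      "expectation (\<lambda>\<omega>. (?S m \<omega> * \<xi> m \<omega>) * h (d m \<omega>)) = 0"
      using increment_mult[OF t _ S\<xi> h] \<eta>int SF \<xi>(1)[OF m] hmean[OF m] by (simp_all add: d_def)
    have sq: "integrable M (\<lambda>\<omega>. (\<xi> m \<omega>)\<^sup>2 * (h (d m \<omega>))\<^sup>2)"
      "expectation (\<lambda>\<omega>. (\<xi> m \<omega>)\<^sup>2 * (h (d m \<omega>))\<^sup>2) =
        expectation (\<lambda>\<omega>. (\<xi> m \<omega>)\<^sup>2) * expectation (\<lambda>\<omega>. (h (d m \<omega>))\<^sup>2)"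
      using increment_mult[OF t _ \<xi>(2)[OF m], of "\<lambda>x. (h x)\<^sup>2"] \<xi>(1)[OF m] hint[OF m]
      by (simp_all add: d_def)
    have eq: "(?S (Suc m) \<omega>)\<^sup>2 = (?S m \<omega>)\<^sup>2 + 2 * ((?S m \<omega> * \<xi> m \<omega>) * h (d m \<omega>)) +
        (\<xi> m \<omega>)\<^sup>2 * (h (d m \<omega>))\<^sup>2" for \<omega>
      by (simp add: power2_sum power_mult_distrib)
    have "?S (Suc m) \<in> borel_measurable (F (\<tau> (Suc m)))"
      using dF F_measurable_mono[OF t(2) SF] F_measurable_mono[OF t(2) \<xi>(1)[OF m]] by simp
    then show ?case
      unfolding eq using Sint SE cross sq by simp
  qed simp
  then show "integrable M (\<lambda>\<omega>. (?S n \<omega>)\<^sup>2)" "expectation (\<lambda>\<omega>. (?S n \<omega>)\<^sup>2) =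
      (\<Sum>i<n. expectation (\<lambda>\<omega>. (\<xi> i \<omega>)\<^sup>2) * expectation (\<lambda>\<omega>. (h (d i \<omega>))\<^sup>2))"
    by simp_all
qed

section \<open>Euler sums and geometric Brownian motion\<close>

definition euler_sum :: "real \<Rightarrow> real \<Rightarrow> (real \<Rightarrow> 'a \<Rightarrow> real) \<Rightarrow> real \<Rightarrow> nat \<Rightarrow> 'a \<Rightarrow> real" where
  "euler_sum \<alpha> \<sigma> X t n \<omega> =
    (\<Sum>i<Suc n. \<alpha> * X (t * real i / real (Suc n)) \<omega> * (t / real (Suc n)) +
      \<sigma> * X (t * real i / real (Suc n)) \<omega> *
        (w (t * real (Suc i) / real (Suc n)) \<omega> - w (t * real i / real (Suc n)) \<omega>))"

lemma uniform_partition: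
  assumes "0 < t" "t \<le> T" "i < Suc n"
  shows "0 \<le> t * real i / real (Suc n)"
    and "t * real i / real (Suc n) \<le> t * real (Suc i) / real (Suc n)"
    and "t * real (Suc i) / real (Suc n) \<le> t"
    and "t * real (Suc i) / real (Suc n) \<le> T"
    and "t * real (Suc i) / real (Suc n) - t * real i / real (Suc n) = t / real (Suc n)"
proof -
  show "0 \<le> t * real i / real (Suc n)"
    using assms by simp
  show d: "t * real (Suc i) / real (Suc n) - t * real i / real (Suc n) = t / real (Suc n)"
    by (simp add: diff_divide_distrib[symmetric] distrib_left)
  have "0 \<le> t / real (Suc n)"
    using assms by simp
  then show "t * real i / real (Suc n) \<le> t * real (Suc i) / real (Suc n)"
    using d by linarith
  have "t * real (Suc i) \<le> t * real (Suc n)"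
    using assms by (intro mult_left_mono) auto
  then show "t * real (Suc i) / real (Suc n) \<le> t"
    by (simp add: pos_divide_le_eq)
  then show "t * real (Suc i) / real (Suc n) \<le> T"
    using assms by linarith
qed

lemma euler_sum_measurable:
  assumes X: "\<And>u. u \<in> {0..T} \<Longrightarrow> X u \<in> borel_measurable (F u)" and t: "0 < t" "t \<le> T"
  shows "euler_sum \<alpha> \<sigma> X t n \<in> borel_measurable M"
proof -
  have "X (t * real i / real (Suc n)) \<in> borel_measurable M"
    "(\<lambda>\<omega>. w (t * real (Suc i) / real (Suc n)) \<omega> - w (t * real i / real (Suc n)) \<omega>) \<in> borel_measurable M"
    if "i < Suc n" for i
    using uniform_partition[OF t that] by (auto intro!: F_measurable_M[OF X] F_measurable_M[OF increment_measurable]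
        simp del: of_nat_Suc)
  then show ?thesis
    unfolding euler_sum_def[abs_def] by (intro borel_measurable_sum borel_measurable_add borel_measurable_times) auto
qed

text \<open>The increment from time 0 stands in place of \<open>w t \<omega>\<close> because
  \<open>W 0\<close> vanishes only almost surely. In this way the process starts at \<open>x\<close>
  on every path, and its difference from \<open>S\<close> starts at 0 on every path.\<close>

definition gbm :: "real \<Rightarrow> real \<Rightarrow> real \<Rightarrow> real \<Rightarrow> 'a \<Rightarrow> real" where
  "gbm x \<alpha> \<sigma> t \<omega> = x * exp ((\<alpha> - \<sigma>\<^sup>2 / 2) * t + \<sigma> * (w t \<omega> - w 0 \<omega>))"

lemma gbm_measurable: "t \<in> {0..T} \<Longrightarrow> gbm x \<alpha> \<sigma> t \<in> borel_measurable (F t)"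
  using increment_measurable[of 0 t] unfolding gbm_def[abs_def] by simp

lemma gbm_second_moment:
  assumes "t \<in> {0..T}"
  shows "integrable M (\<lambda>\<omega>. (gbm x \<alpha> \<sigma> t \<omega>)\<^sup>2)"
    and "expectation (\<lambda>\<omega>. (gbm x \<alpha> \<sigma> t \<omega>)\<^sup>2) = x\<^sup>2 * exp ((2 * \<alpha> + \<sigma>\<^sup>2) * t)"
proof -
  have eq: "(gbm x \<alpha> \<sigma> t \<omega>)\<^sup>2 =
      x\<^sup>2 * exp ((2 * \<alpha> - \<sigma>\<^sup>2) * t) * exp (2 * \<sigma> * (w t \<omega> - w 0 \<omega>))" for \<omega>
    by (simp add: gbm_def power_mult_distrib exp_add[symmetric] exp_double[symmetric] algebra_simps)
  have mom: "integrable M (\<lambda>\<omega>. exp (2 * \<sigma> * (w t \<omega> - w 0 \<omega>)))"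
    "expectation (\<lambda>\<omega>. exp (2 * \<sigma> * (w t \<omega> - w 0 \<omega>))) = exp ((2 * \<sigma>)\<^sup>2 * (t - 0) / 2)"
    using increment_moments(1,2)[of 0 t "2 * \<sigma>"] assms by auto
  show "integrable M (\<lambda>\<omega>. (gbm x \<alpha> \<sigma> t \<omega>)\<^sup>2)"
    unfolding eq using mom(1) by (rule integrable_mult_right)
  have "exp ((2 * \<alpha> - \<sigma>\<^sup>2) * t) * exp ((2 * \<sigma>)\<^sup>2 * (t - 0) / 2) = exp ((2 * \<alpha> + \<sigma>\<^sup>2) * t)"
    by (simp add: exp_add[symmetric] power_mult_distrib algebra_simps)
  then show "expectation (\<lambda>\<omega>. (gbm x \<alpha> \<sigma> t \<omega>)\<^sup>2) = x\<^sup>2 * exp ((2 * \<alpha> + \<sigma>\<^sup>2) * t)"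
    unfolding eq using mom(2) by (simp only: integral_mult_right_zero mult.assoc)
qed

text \<open>The one-step error of the Euler scheme for \<open>gbm\<close> is \<open>gbm\<close> times a function of the
  Brownian increment whose mean and second moment are both \<open>o(\<Delta>)\<close>.\<close>

lemma gbm_step_error_moments:
  fixes \<alpha> \<sigma> :: real
  assumes st: "0 \<le> s" "s \<le> t" "t \<le> T"
  defines "\<Delta> \<equiv> t - s"
  defines "h \<equiv> (\<lambda>y. exp ((\<alpha> - \<sigma>\<^sup>2 / 2) * \<Delta> + \<sigma> * y) - 1 - \<alpha> * \<Delta> - \<sigma> * y)"
  shows "integrable M (\<lambda>\<omega>. h (w t \<omega> - w s \<omega>))"
    and "expectation (\<lambda>\<omega>. h (w t \<omega> - w s \<omega>)) = exp (\<alpha> * \<Delta>) - 1 - \<alpha> * \<Delta>"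
    and "integrable M (\<lambda>\<omega>. (h (w t \<omega> - w s \<omega>))\<^sup>2)"
    and "expectation (\<lambda>\<omega>. (h (w t \<omega> - w s \<omega>))\<^sup>2) \<le>
      exp ((2 * \<alpha> + \<sigma>\<^sup>2) * \<Delta>) + (1 + \<alpha> * \<Delta>)\<^sup>2 + 2 * (exp (\<sigma>\<^sup>2 * \<Delta> / 2) - 1)
        - 2 * (1 + \<alpha> * \<Delta>) * exp (\<alpha> * \<Delta>) - 2 * \<sigma>\<^sup>2 * \<Delta> * exp (\<alpha> * \<Delta>)"
proof -
  define y where "y \<omega> = \<sigma> * (w t \<omega> - w s \<omega>)" for \<omega>
  define c where "c = exp ((\<alpha> - \<sigma>\<^sup>2 / 2) * \<Delta>)"
  define a where "a = 1 + \<alpha> * \<Delta>"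
  note mom = increment_moments[OF st, of \<sigma>, folded \<Delta>_def, folded y_def]
  have y2: "integrable M (\<lambda>\<omega>. exp (2 * y \<omega>))"
    "expectation (\<lambda>\<omega>. exp (2 * y \<omega>)) = exp (2 * \<sigma>\<^sup>2 * \<Delta>)"
    using increment_moments(1,2)[OF st, of "2 * \<sigma>"]
    by (simp_all add: y_def mult.assoc power_mult_distrib \<Delta>_def)
  \<comment> \<open>The correction \<open>- \<sigma>\<^sup>2 / 2\<close> in \<open>c\<close> cancels
    the factor from the Laplace transform and leaves the growth rate \<alpha> for the mean and
    \<open>2 * \<alpha> + \<sigma>\<^sup>2\<close> for the second moment.\<close>
  have ce: "c * exp (\<sigma>\<^sup>2 * \<Delta> / 2) = exp (\<alpha> * \<Delta>)" "c\<^sup>2 * exp (2 * \<sigma>\<^sup>2 * \<Delta>) = exp ((2 * \<alpha> + \<sigma>\<^sup>2) * \<Delta>)"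
    by (simp_all add: c_def exp_add[symmetric] exp_double[symmetric] algebra_simps)
  have h: "h (w t \<omega> - w s \<omega>) = c * exp (y \<omega>) - a - y \<omega>" for \<omega>
    by (simp add: h_def c_def y_def a_def exp_add)
  \<comment> \<open>The mixed term \<open>exp (y \<omega>) * y \<omega>\<close> is the reason why
    that moment was computed for Gaussian vectors.\<close>
  have h2: "(h (w t \<omega> - w s \<omega>))\<^sup>2 = c\<^sup>2 * exp (2 * y \<omega>) + a\<^sup>2 + (y \<omega>)\<^sup>2 - (2 * a * c) * exp (y \<omega>)
      - (2 * c) * (exp (y \<omega>) * y \<omega>) + (2 * a) * y \<omega>" for \<omega>
    unfolding h exp_double by (simp add: power2_eq_square algebra_simps)
  show "integrable M (\<lambda>\<omega>. h (w t \<omega> - w s \<omega>))"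
    unfolding h using mom by simp
  show "expectation (\<lambda>\<omega>. h (w t \<omega> - w s \<omega>)) = exp (\<alpha> * \<Delta>) - 1 - \<alpha> * \<Delta>"
    unfolding h using mom ce prob_space by (simp add: a_def)
  show "integrable M (\<lambda>\<omega>. (h (w t \<omega> - w s \<omega>))\<^sup>2)"
    unfolding h2 using mom y2 by simp
  have "expectation (\<lambda>\<omega>. (h (w t \<omega> - w s \<omega>))\<^sup>2) =
      c\<^sup>2 * exp (2 * \<sigma>\<^sup>2 * \<Delta>) + a\<^sup>2 + expectation (\<lambda>\<omega>. (y \<omega>)\<^sup>2) - (2 * a) * (c * exp (\<sigma>\<^sup>2 * \<Delta> / 2))
      - 2 * \<sigma>\<^sup>2 * \<Delta> * (c * exp (\<sigma>\<^sup>2 * \<Delta> / 2))"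
    unfolding h2 using mom y2 prob_space by simp
  then show "expectation (\<lambda>\<omega>. (h (w t \<omega> - w s \<omega>))\<^sup>2) \<le>
      exp ((2 * \<alpha> + \<sigma>\<^sup>2) * \<Delta>) + (1 + \<alpha> * \<Delta>)\<^sup>2 + 2 * (exp (\<sigma>\<^sup>2 * \<Delta> / 2) - 1)
        - 2 * (1 + \<alpha> * \<Delta>) * exp (\<alpha> * \<Delta>) - 2 * \<sigma>\<^sup>2 * \<Delta> * exp (\<alpha> * \<Delta>)"
    unfolding ce using mom(6) by (simp add: a_def)
qed

lemma gbm_euler_error:
  assumes t: "0 < t" "t \<le> T" and "0 < \<delta>"
  shows "(\<lambda>n. prob {\<omega> \<in> space M. \<delta> < \<bar>gbm x \<alpha> \<sigma> t \<omega> - x - euler_sum \<alpha> \<sigma> (gbm x \<alpha> \<sigma>) t n \<omega>\<bar>}) \<longlonglongrightarrow> 0"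
proof -
  let ?G = "gbm x \<alpha> \<sigma>"
  \<comment> \<open>\<open>q\<close> and \<open>r\<close> are the second-moment bound and the mean
    of the one-step error as functions of the step length. Both vanish at 0 together with their
    derivatives; for \<open>q\<close> this depends on the bound for the Brownian second moment being
    exact to first order.\<close>
  define q where "q \<Delta> = exp ((2 * \<alpha> + \<sigma>\<^sup>2) * \<Delta>) + (1 + \<alpha> * \<Delta>)\<^sup>2 + 2 * (exp (\<sigma>\<^sup>2 * \<Delta> / 2) - 1)
        - 2 * (1 + \<alpha> * \<Delta>) * exp (\<alpha> * \<Delta>) - 2 * \<sigma>\<^sup>2 * \<Delta> * exp (\<alpha> * \<Delta>)" for \<Delta>
  define r where "r \<Delta> = exp (\<alpha> * \<Delta>) - 1 - \<alpha> * \<Delta>" for \<Delta>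
  \<comment> \<open>A bound for the second moment of \<open>?G\<close> on all of [0, T]; the
    absolute value covers a negative growth rate.\<close>
  define C where "C = x\<^sup>2 * exp (\<bar>2 * \<alpha> + \<sigma>\<^sup>2\<bar> * T)"
  \<comment> \<open>The centred errors are orthogonal, so their second moments add up and
    \<open>q\<close> occurs once per step. The means accumulate without cancellation, so
    \<open>r\<close> is multiplied by the number of steps before it is squared.\<close>
  define c where "c n = 2 * C * (real (Suc n) * q (t / real (Suc n))) +
    2 * C * (real (Suc n) * r (t / real (Suc n)))\<^sup>2" for n
  define U where "U n \<omega> = ?G t \<omega> - x - euler_sum \<alpha> \<sigma> ?G t n \<omega>" for n \<omega>
  have "(q has_real_derivative 0) (at 0)"
    unfolding q_def[abs_def] by (auto intro!: derivative_eq_intros simp: power2_eq_square)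
  moreover have "(r has_real_derivative 0) (at 0)"
    unfolding r_def[abs_def] by (auto intro!: derivative_eq_intros)
  ultimately have "c \<longlonglongrightarrow> 2 * C * 0 + 2 * C * 0\<^sup>2"
    unfolding c_def[abs_def] using t(1)
    by (intro tendsto_add tendsto_mult_left tendsto_power tendsto_scaled_at_zero)
      (simp_all add: q_def[of 0] r_def[of 0])
  then have c0: "c \<longlonglongrightarrow> 0" by simp
  have C: "expectation (\<lambda>\<omega>. (?G u \<omega>)\<^sup>2) \<le> C" if "u \<in> {0..T}" for u
  proof -
    have "(2 * \<alpha> + \<sigma>\<^sup>2) * u \<le> \<bar>2 * \<alpha> + \<sigma>\<^sup>2\<bar> * T"
      using that by (intro mult_mono) auto
    then show ?thesis
      using that by (simp add: gbm_second_moment C_def mult_left_mono)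
  qed
  have UM: "U n \<in> borel_measurable M" for n
    using euler_sum_measurable[OF gbm_measurable t] F_measurable_M[OF gbm_measurable] t
    unfolding U_def[abs_def] by simp
  have main: "integrable M (\<lambda>\<omega>. (U n \<omega>)\<^sup>2) \<and> expectation (\<lambda>\<omega>. (U n \<omega>)\<^sup>2) \<le> c n" for n
  proof -
    define \<Delta> where "\<Delta> = t / real (Suc n)"
    define \<tau> where "\<tau> i = t * real i / real (Suc n)" for i
    define d where "d i \<omega> = w (\<tau> (Suc i)) \<omega> - w (\<tau> i) \<omega>" for i \<omega>
    define h where "h y = exp ((\<alpha> - \<sigma>\<^sup>2 / 2) * \<Delta> + \<sigma> * y) - 1 - \<alpha> * \<Delta> - \<sigma> * y" for y
    note part = uniform_partition[OF t, of _ n, folded \<tau>_def \<Delta>_def]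
    have \<tau>T: "\<tau> i \<in> {0..T}" if "i < Suc n" for i
      using part[OF that] by simp
    have mom: "integrable M (\<lambda>\<omega>. h (d i \<omega>))" "expectation (\<lambda>\<omega>. h (d i \<omega>)) = r \<Delta>"
      "integrable M (\<lambda>\<omega>. (h (d i \<omega>))\<^sup>2)" "expectation (\<lambda>\<omega>. (h (d i \<omega>))\<^sup>2) \<le> q \<Delta>"
      if "i < Suc n" for i
      using gbm_step_error_moments[OF part(1,2,4)[OF that], of \<alpha> \<sigma>,
          unfolded part(5)[OF that], folded h_def] unfolding d_def q_def r_def
      by (simp_all add: add.commute)
    have step: "?G (\<tau> (Suc i)) \<omega> - ?G (\<tau> i) \<omega> - (\<alpha> * ?G (\<tau> i) \<omega> * \<Delta> + \<sigma> * ?G (\<tau> i) \<omega> * d i \<omega>) =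
        ?G (\<tau> i) \<omega> * h (d i \<omega>)" if "i < Suc n" for i \<omega>
    proof -
      have "\<tau> (Suc i) = \<tau> i + \<Delta>"
        using part(5)[OF that] by simp
      then have "?G (\<tau> (Suc i)) \<omega> = ?G (\<tau> i) \<omega> * exp ((\<alpha> - \<sigma>\<^sup>2 / 2) * \<Delta> + \<sigma> * d i \<omega>)"
        by (simp add: gbm_def d_def exp_add[symmetric] algebra_simps)
      then show ?thesis
        by (simp add: h_def algebra_simps)
    qed
    have "(\<Sum>i<Suc n. ?G (\<tau> (Suc i)) \<omega> - ?G (\<tau> i) \<omega>) = ?G t \<omega> - x" for \<omega>
      by (subst sum_lessThan_telescope) (simp add: \<tau>_def gbm_def)
    then have "U n \<omega> = (\<Sum>i<Suc n. ?G (\<tau> (Suc i)) \<omega> - ?G (\<tau> i) \<omega> -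
        (\<alpha> * ?G (\<tau> i) \<omega> * \<Delta> + \<sigma> * ?G (\<tau> i) \<omega> * d i \<omega>))" for \<omega>
      by (simp only: U_def euler_sum_def sum_subtractf \<tau>_def \<Delta>_def d_def)
    moreover have "(\<Sum>i<Suc n. ?G (\<tau> (Suc i)) \<omega> - ?G (\<tau> i) \<omega> -
        (\<alpha> * ?G (\<tau> i) \<omega> * \<Delta> + \<sigma> * ?G (\<tau> i) \<omega> * d i \<omega>)) = (\<Sum>i<Suc n. ?G (\<tau> i) \<omega> * h (d i \<omega>))" for \<omega>
      by (intro sum.cong refl step) auto
    \<comment> \<open>Centring each error by \<open>r \<Delta>\<close> makes the terms orthogonal.
      The removed part is handled by Cauchy-Schwarz alone.\<close>
    ultimately have U: "U n \<omega> = (\<Sum>i<Suc n. ?G (\<tau> i) \<omega> * (h (d i \<omega>) - r \<Delta>)) +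
        r \<Delta> * (\<Sum>i<Suc n. ?G (\<tau> i) \<omega>)" (is "_ = ?U1 \<omega> + r \<Delta> * ?U2 \<omega>") for \<omega>
      by (simp only: sum_distrib_left sum.distrib[symmetric]) (simp add: algebra_simps)
    have hm: "(\<lambda>y. h y - r \<Delta>) \<in> borel_measurable borel"
      unfolding h_def[abs_def] by measurable
    have h'sq: "(h (d i \<omega>) - r \<Delta>)\<^sup>2 = (h (d i \<omega>))\<^sup>2 - 2 * r \<Delta> * h (d i \<omega>) + (r \<Delta>)\<^sup>2" for i \<omega>
      by (simp add: power2_eq_square algebra_simps)
    have h': "integrable M (\<lambda>\<omega>. (h (d i \<omega>) - r \<Delta>)\<^sup>2)"
      "expectation (\<lambda>\<omega>. (h (d i \<omega>) - r \<Delta>)\<^sup>2) \<le> q \<Delta>" if "i < Suc n" for i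
    proof -
      show "integrable M (\<lambda>\<omega>. (h (d i \<omega>) - r \<Delta>)\<^sup>2)"
        unfolding h'sq using mom[OF that] by simp
      have "expectation (\<lambda>\<omega>. (h (d i \<omega>) - r \<Delta>)\<^sup>2) = expectation (\<lambda>\<omega>. (h (d i \<omega>))\<^sup>2) - (r \<Delta>)\<^sup>2"
        unfolding h'sq using mom[OF that] prob_space by (simp add: power2_eq_square)
      then show "expectation (\<lambda>\<omega>. (h (d i \<omega>) - r \<Delta>)\<^sup>2) \<le> q \<Delta>"
        using mom(4)[OF that] zero_le_power2[of "r \<Delta>"] by linarith
    qed
    have U1: "integrable M (\<lambda>\<omega>. (?U1 \<omega>)\<^sup>2)"
      "expectation (\<lambda>\<omega>. (?U1 \<omega>)\<^sup>2) = (\<Sum>i<Suc n. expectation (\<lambda>\<omega>. (?G (\<tau> i) \<omega>)\<^sup>2) *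
        expectation (\<lambda>\<omega>. (h (d i \<omega>) - r \<Delta>)\<^sup>2))"
      using orthogonal_increments[of "Suc n" \<tau> "\<lambda>i. ?G (\<tau> i)" "\<lambda>y. h y - r \<Delta>", OF _ _ _ hm, folded d_def]
        part gbm_measurable[OF \<tau>T] gbm_second_moment[OF \<tau>T] h' mom prob_space by simp_all
    have "expectation (\<lambda>\<omega>. (?U1 \<omega>)\<^sup>2) \<le> (\<Sum>i<Suc n. C * q \<Delta>)"
      unfolding U1(2) using C[OF \<tau>T] h'(2) by (intro sum_mono mult_mono) (auto simp: C_def)
    then have U1le: "expectation (\<lambda>\<omega>. (?U1 \<omega>)\<^sup>2) \<le> C * (real (Suc n) * q \<Delta>)"
      by (simp add: mult.left_commute)
    have sumG: "integrable M (\<lambda>\<omega>. \<Sum>i<Suc n. (?G (\<tau> i) \<omega>)\<^sup>2)"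
      using gbm_second_moment[OF \<tau>T] by (intro Bochner_Integration.integrable_sum) auto
    have GM: "?G (\<tau> i) \<in> borel_measurable M" if "i < Suc n" for i
      using gbm_measurable[OF \<tau>T[OF that]] by (rule F_measurable_M)
    have U2int: "integrable M (\<lambda>\<omega>. (?U2 \<omega>)\<^sup>2)"
    proof (rule Bochner_Integration.integrable_bound)
      show "integrable M (\<lambda>\<omega>. real (Suc n) * (\<Sum>i<Suc n. (?G (\<tau> i) \<omega>)\<^sup>2))"
        using sumG by (rule integrable_mult_right)
      show "AE \<omega> in M. norm ((?U2 \<omega>)\<^sup>2) \<le> norm (real (Suc n) * (\<Sum>i<Suc n. (?G (\<tau> i) \<omega>)\<^sup>2))"
        using sum_square_le[of "\<lambda>i. ?G (\<tau> i) _" "Suc n"]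
        by (intro AE_I2) (auto simp del: sum.lessThan_Suc intro: order_trans[OF _ abs_ge_self])
      show "(\<lambda>\<omega>. (?U2 \<omega>)\<^sup>2) \<in> borel_measurable M"
        using GM by (intro borel_measurable_power borel_measurable_sum) auto
    qed
    have "expectation (\<lambda>\<omega>. (?U2 \<omega>)\<^sup>2) \<le> expectation (\<lambda>\<omega>. real (Suc n) * (\<Sum>i<Suc n. (?G (\<tau> i) \<omega>)\<^sup>2))"
      using U2int sumG by (intro integral_mono sum_square_le integrable_mult_right)
    also have "\<dots> = real (Suc n) * (\<Sum>i<Suc n. expectation (\<lambda>\<omega>. (?G (\<tau> i) \<omega>)\<^sup>2))"
      using gbm_second_moment[OF \<tau>T] by (simp add: Bochner_Integration.integral_sum del: sum.lessThan_Suc)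
    also have "\<dots> \<le> real (Suc n) * (\<Sum>i<Suc n. C)"
      using C[OF \<tau>T] by (intro mult_left_mono sum_mono) auto
    finally have U2le: "expectation (\<lambda>\<omega>. (?U2 \<omega>)\<^sup>2) \<le> C * (real (Suc n))\<^sup>2"
      by (simp add: power2_eq_square mult.commute mult.left_commute)
    have bound: "(U n \<omega>)\<^sup>2 \<le> 2 * (?U1 \<omega>)\<^sup>2 + (2 * (r \<Delta>)\<^sup>2) * (?U2 \<omega>)\<^sup>2" for \<omega>
      unfolding U using sum_squares_bound[of "?U1 \<omega>" "r \<Delta> * ?U2 \<omega>"]
      by (simp add: power2_sum power_mult_distrib del: sum.lessThan_Suc)
    have bint: "integrable M (\<lambda>\<omega>. 2 * (?U1 \<omega>)\<^sup>2 + (2 * (r \<Delta>)\<^sup>2) * (?U2 \<omega>)\<^sup>2)"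
      using U1(1) U2int by (intro Bochner_Integration.integrable_add integrable_mult_right)
    have Uint: "integrable M (\<lambda>\<omega>. (U n \<omega>)\<^sup>2)"
      using bint by (rule Bochner_Integration.integrable_bound)
        (use UM bound in \<open>auto simp del: sum.lessThan_Suc intro: order_trans[OF _ abs_ge_self]\<close>)
    have "expectation (\<lambda>\<omega>. (U n \<omega>)\<^sup>2) \<le> expectation (\<lambda>\<omega>. 2 * (?U1 \<omega>)\<^sup>2 + (2 * (r \<Delta>)\<^sup>2) * (?U2 \<omega>)\<^sup>2)"
      using Uint bint bound by (rule integral_mono)
    also have "\<dots> = 2 * expectation (\<lambda>\<omega>. (?U1 \<omega>)\<^sup>2) + (2 * (r \<Delta>)\<^sup>2) * expectation (\<lambda>\<omega>. (?U2 \<omega>)\<^sup>2)"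
      using U1(1) U2int by (simp del: sum.lessThan_Suc)
    also have "\<dots> \<le> 2 * (C * (real (Suc n) * q \<Delta>)) + (2 * (r \<Delta>)\<^sup>2) * (C * (real (Suc n))\<^sup>2)"
      using U1le U2le by (intro add_mono mult_left_mono) auto
    also have "\<dots> = c n"
      by (simp add: c_def \<Delta>_def power_mult_distrib)
    finally show ?thesis
      using Uint by blast
  qed
  show ?thesis
    unfolding U_def[symmetric]
    using UM main c0 \<open>0 < \<delta>\<close> by (intro mean_square_tendsto_imp_in_prob[of U c]) auto
qed

section \<open>Localisation and uniqueness for the linear equation\<close>

definition stay :: "(real \<Rightarrow> 'a \<Rightarrow> real) \<Rightarrow> real \<Rightarrow> real \<Rightarrow> 'a set" where
  "stay D b t = {\<omega> \<in> space M. \<forall>u\<in>{0..t}. \<bar>D u \<omega>\<bar> \<le> b}"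

text \<open>By continuity it is enough to test rational times together with \<open>t\<close> itself,
  which may be irrational and has no later times in the interval to approximate it from. The events
  decrease in time and are known at time \<open>t\<close>, so they do the work of stopping at the
  exit from [-b, b].\<close>

lemma stay_sets:
  assumes D: "adapted_continuous M F T D" and t: "t \<in> {0..T}"
  shows "stay D b t \<in> sets (F t)"
proof -
  have sp: "space (F t) = space M"
    using filtration.space_F[OF filt] .
  have "stay D b t = {\<omega> \<in> space (F t). \<bar>D t \<omega>\<bar> \<le> b} \<inter>
      {\<omega> \<in> space (F t). \<forall>q\<in>\<rat> \<inter> {0..t}. \<bar>D q \<omega>\<bar> \<le> b}" (is "_ = ?A \<inter> ?B")
  proof (intro set_eqI iffI)
    fix \<omega> assume \<omega>: "\<omega> \<in> ?A \<inter> ?B"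
    have "\<bar>D u \<omega>\<bar> \<le> b" if u: "u \<in> {0..t}" for u
    proof (rule ccontr)
      assume "\<not> \<bar>D u \<omega>\<bar> \<le> b"
      then have gt: "b < \<bar>D u \<omega>\<bar>" by simp
      then have "u < t"
        using \<omega> u by (cases "u = t") auto
      have "continuous_on {0..t} (\<lambda>u. \<bar>D u \<omega>\<bar>)"
        using D \<omega> t unfolding adapted_continuous_def sp
        by (auto intro!: continuous_intros intro: continuous_on_subset)
      then have "((\<lambda>u. \<bar>D u \<omega>\<bar>) \<longlongrightarrow> \<bar>D u \<omega>\<bar>) (at u within {0..t})"
        using u by (simp add: continuous_on_def)
      then have "\<forall>\<^sub>F v in at u within {0..t}. b < \<bar>D v \<omega>\<bar>"
        using gt by (rule order_tendstoD(1))
      then obtain d where d: "0 < d" "\<And>v. v \<in> {0..t} \<Longrightarrow> v \<noteq> u \<Longrightarrow> dist v u < d \<Longrightarrow> b < \<bar>D v \<omega>\<bar>"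
        unfolding eventually_at by blast
      obtain q where q: "q \<in> \<rat>" "u < q" "q < min t (u + d)"
        using Rats_dense_in_real[of u "min t (u + d)"] \<open>u < t\<close> d(1) by auto
      then have "b < \<bar>D q \<omega>\<bar>"
        using u by (intro d(2)) (auto simp: dist_real_def)
      moreover have "q \<in> \<rat> \<inter> {0..t}"
        using q u by auto
      ultimately show False
        using \<omega> not_le by blast
    qed
    then show "\<omega> \<in> stay D b t"
      using \<omega> by (simp add: stay_def sp)
  qed (use t sp in \<open>auto simp: stay_def\<close>)
  moreover have meas: "D q \<in> borel_measurable (F t)" if "q \<in> {0..t}" for q
    using D that t unfolding adapted_continuous_def by (auto intro: F_measurable_mono[of q t])
  have "?A \<in> sets (F t)"
  proof -
    have [measurable]: "D t \<in> borel_measurable (F t)"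
      using meas t by simp
    show ?thesis by measurable
  qed
  moreover have "?B \<in> sets (F t)"
  proof (rule sets.sets_Collect_countable_All')
    show "countable (\<rat> \<inter> {0..t})"
      using countable_rat by (rule countable_subset[rotated]) auto
    fix q assume "q \<in> \<rat> \<inter> {0..t}"
    then have [measurable]: "D q \<in> borel_measurable (F t)"
      by (intro meas) auto
    show "{\<omega> \<in> space (F t). \<bar>D q \<omega>\<bar> \<le> b} \<in> sets (F t)"
      by measurable
  qed
  ultimately show ?thesis
    by (simp add: sets.Int)
qed

lemma linear_sde_unique:
  assumes D: "adapted_continuous M F T D" and D0: "\<And>\<omega>. \<omega> \<in> space M \<Longrightarrow> D 0 \<omega> = 0"
    and euler: "\<And>t \<delta>. 0 < t \<Longrightarrow> t \<le> T \<Longrightarrow> 0 < \<delta> \<Longrightarrow>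
      (\<lambda>n. prob {\<omega> \<in> space M. \<delta> < \<bar>D t \<omega> - euler_sum \<alpha> \<sigma> D t n \<omega>\<bar>}) \<longlonglongrightarrow> 0"
  shows "AE \<omega> in M. D T \<omega> = 0"
proof -
  have DF: "D u \<in> borel_measurable (F u)" if "u \<in> {0..T}" for u
    using D that by (simp add: adapted_continuous_def)
  have stopped: "AE \<omega> in M. D T \<omega> * indicator (stay D b T) \<omega> = 0" if b: "0 \<le> b" for b
  proof -
    define a where "a t \<omega> = D t \<omega> * indicator (stay D b t) \<omega>" for t \<omega>
    define g where "g t = expectation (\<lambda>\<omega>. (a t \<omega>)\<^sup>2)" for t
    \<comment> \<open>The first summand comes from the drift by Cauchy-Schwarz, the second from the
      noise, where \<open>exp T * \<Delta>\<close> bounds the second moment of an increment. The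
      rate \<open>l\<close> below is chosen so that \<open>c / l\<close> is at most 1/4.\<close>
    define c where "c = 2 * \<alpha>\<^sup>2 * T + 2 * \<sigma>\<^sup>2 * exp T"
    define l where "l = 4 * c + 1"
    have c: "0 \<le> c"
      using T_pos by (simp add: c_def)
    have aF: "a t \<in> borel_measurable (F t)" if "t \<in> {0..T}" for t
      using DF[OF that] stay_sets[OF D that, of b] unfolding a_def[abs_def] by measurable
    have abs_a: "\<bar>a t \<omega>\<bar> \<le> b" if "t \<in> {0..T}" for t \<omega>
      using that b by (auto simp: a_def stay_def split: split_indicator)
    have a2: "(a t \<omega>)\<^sup>2 \<le> b\<^sup>2" if "t \<in> {0..T}" for t \<omega>
      using power_mono[OF abs_a[OF that], of \<omega> 2] by simp
    have aint: "integrable M (\<lambda>\<omega>. (a t \<omega>)\<^sup>2)" if "t \<in> {0..T}" for t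
      using F_measurable_M[OF aF[OF that]] a2[OF that]
      by (intro integrable_const_bound[where B="b\<^sup>2"]) auto
    have g_le: "g t \<le> b\<^sup>2" if "t \<in> {0..T}" for t
      unfolding g_def using aint[OF that] a2[OF that] by (intro integral_le_const) auto
    \<comment> \<open>One pass of the Gronwall argument. The ratio \<open>c / l\<close> yields the
      factor 1/4, and replacing \<open>D\<close> by its Euler sum inside the square costs a factor
      2; together they give the 1/2.\<close>
    have step: "g t \<le> m / 2 * exp (l * t)"
      if m: "\<And>u. u \<in> {0..T} \<Longrightarrow> g u \<le> m * exp (l * u)" and t: "t \<in> {0..T}" for m t
    proof (cases "t = 0")
      case True
      have "0 \<le> g 0"
        by (simp add: g_def)
      also have "g 0 \<le> m"
        using m[of 0] T_pos by simp
      finally have "0 \<le> m" .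
      moreover have "g 0 = expectation (\<lambda>\<omega>. 0)"
        unfolding g_def using D0 by (intro Bochner_Integration.integral_cong) (auto simp: a_def)
      ultimately show ?thesis
        using True by simp
    next
      case False
      then have t': "0 < t" "t \<le> T"
        using t by auto
      have "0 \<le> g 0"
        by (simp add: g_def)
      also have "g 0 \<le> m"
        using m[of 0] T_pos by simp
      finally have m0: "0 \<le> m" .
      \<comment> \<open>\<open>U\<close> is the Euler sum formed with \<open>a\<close> in place of
        \<open>D\<close>. The two agree on \<open>stay D b t\<close> because that event is contained
        in all earlier ones, and \<open>U\<close> is square integrable by construction.\<close>
      have EU: "\<exists>U. U \<in> borel_measurable M \<and> integrable M (\<lambda>\<omega>. (U \<omega>)\<^sup>2) \<and>
          expectation (\<lambda>\<omega>. (U \<omega>)\<^sup>2) \<le> m / 4 * exp (l * t) \<and>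
          (\<forall>\<omega>\<in>stay D b t. euler_sum \<alpha> \<sigma> D t n \<omega> = U \<omega>)" for n
      proof -
        define \<Delta> where "\<Delta> = t / real (Suc n)"
        define \<tau> where "\<tau> i = t * real i / real (Suc n)" for i
        define d where "d i \<omega> = w (\<tau> (Suc i)) \<omega> - w (\<tau> i) \<omega>" for i \<omega>
        note part = uniform_partition[OF t', of _ n, folded \<tau>_def \<Delta>_def]
        have \<tau>T: "\<tau> i \<in> {0..T}" if "i < Suc n" for i
          using part[OF that] by simp
        have \<Delta>: "0 \<le> \<Delta>" "\<Delta> \<le> T"
          using t' by (simp_all add: \<Delta>_def pos_divide_le_eq) (simp add: add_increasing2 distrib_left)
        have d2: "integrable M (\<lambda>\<omega>. (d i \<omega>)\<^sup>2)" "expectation (d i) = 0"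
          "expectation (\<lambda>\<omega>. (d i \<omega>)\<^sup>2) \<le> exp T * \<Delta>" if "i < Suc n" for i
        proof -
          note mom = increment_moments[OF part(1,2,4)[OF that], of 1, unfolded part(5)[OF that], folded d_def]
          show "integrable M (\<lambda>\<omega>. (d i \<omega>)\<^sup>2)" "expectation (d i) = 0"
            using mom by simp_all
          \<comment> \<open>This bounds exp x - 1 by x exp x at x = \<Delta> / 2, which makes the
            second moment of an increment linear in \<Delta>.\<close>
          have "1 - \<Delta> / 2 \<le> exp (- (\<Delta> / 2))"
            using exp_ge_add_one_self[of "- (\<Delta> / 2)"] by simp
          then have "exp (\<Delta> / 2) * (1 - \<Delta> / 2) \<le> exp (\<Delta> / 2) * exp (- (\<Delta> / 2))"
            by (intro mult_left_mono) auto
          then have "2 * (exp (\<Delta> / 2) - 1) \<le> exp (\<Delta> / 2) * \<Delta>"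
            by (simp add: exp_minus algebra_simps)
          also have "\<dots> \<le> exp T * \<Delta>"
            using \<Delta> by (intro mult_right_mono) auto
          finally show "expectation (\<lambda>\<omega>. (d i \<omega>)\<^sup>2) \<le> exp T * \<Delta>"
            using mom(6) by simp
        qed
        let ?U1 = "\<lambda>\<omega>. \<Sum>i<Suc n. a (\<tau> i) \<omega>" and ?U2 = "\<lambda>\<omega>. \<Sum>i<Suc n. a (\<tau> i) \<omega> * d i \<omega>"
        define U where "U \<omega> = \<alpha> * \<Delta> * ?U1 \<omega> + \<sigma> * ?U2 \<omega>" for \<omega>
        have aM: "a (\<tau> i) \<in> borel_measurable M" if "i < Suc n" for i
          using aF[OF \<tau>T[OF that]] by (rule F_measurable_M)
        have dM: "d i \<in> borel_measurable M" if "i < Suc n" for i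
          unfolding d_def[abs_def] using part[OF that] by (intro F_measurable_M[OF increment_measurable])
        have U1M: "?U1 \<in> borel_measurable M"
          using aM by (intro borel_measurable_sum) auto
        have U2M: "?U2 \<in> borel_measurable M"
          using aM dM by (intro borel_measurable_sum borel_measurable_times) auto
        have UM: "U \<in> borel_measurable M"
          unfolding U_def[abs_def] using U1M U2M by (intro borel_measurable_add borel_measurable_times) auto
        have suma: "integrable M (\<lambda>\<omega>. \<Sum>i<Suc n. (a (\<tau> i) \<omega>)\<^sup>2)"
          using aint[OF \<tau>T] by (intro Bochner_Integration.integrable_sum) auto
        have U1int: "integrable M (\<lambda>\<omega>. (?U1 \<omega>)\<^sup>2)"
        proof (rule Bochner_Integration.integrable_bound)
          show "integrable M (\<lambda>\<omega>. real (Suc n) * (\<Sum>i<Suc n. (a (\<tau> i) \<omega>)\<^sup>2))"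
            using suma by (rule integrable_mult_right)
          show "AE \<omega> in M. norm ((?U1 \<omega>)\<^sup>2) \<le> norm (real (Suc n) * (\<Sum>i<Suc n. (a (\<tau> i) \<omega>)\<^sup>2))"
            using sum_square_le[of "\<lambda>i. a (\<tau> i) _" "Suc n"]
            by (intro AE_I2) (auto simp del: sum.lessThan_Suc intro: order_trans[OF _ abs_ge_self])
          show "(\<lambda>\<omega>. (?U1 \<omega>)\<^sup>2) \<in> borel_measurable M"
            using U1M by (rule borel_measurable_power)
        qed
        define G where "G = (\<Sum>i<Suc n. \<Delta> * g (\<tau> i))"
        have "expectation (\<lambda>\<omega>. (?U1 \<omega>)\<^sup>2) \<le> expectation (\<lambda>\<omega>. real (Suc n) * (\<Sum>i<Suc n. (a (\<tau> i) \<omega>)\<^sup>2))"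
          using U1int suma by (intro integral_mono sum_square_le integrable_mult_right)
        also have "\<dots> = real (Suc n) * (\<Sum>i<Suc n. g (\<tau> i))"
          using aint[OF \<tau>T] by (simp add: Bochner_Integration.integral_sum g_def del: sum.lessThan_Suc)
        finally have "\<Delta>\<^sup>2 * expectation (\<lambda>\<omega>. (?U1 \<omega>)\<^sup>2) \<le> \<Delta>\<^sup>2 * (real (Suc n) * (\<Sum>i<Suc n. g (\<tau> i)))"
          by (intro mult_left_mono) auto
        \<comment> \<open>One factor \<Delta> is used up by the number of steps, whose product with
          \<Delta> is \<open>t\<close>; the other turns the sum into the Riemann sum
          \<open>G\<close>.\<close>
        also have "\<dots> = (real (Suc n) * \<Delta>) * G"
          by (simp only: G_def sum_distrib_left[symmetric] power2_eq_square mult_ac)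
        also have "\<dots> = t * G"
          by (simp add: \<Delta>_def)
        finally have U1le: "\<Delta>\<^sup>2 * expectation (\<lambda>\<omega>. (?U1 \<omega>)\<^sup>2) \<le> t * G" .
        have U2: "integrable M (\<lambda>\<omega>. (?U2 \<omega>)\<^sup>2)"
          "expectation (\<lambda>\<omega>. (?U2 \<omega>)\<^sup>2) = (\<Sum>i<Suc n. g (\<tau> i) * expectation (\<lambda>\<omega>. (d i \<omega>)\<^sup>2))"
          using orthogonal_increments[of "Suc n" \<tau> "\<lambda>i. a (\<tau> i)" "\<lambda>y. y", folded d_def g_def]
            part aF[OF \<tau>T] aint[OF \<tau>T] d2 by simp_all
        have "expectation (\<lambda>\<omega>. (?U2 \<omega>)\<^sup>2) \<le> (\<Sum>i<Suc n. g (\<tau> i) * (exp T * \<Delta>))"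
          unfolding U2(2) using d2(3) by (intro sum_mono mult_left_mono) (auto simp: g_def)
        also have "\<dots> = exp T * G"
          by (simp add: G_def sum_distrib_left mult_ac del: sum.lessThan_Suc)
        finally have U2le: "expectation (\<lambda>\<omega>. (?U2 \<omega>)\<^sup>2) \<le> exp T * G" .
        have bound: "(U \<omega>)\<^sup>2 \<le> (2 * \<alpha>\<^sup>2 * \<Delta>\<^sup>2) * (?U1 \<omega>)\<^sup>2 + (2 * \<sigma>\<^sup>2) * (?U2 \<omega>)\<^sup>2" for \<omega>
          using square_add_le[of "\<alpha> * \<Delta> * ?U1 \<omega>" "\<sigma> * ?U2 \<omega>"]
          by (simp only: U_def power_mult_distrib mult.assoc)
        have bint: "integrable M (\<lambda>\<omega>. (2 * \<alpha>\<^sup>2 * \<Delta>\<^sup>2) * (?U1 \<omega>)\<^sup>2 + (2 * \<sigma>\<^sup>2) * (?U2 \<omega>)\<^sup>2)"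
          using U1int U2(1) by (intro Bochner_Integration.integrable_add integrable_mult_right)
        have Uint: "integrable M (\<lambda>\<omega>. (U \<omega>)\<^sup>2)"
          using bint by (rule Bochner_Integration.integrable_bound)
            (use UM bound in \<open>auto simp del: sum.lessThan_Suc intro: order_trans[OF _ abs_ge_self]\<close>)
        have "expectation (\<lambda>\<omega>. (U \<omega>)\<^sup>2) \<le>
            expectation (\<lambda>\<omega>. (2 * \<alpha>\<^sup>2 * \<Delta>\<^sup>2) * (?U1 \<omega>)\<^sup>2 + (2 * \<sigma>\<^sup>2) * (?U2 \<omega>)\<^sup>2)"
          using Uint bint bound by (rule integral_mono)
        also have "\<dots> = 2 * \<alpha>\<^sup>2 * (\<Delta>\<^sup>2 * expectation (\<lambda>\<omega>. (?U1 \<omega>)\<^sup>2)) + 2 * \<sigma>\<^sup>2 * expectation (\<lambda>\<omega>. (?U2 \<omega>)\<^sup>2)"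
          using U1int U2(1) by (simp del: sum.lessThan_Suc)
        also have "\<dots> \<le> 2 * \<alpha>\<^sup>2 * (t * G) + 2 * \<sigma>\<^sup>2 * (exp T * G)"
          using U1le U2le by (intro add_mono mult_left_mono) auto
        also have "\<dots> \<le> 2 * \<alpha>\<^sup>2 * (T * G) + 2 * \<sigma>\<^sup>2 * (exp T * G)"
        proof -
          have "0 \<le> G"
            unfolding G_def using \<Delta> by (intro sum_nonneg mult_nonneg_nonneg) (auto simp: g_def)
          then show ?thesis
            using t' by (intro add_mono mult_left_mono mult_right_mono) auto
        qed
        also have "\<dots> = c * G"
          by (simp add: c_def algebra_simps)
        also have "\<dots> \<le> c * (m * (exp (l * t) / l))"
        proof (intro mult_left_mono c)
          have "G \<le> (\<Sum>i<Suc n. \<Delta> * (m * exp (l * \<tau> i)))"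
            unfolding G_def using \<Delta> m[OF \<tau>T] by (intro sum_mono mult_left_mono) auto
          also have "\<dots> = m * (\<Sum>i<Suc n. \<Delta> * exp (l * \<tau> i))"
            by (simp add: sum_distrib_left mult_ac del: sum.lessThan_Suc)
          also have "\<dots> \<le> m * (exp (l * t) / l)"
            using left_riemann_sum_exp_le[of l t n] t' m0 c by (intro mult_left_mono) (auto simp: l_def \<Delta>_def \<tau>_def)
          finally show "G \<le> m * (exp (l * t) / l)" .
        qed
        also have "\<dots> = c / l * (m * exp (l * t))"
          by simp
        also have "\<dots> \<le> 1 / 4 * (m * exp (l * t))"
          using c m0 by (intro mult_right_mono) (auto simp: l_def divide_simps)
        finally have Ule: "expectation (\<lambda>\<omega>. (U \<omega>)\<^sup>2) \<le> m / 4 * exp (l * t)"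
          by simp
        have "euler_sum \<alpha> \<sigma> D t n \<omega> = U \<omega>" if \<omega>: "\<omega> \<in> stay D b t" for \<omega>
        proof -
          have a: "D (\<tau> i) \<omega> = a (\<tau> i) \<omega>" if "i < Suc n" for i
          proof -
            have "\<tau> i \<le> t"
              using part[OF that] by linarith
            then have "\<omega> \<in> stay D b (\<tau> i)"
              using \<omega> by (auto simp: stay_def)
            then show ?thesis by (simp add: a_def)
          qed
          have "euler_sum \<alpha> \<sigma> D t n \<omega> = (\<Sum>i<Suc n. \<alpha> * a (\<tau> i) \<omega> * \<Delta> + \<sigma> * a (\<tau> i) \<omega> * d i \<omega>)"
            unfolding euler_sum_def \<tau>_def[symmetric] \<Delta>_def[symmetric] d_def[symmetric]
            using a by (intro sum.cong refl) auto
          also have "\<dots> = U \<omega>"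
            unfolding U_def sum.distrib sum_distrib_left by (simp add: mult_ac del: sum.lessThan_Suc)
          finally show ?thesis .
        qed
        then show ?thesis
          using UM Uint Ule by blast
      qed
      have "g t \<le> m / 2 * exp (l * t) + 2 * \<delta>\<^sup>2" if \<delta>: "0 < \<delta>" for \<delta>
      proof (rule LIMSEQ_le_const)
        let ?E = "\<lambda>n. {\<omega> \<in> space M. \<delta> < \<bar>D t \<omega> - euler_sum \<alpha> \<sigma> D t n \<omega>\<bar>}"
        have "(\<lambda>n. m / 2 * exp (l * t) + 2 * \<delta>\<^sup>2 + b\<^sup>2 * prob (?E n)) \<longlonglongrightarrow>
            m / 2 * exp (l * t) + 2 * \<delta>\<^sup>2 + b\<^sup>2 * 0"
          by (intro tendsto_intros euler t' \<delta>)
        then show "(\<lambda>n. m / 2 * exp (l * t) + 2 * \<delta>\<^sup>2 + b\<^sup>2 * prob (?E n)) \<longlonglongrightarrow>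
            m / 2 * exp (l * t) + 2 * \<delta>\<^sup>2"
          by simp
        have "g t \<le> m / 2 * exp (l * t) + 2 * \<delta>\<^sup>2 + b\<^sup>2 * prob (?E n)" for n
        proof -
          obtain U where U: "U \<in> borel_measurable M" "integrable M (\<lambda>\<omega>. (U \<omega>)\<^sup>2)"
            "expectation (\<lambda>\<omega>. (U \<omega>)\<^sup>2) \<le> m / 4 * exp (l * t)"
            "\<And>\<omega>. \<omega> \<in> stay D b t \<Longrightarrow> euler_sum \<alpha> \<sigma> D t n \<omega> = U \<omega>"
            using EU[of n] by blast
          have EM: "?E n \<in> events"
            using euler_sum_measurable[OF DF t'] F_measurable_M[OF DF[OF t]] by measurable
          have iE: "integrable M (indicator (?E n) :: 'a \<Rightarrow> real)"
            using EM by (intro integrable_real_indicator) (auto simp: emeasure_eq_measure)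
          \<comment> \<open>Inside \<open>stay D b t\<close> and off the exceptional event,
            \<open>a t \<omega>\<close> differs from \<open>U \<omega>\<close> by at most \<delta>.
            On the exceptional event it is bounded by \<open>b\<close>, and outside
            \<open>stay D b t\<close> it is 0.\<close>
          have pw: "(a t \<omega>)\<^sup>2 \<le> 2 * (U \<omega>)\<^sup>2 + 2 * \<delta>\<^sup>2 + b\<^sup>2 * indicator (?E n) \<omega>"
            if "\<omega> \<in> space M" for \<omega>
          proof (cases "\<omega> \<in> stay D b t \<and> \<omega> \<notin> ?E n")
            case True
            define e where "e = D t \<omega> - U \<omega>"
            have "\<bar>e\<bar> \<le> \<delta>"
              using True U(4)[of \<omega>] that by (auto simp: e_def)
            then have "e\<^sup>2 \<le> \<delta>\<^sup>2"
              using power_mono[of "\<bar>e\<bar>" \<delta> 2] by simp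
            moreover have "(U \<omega> + e)\<^sup>2 \<le> 2 * (U \<omega>)\<^sup>2 + 2 * e\<^sup>2"
              by (rule square_add_le)
            moreover have "a t \<omega> = U \<omega> + e"
              using True by (simp add: a_def e_def)
            ultimately show ?thesis
              using True by simp
          next
            case False
            then consider "\<omega> \<notin> stay D b t" | "\<omega> \<in> ?E n"
              by blast
            then show ?thesis
              using a2[OF t, of \<omega>] by cases (simp_all add: a_def add_increasing)
          qed
          have "g t \<le> expectation (\<lambda>\<omega>. 2 * (U \<omega>)\<^sup>2 + 2 * \<delta>\<^sup>2 + b\<^sup>2 * indicator (?E n) \<omega>)"
            unfolding g_def using aint[OF t] U(2) iE pw by (intro integral_mono) auto
          also have "\<dots> = 2 * expectation (\<lambda>\<omega>. (U \<omega>)\<^sup>2) + 2 * \<delta>\<^sup>2 + b\<^sup>2 * prob (?E n)"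
            using U(2) iE EM prob_space by (simp add: Int_absorb1 sets.sets_into_space)
          finally show ?thesis
            using U(3) by simp
        qed
        then show "\<exists>N. \<forall>n\<ge>N. g t \<le> m / 2 * exp (l * t) + 2 * \<delta>\<^sup>2 + b\<^sup>2 * prob (?E n)"
          by blast
      qed
      then have sq: "g t - m / 2 * exp (l * t) \<le> 2 * \<delta>\<^sup>2" if "0 < \<delta>" for \<delta>
        using that by (simp add: algebra_simps)
      have "g t - m / 2 * exp (l * t) \<le> 0"
      proof (rule ccontr)
        assume "\<not> ?thesis"
        \<comment> \<open>This choice of \<delta> makes \<open>2 * \<delta>\<^sup>2\<close> half of
          the supposedly positive excess.\<close>
        then show False
          using sq[of "sqrt ((g t - m / 2 * exp (l * t)) / 4)"] by simp
      qed
      then show ?thesis by simp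
    qed
    \<comment> \<open>The iteration starts from the trivial bound \<open>b\<^sup>2\<close>; the
      localisation is what provides a finite starting value.\<close>
    have halves: "\<forall>t\<in>{0..T}. g t \<le> b\<^sup>2 / 2 ^ j * exp (l * t)" for j
    proof (induction j)
      case 0
      have "b\<^sup>2 * 1 \<le> b\<^sup>2 * exp (l * t)" if "t \<in> {0..T}" for t
        using that c by (intro mult_left_mono) (auto simp: l_def)
      then show ?case
        using g_le by force
    next
      case (Suc j)
      then show ?case
        using step[of "b\<^sup>2 / 2 ^ j"] by (simp add: mult.commute)
    qed
    have "(\<lambda>j. b\<^sup>2 / 2 ^ j * exp (l * T)) \<longlonglongrightarrow> 0"
      by (intro tendsto_mult_left_zero LIMSEQ_divide_realpow_zero) simp
    then have "g T \<le> 0"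
      by (rule LIMSEQ_le_const) (use halves T_pos in auto)
    then have "g T = 0"
      by (simp add: g_def order_antisym)
    then have "AE \<omega> in M. (a T \<omega>)\<^sup>2 = 0"
      unfolding g_def using aint[of T] T_pos
      by (subst (asm) integral_nonneg_eq_0_iff_AE) auto
    then show ?thesis
      by (simp add: a_def)
  qed
  have "AE \<omega> in M. \<forall>b::nat. D T \<omega> * indicator (stay D (real b) T) \<omega> = 0"
    using stopped by (subst AE_all_countable) auto
  moreover have "AE \<omega> in M. \<omega> \<in> space M"
    by (rule AE_space)
  ultimately show ?thesis
  proof eventually_elim
    fix \<omega> assume zero: "\<forall>b::nat. D T \<omega> * indicator (stay D (real b) T) \<omega> = 0" and \<omega>: "\<omega> \<in> space M"
    \<comment> \<open>A continuous path is bounded on [0, T], so it lies in one of the countably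
      many events.\<close>
    have "compact ((\<lambda>u. D u \<omega>) ` {0..T})"
      using D \<omega> by (intro compact_continuous_image) (auto simp: adapted_continuous_def)
    then have "bounded ((\<lambda>u. D u \<omega>) ` {0..T})"
      by (rule compact_imp_bounded)
    then obtain B where B: "\<forall>u\<in>{0..T}. \<bar>D u \<omega>\<bar> \<le> B"
      by (auto simp: bounded_iff)
    obtain b :: nat where "B \<le> real b"
      using real_arch_simple by blast
    then have "\<omega> \<in> stay D (real b) T"
      using \<omega> B by (auto simp: stay_def intro: order_trans)
    then show "D T \<omega> = 0"
      using spec[OF zero, of b] by simp
  qed
qed

text \<open>The Euler sum is a Riemann sum \<open>R\<close> for the drift plus an Ito sum
  \<open>J\<close>. The first converges along almost every path, the second in probability, and by
  the stochastic equation the two limits add up to \<open>S t \<omega> - x\<close>.\<close>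

lemma ito_differential_euler_error:
  assumes S: "has_ito_differential M F T w S (\<lambda>t \<omega>. S t \<omega> * \<alpha>) (\<lambda>t \<omega>. S t \<omega> * \<sigma>)"
    and S0: "\<And>\<omega>. \<omega> \<in> space M \<Longrightarrow> S 0 \<omega> = x" and t: "0 < t" "t \<le> T" and \<delta>: "0 < \<delta>"
  shows "(\<lambda>n. prob {\<omega> \<in> space M. \<delta> < \<bar>S t \<omega> - x - euler_sum \<alpha> \<sigma> S t n \<omega>\<bar>}) \<longlonglongrightarrow> 0"
proof -
  have t0T: "t \<in> {0..T}"
    using t by simp
  obtain I where I: "ito_integral M F w (\<lambda>t \<omega>. S t \<omega> * \<sigma>) t I"
    and eq: "AE \<omega> in M. S t \<omega> = S 0 \<omega> + (LBINT u=ereal 0..ereal t. S u \<omega> * \<alpha>) + I \<omega>"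
    using S t0T unfolding has_ito_differential_def by blast
  have S_ad: "adapted_continuous M F T S"
    using S by (simp add: has_ito_differential_def)
  let ?\<tau> = "\<lambda>n i. t * real i / real (Suc n)"
  define J where "J n \<omega> = (\<Sum>i<Suc n. S (?\<tau> n i) \<omega> * \<sigma> * (w (?\<tau> n (Suc i)) \<omega> - w (?\<tau> n i) \<omega>))" for n \<omega>
  define R where "R n \<omega> = (\<Sum>i<Suc n. S (?\<tau> n i) \<omega> * \<alpha> * (t / real (Suc n)))" for n \<omega>
  have J: "converges_in_prob M J I"
    using I t unfolding ito_integral_def J_def[abs_def]
    by (blast intro: vanishing_uniform_partitions less_imp_le)
  have [measurable]: "J n \<in> borel_measurable M" "I \<in> borel_measurable M" for n
    using J by (auto simp: converges_in_prob_def)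
  have SM: "S u \<in> borel_measurable M" if "u \<in> {0..T}" for u
    using S_ad that unfolding adapted_continuous_def by (auto intro: F_measurable_M)
  note SM[OF t0T, measurable]
  have [measurable]: "R n \<in> borel_measurable M" for n
  proof -
    have "S (?\<tau> n i) \<in> borel_measurable M" if "i < Suc n" for i
      using uniform_partition(1,2,4)[OF t that] by (intro SM) (simp del: of_nat_Suc)
    then show ?thesis
      unfolding R_def[abs_def] by (intro borel_measurable_sum borel_measurable_times) auto
  qed
  have euler: "euler_sum \<alpha> \<sigma> S t n \<omega> = R n \<omega> + J n \<omega>" for n \<omega>
    unfolding euler_sum_def R_def J_def sum.distrib[symmetric] by (intro sum.cong refl) (simp only: mult_ac)
  have Jlim: "(\<lambda>n. prob {\<omega> \<in> space M. \<delta> / 2 < \<bar>J n \<omega> - I \<omega>\<bar>}) \<longlonglongrightarrow> 0"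
    using J half_gt_zero[OF \<delta>] unfolding converges_in_prob_def by blast
  have Rlim: "(\<lambda>n. prob {\<omega> \<in> space M. \<delta> / 2 < \<bar>S t \<omega> - x - I \<omega> - R n \<omega>\<bar>}) \<longlonglongrightarrow> 0"
  proof (rule AE_tendsto_imp_in_prob)
    show "AE \<omega> in M. (\<lambda>n. S t \<omega> - x - I \<omega> - R n \<omega>) \<longlonglongrightarrow> 0"
      using eq AE_space
    proof eventually_elim
      fix \<omega>
      assume *: "S t \<omega> = S 0 \<omega> + (LBINT u=ereal 0..ereal t. S u \<omega> * \<alpha>) + I \<omega>" and \<omega>: "\<omega> \<in> space M"
      have "continuous_on {0..t} (\<lambda>u. S u \<omega> * \<alpha>)"
        using S_ad \<omega> t unfolding adapted_continuous_def
        by (auto intro!: continuous_intros intro: continuous_on_subset)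
      then have "(\<lambda>n. R n \<omega>) \<longlonglongrightarrow> (LBINT u=ereal 0..ereal t. S u \<omega> * \<alpha>)"
        unfolding R_def using t by (intro uniform_riemann_sums_tendsto) auto
      then have "(\<lambda>n. S t \<omega> - x - I \<omega> - R n \<omega>) \<longlonglongrightarrow>
          S t \<omega> - x - I \<omega> - (LBINT u=ereal 0..ereal t. S u \<omega> * \<alpha>)"
        by (intro tendsto_intros)
      then show "(\<lambda>n. S t \<omega> - x - I \<omega> - R n \<omega>) \<longlonglongrightarrow> 0"
        using * S0[OF \<omega>] by simp
    qed
  qed (use \<delta> in auto)
  show ?thesis
    using tendsto_in_prob_diff[OF _ _ Rlim Jlim] by (simp add: euler algebra_simps)
qed

lemma geometric_sde_solution:
  assumes S: "has_ito_differential M F T w S (\<lambda>t \<omega>. S t \<omega> * \<alpha>) (\<lambda>t \<omega>. S t \<omega> * \<sigma>)"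
    and S0: "\<And>\<omega>. \<omega> \<in> space M \<Longrightarrow> S 0 \<omega> = x"
  shows "AE \<omega> in M. S T \<omega> = x * exp ((\<alpha> - \<sigma>\<^sup>2 / 2) * T + \<sigma> * w T \<omega>)"
proof -
  let ?G = "gbm x \<alpha> \<sigma>"
  define D where "D t \<omega> = S t \<omega> - ?G t \<omega>" for t \<omega>
  have S_ad: "adapted_continuous M F T S"
    using S by (simp add: has_ito_differential_def)
  have SF: "S u \<in> borel_measurable (F u)" if "u \<in> {0..T}" for u
    using S_ad that by (simp add: adapted_continuous_def)
  have W_cont: "continuous_on {0..T} (\<lambda>t. W t \<omega>)" if "\<omega> \<in> space M" for \<omega>
    using wiener that by (simp add: wiener_process_def adapted_continuous_def)
  have "adapted_continuous M F T D"
    unfolding adapted_continuous_def D_def[abs_def]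
  proof (intro conjI ballI)
    fix \<omega> assume \<omega>: "\<omega> \<in> space M"
    have "continuous_on {0..T} (\<lambda>t. S t \<omega>)"
      using S_ad \<omega> by (simp add: adapted_continuous_def)
    then show "continuous_on {0..T} (\<lambda>t. S t \<omega> - ?G t \<omega>)"
      unfolding gbm_def w_def using W_cont[OF \<omega>] by (intro continuous_intros)
  qed (use SF gbm_measurable in auto)
  moreover have "D 0 \<omega> = 0" if "\<omega> \<in> space M" for \<omega>
    using S0[OF that] by (simp add: D_def gbm_def)
  moreover have "(\<lambda>n. prob {\<omega> \<in> space M. \<delta> < \<bar>D t \<omega> - euler_sum \<alpha> \<sigma> D t n \<omega>\<bar>}) \<longlonglongrightarrow> 0"
    if t: "0 < t" "t \<le> T" and \<delta>: "0 < \<delta>" for t \<delta>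
  proof -
    have [measurable]: "euler_sum \<alpha> \<sigma> S t n \<in> borel_measurable M" "euler_sum \<alpha> \<sigma> ?G t n \<in> borel_measurable M"
      "S t \<in> borel_measurable M" "?G t \<in> borel_measurable M" for n
      using euler_sum_measurable[OF _ t] SF gbm_measurable t by (auto intro: F_measurable_M[where t=t])
    have "\<alpha> * (y - z) * a + \<sigma> * (y - z) * c = \<alpha> * y * a + \<sigma> * y * c - (\<alpha> * z * a + \<sigma> * z * c)"
      for y z a c :: real
      by (simp add: algebra_simps)
    \<comment> \<open>Euler sums are linear in the process because both coefficients are, so the
      errors of \<open>S\<close> and of \<open>?G\<close> subtract.\<close>
    then have "euler_sum \<alpha> \<sigma> D t n \<omega> = euler_sum \<alpha> \<sigma> S t n \<omega> - euler_sum \<alpha> \<sigma> ?G t n \<omega>" for n \<omega>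
      unfolding euler_sum_def sum_subtractf[symmetric] D_def
      by (intro sum.cong refl)
    then have "D t \<omega> - euler_sum \<alpha> \<sigma> D t n \<omega> = (S t \<omega> - x - euler_sum \<alpha> \<sigma> S t n \<omega>) -
        (?G t \<omega> - x - euler_sum \<alpha> \<sigma> ?G t n \<omega>)" for n \<omega>
      by (simp add: D_def)
    then show ?thesis
      by (simp only:) (intro tendsto_in_prob_diff ito_differential_euler_error[OF S S0] gbm_euler_error t half_gt_zero \<delta>;
          measurable)
  qed
  ultimately have "AE \<omega> in M. D T \<omega> = 0"
    by (rule linear_sde_unique)
  moreover have "AE \<omega> in M. W 0 \<omega> = 0"
    using wiener by (simp add: wiener_process_def)
  ultimately show ?thesis
    by eventually_elim (simp add: D_def gbm_def w_def)
qed

end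

section \<open>Changes of measure and joint densities\<close>

lemma normal_vector_linear:
  fixes V :: "'a \<Rightarrow> real^'n" and N :: "real^'n^'n"
  assumes "normal_vector M V m C"
  shows "normal_vector M (\<lambda>\<omega>. N *v V \<omega>) (N *v m) (N ** C ** transpose N)"
proof -
  obtain L :: "real^'n^'n"
    where V [measurable]: "V \<in> borel_measurable M" and LC: "L ** transpose L = C"
      and L: "distr M borel V = distr std_normal_measure borel (\<lambda>z. m + L *v z)"
    using assms unfolding normal_vector_def by blast
  have "distr M borel (\<lambda>\<omega>. N *v V \<omega>) = distr (distr M borel V) borel ((*v) N)"
    by (subst distr_distr) (simp_all add: comp_def)
  also have "\<dots> = distr std_normal_measure borel (\<lambda>z. N *v m + (N ** L) *v z)"
    unfolding L by (subst distr_distr)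
      (simp_all add: comp_def matrix_vector_right_distrib matrix_vector_mul_assoc)
  finally show ?thesis
    unfolding normal_vector_def
    by (intro conjI exI[of _ "N ** L"])
      (simp_all add: matrix_transpose_mul matrix_mul_assoc LC[symmetric])
qed

text \<open>In law \<open>V\<close> is \<open>L *v z\<close>, and the density becomes the tilt of
  \<open>z\<close> in the direction \<open>d\<close>, which translates \<open>z\<close> by
  \<open>d\<close> and hence \<open>V\<close> by \<open>- (C *v a)\<close>; the added drift restores
  mean 0. No matrix is inverted, so the argument covers singular \<open>C\<close>.\<close>

lemma normal_vector_girsanov:
  fixes V :: "'a \<Rightarrow> real^'n"
  assumes V: "normal_vector M V 0 C"
  shows "normal_vector (density M (\<lambda>\<omega>. ennreal (exp (- (a \<bullet> V \<omega>) - a \<bullet> (C *v a) / 2))))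
    (\<lambda>\<omega>. V \<omega> + C *v a) 0 C"
proof -
  obtain L :: "real^'n^'n"
    where V [measurable]: "V \<in> borel_measurable M" and LC: "L ** transpose L = C"
      and L: "distr M borel V = distr std_normal_measure borel (\<lambda>z. 0 + L *v z)"
    using V unfolding normal_vector_def by blast
  let ?Z = "\<lambda>v. ennreal (exp (- (a \<bullet> v) - a \<bullet> (C *v a) / 2))"
  define d where "d = - (transpose L *v a)"
  have d: "d \<bullet> z = - (a \<bullet> (L *v z))" for z
    by (simp add: d_def dot_lmul_matrix)
  have Ld: "L *v d = - (C *v a)"
    using matrix_vector_mult_diff_distrib[of L 0 "transpose L *v a"]
    by (simp add: d_def LC[symmetric] matrix_vector_mul_assoc[symmetric])
  have nd: "(norm d)\<^sup>2 = a \<bullet> (C *v a)"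
    by (simp add: power2_norm_eq_inner d Ld)
  have "distr (density M (\<lambda>\<omega>. ?Z (V \<omega>))) borel (\<lambda>\<omega>. V \<omega> + C *v a) =
      distr (distr (density M (\<lambda>\<omega>. ?Z (V \<omega>))) borel V) borel (\<lambda>v. v + C *v a)"
    by (subst distr_distr) (simp_all add: comp_def)
  also have "distr (density M (\<lambda>\<omega>. ?Z (V \<omega>))) borel V = density (distr M borel V) ?Z"
    by (subst density_distr) simp_all
  also have "\<dots> = distr (density std_normal_measure (\<lambda>z. ?Z (L *v z))) borel ((*v) L)"
    unfolding L by (subst density_distr) simp_all
  also have "density std_normal_measure (\<lambda>z. ?Z (L *v z)) = distr std_normal_measure borel (\<lambda>z. z + d)"
    unfolding std_normal_tilt[symmetric] by (simp add: d nd)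
  also have "distr (distr (distr std_normal_measure borel (\<lambda>z. z + d)) borel ((*v) L)) borel (\<lambda>v. v + C *v a) =
      distr std_normal_measure borel (\<lambda>z. 0 + L *v z)"
    by (subst distr_distr, simp, simp, subst distr_distr)
      (simp_all add: comp_def matrix_vector_right_distrib Ld)
  finally show ?thesis
    unfolding normal_vector_def using LC by auto
qed

text \<open>Lebesgue measure is determined by boxes, so the claim is checked in the form that |det
  L| times the image measure is Lebesgue measure. The preimage of a box is its image under the
  inverse matrix, whose volume is that of the box divided by |det L|.\<close>

lemma lborel_distr_matrix:
  fixes L :: "real^('n::{finite,wellorder})^('n::{finite,wellorder})"
  assumes "det L \<noteq> 0"
  shows "distr lborel borel ((*v) L) = density lborel (\<lambda>_. ennreal (1 / \<bar>det L\<bar>))"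
proof -
  obtain L' where L': "L ** L' = mat 1" "L' ** L = mat 1"
    using assms invertible_det_nz[of L] unfolding invertible_def by blast
  have inv: "L *v (L' *v z) = z" "L' *v (L *v z) = z" for z
    by (simp_all add: matrix_vector_mul_assoc L')
  have "lborel = density (distr lborel borel ((*v) L)) (\<lambda>_. ennreal \<bar>det L\<bar>)"
  proof (rule lborel_eqI)
    fix l u :: "real^('n::{finite,wellorder})" assume "\<And>b. b \<in> Basis \<Longrightarrow> l \<bullet> b \<le> u \<bullet> b"
    then have box: "measure lebesgue (box l u) = (\<Prod>b\<in>Basis. (u - l) \<bullet> b)"
      by (simp add: measure_lborel_box_eq)
    have vim: "(*v) L -` box l u = (*v) L' ` box l u"
      using inv by (auto simp: image_iff) metis
    have img: "(*v) L ` ((*v) L' ` box l u) = box l u"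
      using inv by (auto simp: image_iff)
    have lin: "linear ((*v) L)" "linear ((*v) L')"
      by (simp_all add: matrix_vector_mul_linear)
    have lm: "(*v) L' ` box l u \<in> lmeasurable"
      using lin(2) by (rule measurable_linear_image) simp
    have "(*v) L -` box l u \<in> sets borel"
      using measurable_sets[OF matrix_vector_mult_borel[of L], of "box l u"] by simp
    then have em: "emeasure lborel ((*v) L -` box l u) = ennreal (measure lebesgue ((*v) L' ` box l u))"
      using emeasure_eq_measure2[OF lm] unfolding vim by simp
    have "measure lebesgue (box l u) = \<bar>det L\<bar> * measure lebesgue ((*v) L' ` box l u)"
      using measure_linear_image[OF lin(1) lm] unfolding img by simp
    then show "emeasure (density (distr lborel borel ((*v) L)) (\<lambda>_. ennreal \<bar>det L\<bar>)) (box l u) =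
        (\<Prod>b\<in>Basis. (u - l) \<bullet> b)"
      by (simp add: emeasure_density nn_integral_cmult emeasure_distr em box[symmetric] ennreal_mult[symmetric])
  qed simp
  then have "density lborel (\<lambda>_. ennreal (1 / \<bar>det L\<bar>)) =
      density (density (distr lborel borel ((*v) L)) (\<lambda>_. ennreal \<bar>det L\<bar>)) (\<lambda>_. ennreal (1 / \<bar>det L\<bar>))"
    by simp
  also have "\<dots> = distr lborel borel ((*v) L)"
    using assms by (simp add: density_density_eq ennreal_mult[symmetric] density_1)
  finally show ?thesis by simp
qed

text \<open>Gaussian vectors live in \<open>real^2\<close> but joint densities on pairs; comparing
  boxes identifies the two Lebesgue measures.\<close>

lemma lborel_distr_vec2_pair:
  "distr lborel borel (\<lambda>z::real^2. (z $ 1, z $ 2)) = lborel"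
proof (rule lborel_eqI[symmetric])
  fix l u :: "real \<times> real" assume le: "\<And>b. b \<in> Basis \<Longrightarrow> l \<bullet> b \<le> u \<bullet> b"
  have le': "fst l \<le> fst u" "snd l \<le> snd u"
    using le[of "(1, 0)"] le[of "(0, 1)"] by (simp_all add: Basis_prod_def inner_prod_def)
  have "(\<lambda>z::real^2. (z $ 1, z $ 2)) -` box l u =
      box (vector [fst l, snd l]) (vector [fst u, snd u])"
    by (auto simp: box_def Basis_prod_def inner_prod_def Basis_vec_def inner_axis forall_2)
  moreover have "emeasure lborel (box (vector [fst l, snd l]) (vector [fst u, snd u]) :: (real^2) set) =
      ennreal ((fst u - fst l) * (snd u - snd l))"
  proof -
    have B: "Basis = {axis 1 1, axis 2 1 :: real^2}"
      by (auto simp: Basis_vec_def UNIV_2)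
    have "axis 1 1 \<noteq> (axis 2 1 :: real^2)"
      by (simp add: axis_eq_axis)
    then show ?thesis
      using le' by (subst emeasure_lborel_box) (auto simp: B inner_axis)
  qed
  moreover have "(\<Prod>b\<in>Basis. (u - l) \<bullet> b) = (fst u - fst l) * (snd u - snd l)"
  proof -
    have B: "Basis = {(1, 0), (0, 1) :: real \<times> real}"
      by (auto simp: Basis_prod_def)
    show ?thesis
      unfolding B by (simp add: inner_prod_def)
  qed
  moreover have [measurable]: "(\<lambda>z::real^2. (z $ 1, z $ 2)) \<in> borel_measurable borel"
    by (intro borel_measurable_continuous_onI continuous_intros)
  ultimately show "emeasure (distr lborel borel (\<lambda>z::real^2. (z $ 1, z $ 2))) (box l u) =
      (\<Prod>b\<in>Basis. (u - l) \<bullet> b)"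
    by (simp add: emeasure_distr)
qed simp

text \<open>The determinant of \<open>C\<close> is the square of that of \<open>L\<close>, so the
  vector is in law an invertible affine image of a standard normal one, and \<psi> inverts that
  map.\<close>

lemma normal_vector_joint_density:
  fixes V :: "'a \<Rightarrow> real^2"
  assumes V: "normal_vector M V m C" and C: "det C \<noteq> 0"
  shows "\<exists>f. joint_density M (\<lambda>\<omega>. V \<omega> $ 1) (\<lambda>\<omega>. V \<omega> $ 2) f"
proof -
  obtain L :: "real^2^2"
    where VM [measurable]: "V \<in> borel_measurable M" and LC: "L ** transpose L = C"
      and L: "distr M borel V = distr std_normal_measure borel (\<lambda>z. m + L *v z)"
    using V unfolding normal_vector_def by blast
  have det: "det L \<noteq> 0"
    using C by (auto simp: LC[symmetric] det_mul det_transpose)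
  then obtain L' where L': "L' ** L = mat 1"
    using invertible_det_nz[of L] unfolding invertible_def by blast
  define pair where "pair z = (z $ 1, z $ 2)" for z :: "real^2"
  define \<psi> where "\<psi> p = L' *v (vector [fst p, snd p] - m)" for p :: "real \<times> real"
  define h where "h z = exp (- (norm z)\<^sup>2 / 2) / (2 * pi) powr (real CARD(2) / 2)" for z :: "real^2"
  define c where "c = 1 / \<bar>det L\<bar>"
  have [measurable]: "pair \<in> borel_measurable borel"
    unfolding pair_def[abs_def] by (intro borel_measurable_continuous_onI continuous_intros)
  have vec2: "vector [x, y] = x *\<^sub>R axis 1 1 + y *\<^sub>R (axis 2 1 :: real^2)" for x y :: real
    by (simp add: vec_eq_iff forall_2 axis_def)
  have [measurable]: "\<psi> \<in> borel_measurable borel"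
    unfolding \<psi>_def[abs_def] vec2
    by (intro borel_measurable_continuous_onI continuous_intros
        continuous_on_compose2[OF linear_continuous_on[OF matrix_vector_mul_bounded_linear]]) auto
  have [measurable]: "h \<in> borel_measurable borel"
    unfolding h_def[abs_def] by measurable
  have \<psi>: "\<psi> (pair (m + L *v z)) = z" for z
  proof -
    have "vector [(m + L *v z) $ 1, (m + L *v z) $ 2] = m + L *v z"
      by (simp add: vec_eq_iff forall_2)
    then show ?thesis
      by (simp add: \<psi>_def pair_def matrix_vector_mul_assoc L')
  qed
  have "distr lborel borel (\<lambda>z. pair (m + L *v z)) =
      distr (distr (distr lborel borel ((*v) L)) borel ((+) m)) borel pair"
    by (simp add: distr_distr comp_def)
  also have "distr (distr lborel borel ((*v) L)) borel ((+) m) =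
      density (distr lborel borel ((+) m)) (\<lambda>_. ennreal c)"
    unfolding lborel_distr_matrix[OF det] c_def by (subst density_distr) simp_all
  also have "distr \<dots> borel pair = density (distr lborel borel pair) (\<lambda>_. ennreal c)"
    unfolding lborel_distr_plus by (subst density_distr) simp_all
  also have "distr lborel borel pair = lborel"
    unfolding pair_def[abs_def] by (rule lborel_distr_vec2_pair)
  finally have leb: "distr lborel borel (\<lambda>z. pair (m + L *v z)) = density lborel (\<lambda>_. ennreal c)" .
  have "distr M borel (\<lambda>\<omega>. pair (V \<omega>)) = distr (distr M borel V) borel pair"
    by (subst distr_distr) (simp_all add: comp_def)
  also have "\<dots> = distr std_normal_measure borel (\<lambda>z. pair (m + L *v z))"
    unfolding L by (subst distr_distr) (simp_all add: comp_def)
  \<comment> \<open>The density is rewritten as a function of the image point, so that it can be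
    carried through the image measure.\<close>
  also have "std_normal_measure = density lborel (\<lambda>z. ennreal (h (\<psi> (pair (m + L *v z)))))"
    unfolding \<psi> by (simp add: std_normal_measure_def h_def)
  also have "distr \<dots> borel (\<lambda>z. pair (m + L *v z)) =
      density (distr lborel borel (\<lambda>z. pair (m + L *v z))) (\<lambda>p. ennreal (h (\<psi> p)))"
    by (subst density_distr) simp_all
  also have "\<dots> = density lborel (\<lambda>p. ennreal (c * h (\<psi> p)))"
    unfolding leb by (subst density_density_eq) (simp_all add: ennreal_mult'[symmetric] c_def h_def)
  finally have dens: "distr M borel (\<lambda>\<omega>. pair (V \<omega>)) = density lborel (\<lambda>p. ennreal (c * h (\<psi> p)))" .
  have "distr M lborel (\<lambda>\<omega>. pair (V \<omega>)) = distr M borel (\<lambda>\<omega>. pair (V \<omega>))"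
    by (intro distr_cong) simp_all
  then have "joint_density M (\<lambda>\<omega>. V \<omega> $ 1) (\<lambda>\<omega>. V \<omega> $ 2) (\<lambda>x y. c * h (\<psi> (x, y)))"
    unfolding joint_density_def distributed_def using dens
    by (simp add: pair_def[symmetric] c_def h_def case_prod_beta' measurable_lborel1)
  then show ?thesis by blast
qed

text \<open>Fubini's theorem for a bounded integrand. The bound on \<open>G\<close> is asked for on
  \<open>J\<close> only, since the exponential weights of the power loss are bounded on a half-line
  but not on the whole line. \<open>J\<close> may differ from the interval by a null set, since the
  events lead to closed half-lines while \<open>LBINT\<close> runs over open intervals.\<close>

lemma joint_density_expectation:
  fixes G :: "real \<Rightarrow> real" and J :: "real set"
  assumes M: "prob_space M" and f: "joint_density M X Y f"
    and [measurable]: "G \<in> borel_measurable borel" "J \<in> sets borel"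
    and G: "\<And>y. y \<in> J \<Longrightarrow> \<bar>G y\<bar> \<le> c"
    and J: "AE y in lborel. y \<in> J \<longleftrightarrow> y \<in> einterval p q" and pq: "p \<le> q"
  shows "(\<integral>\<omega>. indicator {b..} (X \<omega>) * (indicator J (Y \<omega>) * G (Y \<omega>)) \<partial>M) =
    (LBINT x=ereal b..\<infinity>. (LBINT y=p..q. G y * f x y))"
    and "integrable M (\<lambda>\<omega>. indicator {b..} (X \<omega>) * (indicator J (Y \<omega>) * G (Y \<omega>)))"
proof -
  interpret prob_space M by fact
  have f0: "0 \<le> f x y" for x y
    using f by (simp add: joint_density_def)
  have D: "distributed M lborel (\<lambda>\<omega>. (X \<omega>, Y \<omega>)) (\<lambda>(x, y). ennreal (f x y))"
    using f by (simp add: joint_density_def)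
  have D': "distributed M lborel (\<lambda>\<omega>. (X \<omega>, Y \<omega>)) (\<lambda>p. ennreal (f (fst p) (snd p)))"
    using D by (simp add: case_prod_beta')
  \<comment> \<open>Measurability is given for the extended-real version of the density;
    nonnegativity recovers \<open>f\<close> from it.\<close>
  have "(\<lambda>p. enn2real (ennreal (f (fst p) (snd p)))) \<in> borel_measurable lborel"
    using distributed_borel_measurable[OF D'] by measurable
  then have fM: "(\<lambda>p. f (fst p) (snd p)) \<in> borel_measurable borel"
    by (simp add: f0 measurable_lborel1)
  have f_sec [measurable]: "f x \<in> borel_measurable borel" for x
  proof -
    have "(\<lambda>y. (x, y)) \<in> borel_measurable borel"
      by (intro borel_measurable_continuous_onI continuous_intros)
    from measurable_compose[OF this fM] show ?thesis by simp
  qed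
  define g where "g p = indicator {b..} (fst p) * (indicator J (snd p) * G (snd p))" for p :: "real \<times> real"
  have [measurable]: "fst \<in> borel_measurable (borel :: (real \<times> real) measure)"
    "snd \<in> borel_measurable (borel :: (real \<times> real) measure)"
    by (simp_all add: borel_prod[symmetric])
  have gM: "g \<in> borel_measurable borel"
    unfolding g_def[abs_def] by measurable
  have XY: "(\<lambda>\<omega>. (X \<omega>, Y \<omega>)) \<in> borel_measurable M"
    using distributed_measurable[OF D] by simp
  have gbd: "\<bar>g p\<bar> \<le> \<bar>c\<bar>" for p
    using G[of "snd p"] by (auto simp: g_def split: split_indicator)
  have gint: "integrable M (\<lambda>\<omega>. g (X \<omega>, Y \<omega>))"
    using measurable_compose[OF XY gM] gbd by (intro integrable_const_bound[where B="\<bar>c\<bar>"]) auto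
  then show "integrable M (\<lambda>\<omega>. indicator {b..} (X \<omega>) * (indicator J (Y \<omega>) * G (Y \<omega>)))"
    by (simp add: g_def)
  have gint': "integrable (lborel \<Otimes>\<^sub>M lborel) (\<lambda>p. f (fst p) (snd p) * g p)"
    using distributed_integrable[OF D', of g] gint gM f0 by (simp add: lborel_prod)
  have "(\<integral>\<omega>. g (X \<omega>, Y \<omega>) \<partial>M) = (\<integral>p. f (fst p) (snd p) * g p \<partial>lborel)"
    using distributed_integral[OF D', of g] gM f0 by simp
  also have "\<dots> = (\<integral>x. (\<integral>y. f x y * g (x, y) \<partial>lborel) \<partial>lborel)"
    using lborel_pair.integral_fst'[OF gint'] by (simp add: lborel_prod)
  also have "\<dots> = (\<integral>x. indicator {b..} x * (LBINT y=p..q. G y * f x y) \<partial>lborel)"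
  proof (rule Bochner_Integration.integral_cong[OF refl])
    fix x
    have "(\<integral>y. f x y * g (x, y) \<partial>lborel) = (\<integral>y. indicator {b..} x * (indicator (einterval p q) y * (G y * f x y)) \<partial>lborel)"
    proof (rule integral_cong_AE)
      show "AE y in lborel. f x y * g (x, y) = indicator {b..} x * (indicator (einterval p q) y * (G y * f x y))"
        using J by eventually_elim (simp add: g_def indicator_def)
    qed (simp_all add: g_def)
    then show "(\<integral>y. f x y * g (x, y) \<partial>lborel) = indicator {b..} x * (LBINT y=p..q. G y * f x y)"
      using pq by (simp add: interval_lebesgue_integral_def set_lebesgue_integral_def)
  qed
  also have "\<dots> = (\<integral>x. indicator (einterval (ereal b) \<infinity>) x * (LBINT y=p..q. G y * f x y) \<partial>lborel)"
  proof (rule integral_cong_AE)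
    have inner: "(\<lambda>x. LBINT y=p..q. G y * f x y) \<in> borel_measurable borel"
    proof -
      have "(\<lambda>p. f (fst p) (snd p)) \<in> borel_measurable (borel \<Otimes>\<^sub>M borel)"
        using fM by (simp add: borel_prod)
      then have "(\<lambda>(x, y). indicator (einterval p q) y *\<^sub>R (G y * f x y)) \<in> borel_measurable (borel \<Otimes>\<^sub>M lborel)"
        by (simp add: case_prod_beta')
      then show ?thesis
        using pq unfolding interval_lebesgue_integral_def set_lebesgue_integral_def
        by (simp add: lborel.borel_measurable_lebesgue_integral)
    qed
    then show "(\<lambda>x. indicator {b..} x * (LBINT y=p..q. G y * f x y)) \<in> borel_measurable lborel"
      "(\<lambda>x. indicator (einterval (ereal b) \<infinity>) x * (LBINT y=p..q. G y * f x y)) \<in> borel_measurable lborel"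
      by (simp_all add: measurable_lborel1)
    show "AE x in lborel. indicator {b..} x * (LBINT y=p..q. G y * f x y) =
        indicator (einterval (ereal b) \<infinity>) x * (LBINT y=p..q. G y * f x y)"
      using AE_lborel_singleton[of b] by eventually_elim (auto simp: einterval_def split: split_indicator)
  qed
  also have "\<dots> = (LBINT x=ereal b..\<infinity>. (LBINT y=p..q. G y * f x y))"
    by (simp add: interval_lebesgue_integral_def set_lebesgue_integral_def)
  finally show "(\<integral>\<omega>. indicator {b..} (X \<omega>) * (indicator J (Y \<omega>) * G (Y \<omega>)) \<partial>M) =
    (LBINT x=ereal b..\<infinity>. (LBINT y=p..q. G y * f x y))"
    by (simp add: g_def)
qed

section \<open>Risk functions of the digital option\<close>

text \<open>The sets differ at most in the endpoint. For infinite \<open>e\<close> they coincide,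
  and the default value 0 of \<open>real_of_ereal\<close> removes a harmless point.\<close>

lemma AE_atLeast_iff_einterval: "AE y in lborel. y \<in> {y. e \<le> ereal y} \<longleftrightarrow> y \<in> einterval e \<infinity>"
  using AE_lborel_singleton[of "real_of_ereal e"]
  by eventually_elim (cases e; auto simp: einterval_def)

lemma AE_atMost_iff_einterval: "AE y in lborel. y \<in> {y. ereal y \<le> e} \<longleftrightarrow> y \<in> einterval (-\<infinity>) e"
  using AE_lborel_singleton[of "real_of_ereal e"]
  by eventually_elim (cases e; auto simp: einterval_def)

text \<open>The common form of the problem under \<open>P\<close>, with \<open>X\<close>,
  \<open>Y\<close>, \<open>b\<close>, \<open>B * T\<close>, and under \<open>Pt\<close>, with
  \<open>Xt\<close>, \<open>Yt\<close>, \<open>bt\<close>, \<open>Bt * T\<close>: the same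
  \<open>H\<close> and \<open>Z\<close> in two sets of coordinates. The formula for \<open>H\<close>
  is almost sure because the stock prices are identified only almost surely.\<close>

locale digital_claim = prob_space M for M :: "'a measure" +
  fixes X Y Z H :: "'a \<Rightarrow> real" and f :: "real \<Rightarrow> real \<Rightarrow> real" and K b \<beta> :: real
  assumes density: "joint_density M X Y f" and K_pos: "0 < K"
    and H_measurable [measurable]: "H \<in> borel_measurable M"
    and H_eq: "AE \<omega> in M. H \<omega> = K * indicator {b..} (X \<omega>)"
    and Z_eq: "\<And>\<omega>. Z \<omega> = exp (- (Y \<omega> + \<beta>))"
begin

lemma XY_measurable [measurable]: "X \<in> borel_measurable M" "Y \<in> borel_measurable M"
proof -
  have XY: "(\<lambda>\<omega>. (X \<omega>, Y \<omega>)) \<in> M \<rightarrow>\<^sub>M borel"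
    using density distributed_measurable unfolding joint_density_def by fastforce
  have "fst \<in> borel_measurable (borel :: (real \<times> real) measure)"
    "snd \<in> borel_measurable (borel :: (real \<times> real) measure)"
    by (simp_all add: borel_prod[symmetric])
  from measurable_compose[OF XY this(1)] measurable_compose[OF XY this(2)]
  show "X \<in> borel_measurable M" "Y \<in> borel_measurable M" by simp_all
qed

lemma Z_measurable [measurable]: "Z \<in> borel_measurable M"
  unfolding Z_eq[abs_def] by measurable

lemmas expectation_eq = joint_density_expectation[OF prob_space_axioms density]

lemma digital_linear:
  assumes "0 \<le> c"
  shows "(\<integral>\<omega>. H \<omega> * indicator {\<omega>. inverse (Z \<omega>) \<ge> c} \<omega> \<partial>M) =
    K * (LBINT x=ereal b..\<infinity>. (LBINT y=eln c - ereal \<beta>..\<infinity>. f x y))"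
proof -
  let ?J = "{y. eln c - ereal \<beta> \<le> ereal y}"
  \<comment> \<open>For \<open>c = 0\<close> both sides hold: \<open>inverse (Z \<omega>)\<close> is
    positive, and the bound is -\<infinity>.\<close>
  have iff: "c \<le> inverse (Z \<omega>) \<longleftrightarrow> Y \<omega> \<in> ?J" for \<omega>
  proof (cases "c = 0")
    case False
    then have "0 < c"
      using assms by simp
    then have "c \<le> exp (Y \<omega> + \<beta>) \<longleftrightarrow> ln c \<le> Y \<omega> + \<beta>"
      by (metis exp_le_cancel_iff exp_ln)
    then show ?thesis
      using False by (simp add: Z_eq eln_def exp_minus[symmetric] algebra_simps)
  qed (simp add: eln_def Z_eq)
  have "(\<integral>\<omega>. H \<omega> * indicator {\<omega>. inverse (Z \<omega>) \<ge> c} \<omega> \<partial>M) =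
      (\<integral>\<omega>. K * (indicator {b..} (X \<omega>) * (indicator ?J (Y \<omega>) * 1)) \<partial>M)"
  proof (rule integral_cong_AE)
    show "AE \<omega> in M. H \<omega> * indicator {\<omega>. inverse (Z \<omega>) \<ge> c} \<omega> =
        K * (indicator {b..} (X \<omega>) * (indicator ?J (Y \<omega>) * 1))"
      using H_eq by eventually_elim (simp add: iff indicator_def)
  qed measurable
  also have "\<dots> = K * (LBINT x=ereal b..\<infinity>. (LBINT y=eln c - ereal \<beta>..\<infinity>. 1 * f x y))"
    by (subst integral_mult_right_zero, subst expectation_eq(1)[where c=1 and G="\<lambda>_. 1", OF _ _ _ AE_atLeast_iff_einterval])
      auto
  finally show ?thesis by simp
qed

text \<open>Taking logarithms turns \<open>K \<le> v \<omega>\<close> into an upper bound on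
  \<open>Y \<omega>\<close>. The quotient is \<open>c / K powr (p - 1)\<close> and not its
  reciprocal: a larger \<open>c\<close> increases \<open>v\<close> and so enlarges the region where
  the minimum in \<open>phi_pow\<close> is 1.\<close>

lemma phi_pow_threshold:
  fixes p c :: real
  assumes "1 < p" "0 < c"
  defines "v \<equiv> (\<lambda>\<omega>. (c * Z \<omega>) powr (1 / (p - 1)))"
  shows "v \<omega> = c powr (1 / (p - 1)) * exp (- ((Y \<omega> + \<beta>) / (p - 1)))"
    and "K \<le> v \<omega> \<longleftrightarrow> ereal (Y \<omega>) \<le> eln (c / K powr (p - 1)) - ereal \<beta>"
proof -
  have v: "v \<omega> = exp ((ln c - (Y \<omega> + \<beta>)) / (p - 1))"
    using assms by (simp add: v_def Z_eq powr_def ln_mult)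
  then show "v \<omega> = c powr (1 / (p - 1)) * exp (- ((Y \<omega> + \<beta>) / (p - 1)))"
    using assms by (simp add: powr_def exp_add[symmetric] diff_divide_distrib)
  have "K \<le> v \<omega> \<longleftrightarrow> ln K \<le> (ln c - (Y \<omega> + \<beta>)) / (p - 1)"
    unfolding v using K_pos by (metis exp_le_cancel_iff exp_ln)
  also have "\<dots> \<longleftrightarrow> (p - 1) * ln K \<le> ln c - (Y \<omega> + \<beta>)"
    using assms by (simp add: pos_le_divide_eq mult.commute)
  also have "\<dots> \<longleftrightarrow> ereal (Y \<omega>) \<le> eln (c / K powr (p - 1)) - ereal \<beta>"
    using assms K_pos by (auto simp: eln_def ln_div ln_powr)
  finally show "K \<le> v \<omega> \<longleftrightarrow> ereal (Y \<omega>) \<le> eln (c / K powr (p - 1)) - ereal \<beta>" .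
qed

text \<open>On \<open>b \<le> X \<omega>\<close> the shortfall is the minimum of \<open>K\<close>
  and the power of \<open>c * Z \<omega>\<close>, and \<open>e\<close> is the value of
  \<open>Y\<close> at which the two agree. The half-line up to \<open>e\<close> is closed and the
  one beyond it open, so that they partition the line.\<close>

lemma digital_power_expectation:
  assumes p: "1 < p" and c: "0 \<le> c"
  defines "e \<equiv> eln (c / K powr (p - 1)) - ereal \<beta>"
  shows "1 / p * (\<integral>\<omega>. ((1 - phi_pow p Z H c \<omega>) * H \<omega>) powr p \<partial>M) =
    K powr p / p * (LBINT x=ereal b..\<infinity>. (LBINT y=-\<infinity>..e. f x y)) +
    1 / p * c powr (p / (p - 1)) *
      (LBINT x=ereal b..\<infinity>. (LBINT y=e..\<infinity>. exp (- (p * (y + \<beta>) / (p - 1))) * f x y))"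
proof (cases "c = 0")
  \<comment> \<open>For \<open>c = 0\<close> the shortfall vanishes. On the right the first inner
    interval is empty, and the factor \<open>c powr (p / (p - 1))\<close> is 0; the second integrand
    would be unbounded there, which is why this case is separate.\<close>
  case True
  have "((1 - phi_pow p Z H c \<omega>) * H \<omega>) powr p = 0" if "H \<omega> = K * indicator {b..} (X \<omega>)" for \<omega>
    using that K_pos p by (auto simp: phi_pow_def True split: split_indicator)
  then have "(\<integral>\<omega>. ((1 - phi_pow p Z H c \<omega>) * H \<omega>) powr p \<partial>M) = (\<integral>\<omega>. 0 \<partial>M)"
    using H_eq by (intro integral_cong_AE) (auto simp: phi_pow_def)
  moreover have "e = -\<infinity>"
    by (simp add: e_def True eln_def)
  ultimately show ?thesis
    using p by (simp add: True)
next
  case False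
  then have c: "0 < c"
    using c by simp
  then have "e = ereal (ln (c / K powr (p - 1)) - \<beta>)"
    using K_pos by (simp add: e_def eln_def)
  then obtain r where r: "e = ereal r" by blast
  let ?G = "\<lambda>y. exp (- (p * (y + \<beta>) / (p - 1)))" and ?J = "{y. ereal y \<le> e}"
  note thr = phi_pow_threshold[OF p c, folded e_def]
  have "((1 - phi_pow p Z H c \<omega>) * H \<omega>) powr p =
      K powr p * (indicator {b..} (X \<omega>) * (indicator ?J (Y \<omega>) * 1)) +
      c powr (p / (p - 1)) * (indicator {b..} (X \<omega>) * (indicator (einterval e \<infinity>) (Y \<omega>) * ?G (Y \<omega>)))"
    if H: "H \<omega> = K * indicator {b..} (X \<omega>)" for \<omega>
  proof (cases "b \<le> X \<omega>")
    case True
    let ?v = "(c * Z \<omega>) powr (1 / (p - 1))"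
    have HK: "H \<omega> = K"
      using True H by simp
    then have lhs: "(1 - phi_pow p Z H c \<omega>) * H \<omega> = min ?v K"
      using K_pos by (simp add: phi_pow_def min_def field_simps)
    have "?v powr p = c powr (p / (p - 1)) * ?G (Y \<omega>)"
      using c unfolding thr(1) by (simp add: powr_mult powr_powr exp_powr_real algebra_simps)
    then show ?thesis
      using True thr(2)[of \<omega>] unfolding lhs by (auto simp: min_def einterval_def not_le split: split_indicator)
  next
    case False
    then show ?thesis
      using H p by simp
  qed
  then have "(\<integral>\<omega>. ((1 - phi_pow p Z H c \<omega>) * H \<omega>) powr p \<partial>M) =
      (\<integral>\<omega>. K powr p * (indicator {b..} (X \<omega>) * (indicator ?J (Y \<omega>) * 1)) +
      c powr (p / (p - 1)) * (indicator {b..} (X \<omega>) * (indicator (einterval e \<infinity>) (Y \<omega>) * ?G (Y \<omega>))) \<partial>M)"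
    using H_eq by (intro integral_cong_AE) (auto simp: phi_pow_def[abs_def])
  also have "\<dots> = K powr p * (LBINT x=ereal b..\<infinity>. (LBINT y=-\<infinity>..e. 1 * f x y)) +
      c powr (p / (p - 1)) * (LBINT x=ereal b..\<infinity>. (LBINT y=e..\<infinity>. ?G y * f x y))"
  proof -
    have E1: "(\<integral>\<omega>. indicator {b..} (X \<omega>) * (indicator ?J (Y \<omega>) * 1) \<partial>M) =
        (LBINT x=ereal b..\<infinity>. (LBINT y=-\<infinity>..e. 1 * f x y))"
      "integrable M (\<lambda>\<omega>. indicator {b..} (X \<omega>) * (indicator ?J (Y \<omega>) * 1 :: real))"
      by (rule expectation_eq[where c=1 and G="\<lambda>_. 1", OF _ _ _ AE_atMost_iff_einterval]; simp)+
    have G: "\<bar>?G y\<bar> \<le> exp (- (p * (r + \<beta>) / (p - 1)))" if "y \<in> einterval e \<infinity>" for y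
      using that p by (simp add: r einterval_def divide_right_mono)
    have E2: "(\<integral>\<omega>. indicator {b..} (X \<omega>) * (indicator (einterval e \<infinity>) (Y \<omega>) * ?G (Y \<omega>)) \<partial>M) =
        (LBINT x=ereal b..\<infinity>. (LBINT y=e..\<infinity>. ?G y * f x y))"
      "integrable M (\<lambda>\<omega>. indicator {b..} (X \<omega>) * (indicator (einterval e \<infinity>) (Y \<omega>) * ?G (Y \<omega>)))"
      by (rule expectation_eq[where p=e and q=\<infinity>, OF _ _ G]; simp)+
    show ?thesis
      using E1 E2 by (subst Bochner_Integration.integral_add) (simp_all only: integrable_mult_right integral_mult_right_zero)
  qed
  finally show ?thesis
    by (simp add: distrib_left)
qed

text \<open>On \<open>b \<le> X \<omega>\<close> the integrand is \<open>K\<close> minus the same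
  minimum, hence 0 up to \<open>e\<close> and a difference of two terms beyond it. For positive
  \<open>c\<close> the exponential is bounded beyond \<open>e\<close>, so each term is integrable on
  its own.\<close>

lemma digital_power_cost:
  assumes p: "1 < p" and c: "0 \<le> c"
  defines "e \<equiv> eln (c / K powr (p - 1)) - ereal \<beta>"
  shows "(\<integral>\<omega>. H \<omega> * phi_pow p Z H c \<omega> \<partial>M) =
    K * (LBINT x=ereal b..\<infinity>. (LBINT y=e..\<infinity>. f x y)) -
    c powr (1 / (p - 1)) *
      (LBINT x=ereal b..\<infinity>. (LBINT y=e..\<infinity>. exp (- ((y + \<beta>) / (p - 1))) * f x y))"
proof -
  have E1: "(\<integral>\<omega>. indicator {b..} (X \<omega>) * (indicator (einterval e \<infinity>) (Y \<omega>) * 1) \<partial>M) =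
      (LBINT x=ereal b..\<infinity>. (LBINT y=e..\<infinity>. 1 * f x y))"
    "integrable M (\<lambda>\<omega>. indicator {b..} (X \<omega>) * (indicator (einterval e \<infinity>) (Y \<omega>) * 1 :: real))"
    by (rule expectation_eq[where c=1 and G="\<lambda>_. 1" and p=e and q=\<infinity>]; simp)+
  show ?thesis
  proof (cases "c = 0")
    case True
    then have e: "e = -\<infinity>"
      by (simp add: e_def eln_def)
    have "(\<integral>\<omega>. H \<omega> * phi_pow p Z H c \<omega> \<partial>M) =
        (\<integral>\<omega>. K * (indicator {b..} (X \<omega>) * (indicator (einterval e \<infinity>) (Y \<omega>) * 1)) \<partial>M)"
    proof (rule integral_cong_AE)
      show "AE \<omega> in M. H \<omega> * phi_pow p Z H c \<omega> =
          K * (indicator {b..} (X \<omega>) * (indicator (einterval e \<infinity>) (Y \<omega>) * 1))"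
        using H_eq by eventually_elim
          (use K_pos p in \<open>auto simp: phi_pow_def True e einterval_def split: split_indicator\<close>)
    qed (simp_all add: phi_pow_def[abs_def])
    then show ?thesis
      using E1(1) by (simp add: True)
  next
    case False
    then have c: "0 < c"
      using c by simp
    then have "e = ereal (ln (c / K powr (p - 1)) - \<beta>)"
      using K_pos by (simp add: e_def eln_def)
    then obtain r where r: "e = ereal r" by blast
    let ?G = "\<lambda>y. exp (- ((y + \<beta>) / (p - 1)))"
    note thr = phi_pow_threshold[OF p c, folded e_def]
    have G: "\<bar>?G y\<bar> \<le> exp (- ((r + \<beta>) / (p - 1)))" if "y \<in> einterval e \<infinity>" for y
      using that p by (simp add: r einterval_def divide_right_mono)
    have E2: "(\<integral>\<omega>. indicator {b..} (X \<omega>) * (indicator (einterval e \<infinity>) (Y \<omega>) * ?G (Y \<omega>)) \<partial>M) =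
        (LBINT x=ereal b..\<infinity>. (LBINT y=e..\<infinity>. ?G y * f x y))"
      "integrable M (\<lambda>\<omega>. indicator {b..} (X \<omega>) * (indicator (einterval e \<infinity>) (Y \<omega>) * ?G (Y \<omega>)))"
      by (rule expectation_eq[where p=e and q=\<infinity>, OF _ _ G]; simp)+
    have "H \<omega> * phi_pow p Z H c \<omega> =
        K * (indicator {b..} (X \<omega>) * (indicator (einterval e \<infinity>) (Y \<omega>) * 1)) -
        c powr (1 / (p - 1)) * (indicator {b..} (X \<omega>) * (indicator (einterval e \<infinity>) (Y \<omega>) * ?G (Y \<omega>)))"
      if H: "H \<omega> = K * indicator {b..} (X \<omega>)" for \<omega>
    proof (cases "b \<le> X \<omega>")
      case True
      let ?v = "(c * Z \<omega>) powr (1 / (p - 1))"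
      have HK: "H \<omega> = K"
        using True H by simp
      then have lhs: "H \<omega> * phi_pow p Z H c \<omega> = K - min ?v K"
        using K_pos by (simp add: phi_pow_def min_def field_simps)
      show ?thesis
        using True thr[of \<omega>] unfolding lhs by (auto simp: min_def einterval_def not_le split: split_indicator)
    next
      case False
      then show ?thesis
        using H by simp
    qed
    then have "(\<integral>\<omega>. H \<omega> * phi_pow p Z H c \<omega> \<partial>M) =
        (\<integral>\<omega>. K * (indicator {b..} (X \<omega>) * (indicator (einterval e \<infinity>) (Y \<omega>) * 1)) -
        c powr (1 / (p - 1)) * (indicator {b..} (X \<omega>) * (indicator (einterval e \<infinity>) (Y \<omega>) * ?G (Y \<omega>))) \<partial>M)"
      using H_eq by (intro integral_cong_AE) (auto simp: phi_pow_def[abs_def])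
    also have "\<dots> = K * (LBINT x=ereal b..\<infinity>. (LBINT y=e..\<infinity>. 1 * f x y)) -
        c powr (1 / (p - 1)) * (LBINT x=ereal b..\<infinity>. (LBINT y=e..\<infinity>. ?G y * f x y))"
      using E1 E2 by (subst Bochner_Integration.integral_diff) (simp_all only: integrable_mult_right integral_mult_right_zero)
    finally show ?thesis by simp
  qed
qed

end

section \<open>Application to the two-asset market\<close>

lemma normal_vector_cong_AE:
  assumes V: "normal_vector M V m C" and "AE \<omega> in M. V \<omega> = V' \<omega>" and V': "V' \<in> borel_measurable M"
  shows "normal_vector M V' m C"
proof -
  have "distr M borel V = distr M borel V'"
    using assms by (intro distr_cong_AE) (auto simp: normal_vector_def)
  then show ?thesis
    using V V' by (simp add: normal_vector_def)
qed

lemma black_scholes_2d_stock: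
  assumes "black_scholes_2d P F T \<rho> \<alpha> \<sigma> s W S"
  shows "AE \<omega> in P. S T \<omega> $ i = s $ i * exp ((\<alpha> $ i - (\<sigma> $ i)\<^sup>2 / 2) * T + \<sigma> $ i * W T \<omega> $ i)"
proof -
  have "corr_matrix \<rho> $ i $ i = 1"
    using exhaust_2[of i] by (auto simp: corr_matrix_def)
  then have "scalar_brownian P F T (corr_matrix \<rho>) W i"
    using assms unfolding black_scholes_2d_def scalar_brownian_def scalar_brownian_axioms_def by auto
  then interpret scalar_brownian P F T "corr_matrix \<rho>" W i .
  have "has_ito_differential P F T w (\<lambda>t \<omega>. S t \<omega> $ i) (\<lambda>t \<omega>. S t \<omega> $ i * \<alpha> $ i) (\<lambda>t \<omega>. S t \<omega> $ i * \<sigma> $ i)"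
    "\<And>\<omega>. \<omega> \<in> space P \<Longrightarrow> S 0 \<omega> $ i = s $ i"
    using assms unfolding black_scholes_2d_def w_def[abs_def] by auto
  from geometric_sde_solution[OF this] show ?thesis
    by (simp add: w_def)
qed

text \<open>\<open>\<sigma> $ 1 * A $ 2 + \<sigma> $ 2 * A $ 1\<close> is the determinant of the
  linear map taking \<open>W T\<close> to (X, Y). If it vanishes, as for \<theta> = 0, the law sits
  on a line and has no planar density. Existence of densities is therefore conditional, and the
  formulas are stated for all densities.\<close>

theorem mainTheorem4:
  fixes P :: "'a measure" and F :: "real \<Rightarrow> 'a measure"
    and T \<rho> r K :: real and \<alpha> \<sigma> s :: "real^2"
    and W S Wt :: "real \<Rightarrow> 'a \<Rightarrow> real^2"
    and \<theta> A :: "real^2" and B Bt b bt :: real and Pt :: "'a measure"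
    and Z H X Y Xt Yt :: "'a \<Rightarrow> real"
  assumes market: "black_scholes_2d P F T \<rho> \<alpha> \<sigma> s W S"
    and K: "0 < K"
  defines "\<theta> \<equiv> (\<chi> i. (\<alpha> $ i - r) / \<sigma> $ i)"
    and "Wt \<equiv> (\<lambda>t \<omega>. W t \<omega> + t *\<^sub>R \<theta>)"
    and "A \<equiv> matrix_inv (corr_matrix \<rho>) *v \<theta>"
    and "B \<equiv> 1/2 * (norm (matrix_inv_sqrt (corr_matrix \<rho>) *v \<theta>))\<^sup>2"
    and "Bt \<equiv> B - A $ 1 * \<theta> $ 1 - A $ 2 * \<theta> $ 2"
    and "Z \<equiv> (\<lambda>\<omega>. exp (- A $ 1 * W T \<omega> $ 1 - A $ 2 * W T \<omega> $ 2 - B * T))"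
    and "Pt \<equiv> mart_measure P Z"
    and "b \<equiv> ln (s $ 2 / s $ 1) + (\<alpha> $ 2 - \<alpha> $ 1 - 1/2 * ((\<sigma> $ 2)\<^sup>2 - (\<sigma> $ 1)\<^sup>2)) * T"
    and "bt \<equiv> ln (s $ 2 / s $ 1) - 1/2 * ((\<sigma> $ 2)\<^sup>2 - (\<sigma> $ 1)\<^sup>2) * T"
    and "H \<equiv> (\<lambda>\<omega>. K * indicator {\<omega>. S T \<omega> $ 1 \<ge> S T \<omega> $ 2} \<omega>)"
    and "X \<equiv> (\<lambda>\<omega>. \<sigma> $ 1 * W T \<omega> $ 1 - \<sigma> $ 2 * W T \<omega> $ 2)"
    and "Y \<equiv> (\<lambda>\<omega>. A $ 1 * W T \<omega> $ 1 + A $ 2 * W T \<omega> $ 2)"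
    and "Xt \<equiv> (\<lambda>\<omega>. \<sigma> $ 1 * Wt T \<omega> $ 1 - \<sigma> $ 2 * Wt T \<omega> $ 2)"
    and "Yt \<equiv> (\<lambda>\<omega>. A $ 1 * Wt T \<omega> $ 1 + A $ 2 * Wt T \<omega> $ 2)"
  shows
    "(\<exists>m C. normal_vector P (\<lambda>\<omega>. vector [X \<omega>, Y \<omega>] :: real^2) m C) \<and>
     (\<exists>m C. normal_vector Pt (\<lambda>\<omega>. vector [Xt \<omega>, Yt \<omega>] :: real^2) m C) \<and>
     (\<sigma> $ 1 * A $ 2 + \<sigma> $ 2 * A $ 1 \<noteq> 0 \<longrightarrow>
        (\<exists>f. joint_density P X Y f) \<and> (\<exists>ft. joint_density Pt Xt Yt ft)) \<and>
     (\<forall>f ft. joint_density P X Y f \<longrightarrow> joint_density Pt Xt Yt ft \<longrightarrow>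
       (\<forall>c\<ge>0.
          Psi1_lin P Z H c =
            K * (LBINT x=ereal b..\<infinity>. (LBINT y=eln c - ereal (B * T)..\<infinity>. f x y)) \<and>
          Psi2_lin P Z H c =
            K * (LBINT x=ereal bt..\<infinity>. (LBINT y=eln c - ereal (Bt * T)..\<infinity>. ft x y)) \<and>
          (\<forall>p>1.
             Psi1_pow p P Z H c =
               K powr p / p *
                 (LBINT x=ereal b..\<infinity>.
                    (LBINT y=-\<infinity>..eln (c / K powr (p - 1)) - ereal (B * T). f x y)) +
               1 / p * c powr (p / (p - 1)) *
                 (LBINT x=ereal b..\<infinity>.
                    (LBINT y=eln (c / K powr (p - 1)) - ereal (B * T)..\<infinity>.
                       exp (- (p * (y + B * T) / (p - 1))) * f x y)) \<and>
             Psi2_pow p P Z H c =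
               K * (LBINT x=ereal bt..\<infinity>.
                      (LBINT y=eln (c / K powr (p - 1)) - ereal (Bt * T)..\<infinity>. ft x y)) -
               c powr (1 / (p - 1)) *
                 (LBINT x=ereal bt..\<infinity>.
                    (LBINT y=eln (c / K powr (p - 1)) - ereal (Bt * T)..\<infinity>.
                       exp (- ((y + Bt * T) / (p - 1))) * ft x y)))))"
proof -
  let ?Q = "corr_matrix \<rho>"
  have PS: "prob_space P" and T: "0 < T" and pd: "pos_def_matrix ?Q"
    and wien: "wiener_process P F T ?Q W" and sub: "\<And>t. subalgebra P (F t)"
    and pos: "\<And>i. 0 < \<sigma> $ i \<and> 0 < s $ i"
    and SF: "\<And>i. adapted_continuous P F T (\<lambda>t \<omega>. S t \<omega> $ i)"
    using market unfolding black_scholes_2d_def has_ito_differential_def by auto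
  interpret prob_space P by fact
  note rho = pos_def_corr_matrixD[OF pd]
  have detQ: "0 < 1 - \<rho>\<^sup>2"
    using mult_pos_pos[OF rho] by (simp add: power2_eq_square algebra_simps)
  define V where "V = W T"
  have VM [measurable]: "V \<in> borel_measurable P"
    using wien T measurable_from_subalg[OF sub[of T], of "W T"]
    unfolding wiener_process_def adapted_continuous_def V_def by auto
  have nV: "normal_vector P V 0 (T *\<^sub>R ?Q)"
  proof (rule normal_vector_cong_AE)
    show "normal_vector P (\<lambda>\<omega>. W T \<omega> - W 0 \<omega>) 0 (T *\<^sub>R ?Q)"
    proof -
      have "\<forall>s\<in>{0..T}. \<forall>t\<in>{s..T}. normal_vector P (\<lambda>\<omega>. W t \<omega> - W s \<omega>) 0 ((t - s) *\<^sub>R ?Q)"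
        using wien unfolding wiener_process_def by blast
      from bspec[OF bspec[OF this, of 0], of T] T show ?thesis
        by simp
    qed
    have "AE \<omega> in P. W 0 \<omega> = 0"
      using wien by (simp add: wiener_process_def)
    then show "AE \<omega> in P. W T \<omega> - W 0 \<omega> = V \<omega>"
      by eventually_elim (simp add: V_def)
  qed (fact VM)
  note invQ = matrix_inv_corr_matrix(2)[OF rho]
  have "?Q *v A = \<theta>"
    by (simp add: A_def matrix_vector_mul_assoc invQ)
  then have QA: "(T *\<^sub>R ?Q) *v A = T *\<^sub>R \<theta>"
    by (simp add: scaleR_matrix_vector_assoc[symmetric])
  \<comment> \<open>With this, \<open>B * T\<close> is half the quadratic form of the covariance
    \<open>T *\<^sub>R ?Q\<close> at \<open>A\<close>, so \<open>Z\<close> is the density of the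
    Gaussian change of measure in direction \<open>A\<close>. By \<open>QA\<close> its drift is the
    shift from \<open>W T\<close> to \<open>Wt T\<close>.\<close>
  have B: "A \<bullet> \<theta> = 2 * B"
    using norm_matrix_inv_sqrt_corr_matrix[OF pd, of \<theta>] by (simp add: B_def A_def inner_commute)
  have Z_V: "Z \<omega> = exp (- (A \<bullet> V \<omega>) - A \<bullet> ((T *\<^sub>R ?Q) *v A) / 2)" for \<omega>
  proof -
    have "A \<bullet> (T *\<^sub>R \<theta>) / 2 = B * T"
      by (simp add: B)
    then show ?thesis
      unfolding QA by (simp add: Z_def V_def inner_vec_def sum_2)
  qed
  have Pt: "Pt = density P (\<lambda>\<omega>. ennreal (Z \<omega>))"
    by (simp add: Pt_def mart_measure_def)
  have nVt: "normal_vector Pt (Wt T) 0 (T *\<^sub>R ?Q)"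
    using normal_vector_girsanov[OF nV, of A, folded Z_V] unfolding Pt QA
    by (simp add: Wt_def V_def)
  \<comment> \<open>That \<open>Z\<close> has expectation 1 under \<open>P\<close> follows from the
    two Gaussian laws, with no integral to evaluate.\<close>
  have PSt: "prob_space Pt"
    using normal_vector_prob_space_iff[OF nV] normal_vector_prob_space_iff[OF nVt] PS by blast
  define N :: "real^2^2" where "N = vector [vector [\<sigma> $ 1, - \<sigma> $ 2], vector [A $ 1, A $ 2]]"
  have XY: "(vector [X \<omega>, Y \<omega>] :: real^2) = N *v V \<omega>" for \<omega>
    by (simp add: X_def Y_def V_def N_def vec_eq_iff forall_2 matrix_vector_mult_def sum_2)
  have XYt: "(vector [Xt \<omega>, Yt \<omega>] :: real^2) = N *v Wt T \<omega>" for \<omega>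
    by (simp add: Xt_def Yt_def N_def vec_eq_iff forall_2 matrix_vector_mult_def sum_2)
  note nXY = normal_vector_linear[OF nV, of N, folded XY]
    and nXYt = normal_vector_linear[OF nVt, of N, folded XYt]
  have dens: "(\<exists>f. joint_density P X Y f) \<and> (\<exists>ft. joint_density Pt Xt Yt ft)"
    if "\<sigma> $ 1 * A $ 2 + \<sigma> $ 2 * A $ 1 \<noteq> 0"
  proof -
    have "det (T *\<^sub>R ?Q) = T\<^sup>2 * (1 - \<rho>\<^sup>2)"
      by (simp add: det_2 corr_matrix_def power2_eq_square algebra_simps)
    moreover have "det N \<noteq> 0"
      using that by (simp add: det_2 N_def)
    ultimately have "det (N ** (T *\<^sub>R ?Q) ** transpose N) \<noteq> 0"
      using T detQ by (simp add: det_mul det_transpose)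
    from normal_vector_joint_density[OF nXY this] normal_vector_joint_density[OF nXYt this]
    show ?thesis by simp
  qed
  have HM: "H \<in> borel_measurable P"
  proof -
    have [measurable]: "(\<lambda>\<omega>. S T \<omega> $ i) \<in> borel_measurable P" for i
      using SF[of i] T by (intro measurable_from_subalg[OF sub[of T]]) (simp add: adapted_continuous_def)
    show ?thesis
      unfolding H_def by measurable
  qed
  have H_X: "AE \<omega> in P. H \<omega> = K * indicator {b..} (X \<omega>)"
    using black_scholes_2d_stock[OF market, of 1] black_scholes_2d_stock[OF market, of 2]
  proof eventually_elim
    fix \<omega>
    assume S1: "S T \<omega> $ 1 = s $ 1 * exp ((\<alpha> $ 1 - (\<sigma> $ 1)\<^sup>2 / 2) * T + \<sigma> $ 1 * W T \<omega> $ 1)"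
      and S2: "S T \<omega> $ 2 = s $ 2 * exp ((\<alpha> $ 2 - (\<sigma> $ 2)\<^sup>2 / 2) * T + \<sigma> $ 2 * W T \<omega> $ 2)"
    have pos': "0 < S T \<omega> $ 1" "0 < S T \<omega> $ 2"
      using pos by (simp_all add: S1 S2)
    then have "S T \<omega> $ 2 \<le> S T \<omega> $ 1 \<longleftrightarrow> ln (S T \<omega> $ 2) \<le> ln (S T \<omega> $ 1)"
      by simp
    also have "\<dots> \<longleftrightarrow> b \<le> X \<omega>"
      using pos[of 1] pos[of 2] by (simp add: S1 S2 ln_mult ln_div b_def X_def algebra_simps)
    finally show "H \<omega> = K * indicator {b..} (X \<omega>)"
      by (simp add: H_def indicator_def)
  qed
  \<comment> \<open>Both sides move by \<open>(\<alpha> $ 1 - \<alpha> $ 2) * T\<close>, since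
    \<open>\<sigma> $ i * \<theta> $ i = \<alpha> $ i - r\<close> and the interest rate cancels. The
    exercise event is the same in both coordinates.\<close>
  have Xt_X: "bt \<le> Xt \<omega> \<longleftrightarrow> b \<le> X \<omega>" for \<omega>
  proof -
    have "\<sigma> $ i * \<theta> $ i = \<alpha> $ i - r" for i
      using pos[of i] by (simp add: \<theta>_def)
    moreover have "Xt \<omega> = X \<omega> + (\<sigma> $ 1 * \<theta> $ 1 - \<sigma> $ 2 * \<theta> $ 2) * T"
      by (simp add: Xt_def X_def Wt_def algebra_simps)
    ultimately have "Xt \<omega> = X \<omega> + (\<alpha> $ 1 - \<alpha> $ 2) * T"
      by simp
    moreover have "bt = b + (\<alpha> $ 1 - \<alpha> $ 2) * T"
      by (simp add: bt_def b_def algebra_simps)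
    ultimately show ?thesis
      by simp
  qed
  have H_Xt: "AE \<omega> in Pt. H \<omega> = K * indicator {bt..} (Xt \<omega>)"
  proof -
    have "Z \<in> borel_measurable P"
      unfolding Z_V[abs_def] by measurable
    then show ?thesis
      unfolding Pt using H_X by (subst AE_density) (auto simp: indicator_def Xt_X)
  qed
  have Z_Y: "Z \<omega> = exp (- (Y \<omega> + B * T))" for \<omega>
    by (simp add: Z_def Y_def)
  \<comment> \<open>Passing from \<open>W\<close> to \<open>Wt\<close> adds
    \<open>T * (A \<bullet> \<theta>)\<close> to \<open>Y\<close>, and \<open>Bt\<close> is smaller
    than \<open>B\<close> by \<open>A \<bullet> \<theta>\<close> to compensate.\<close>
  have Z_Yt: "Z \<omega> = exp (- (Yt \<omega> + Bt * T))" for \<omega>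
    by (simp add: Z_def Yt_def Wt_def Bt_def algebra_simps)
  have "(Psi1_lin P Z H c =
            K * (LBINT x=ereal b..\<infinity>. (LBINT y=eln c - ereal (B * T)..\<infinity>. f x y)) \<and>
          Psi2_lin P Z H c =
            K * (LBINT x=ereal bt..\<infinity>. (LBINT y=eln c - ereal (Bt * T)..\<infinity>. ft x y)) \<and>
          (\<forall>p>1.
             Psi1_pow p P Z H c =
               K powr p / p *
                 (LBINT x=ereal b..\<infinity>.
                    (LBINT y=-\<infinity>..eln (c / K powr (p - 1)) - ereal (B * T). f x y)) +
               1 / p * c powr (p / (p - 1)) *
                 (LBINT x=ereal b..\<infinity>.
                    (LBINT y=eln (c / K powr (p - 1)) - ereal (B * T)..\<infinity>.
                       exp (- (p * (y + B * T) / (p - 1))) * f x y)) \<and>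
             Psi2_pow p P Z H c =
               K * (LBINT x=ereal bt..\<infinity>.
                      (LBINT y=eln (c / K powr (p - 1)) - ereal (Bt * T)..\<infinity>. ft x y)) -
               c powr (1 / (p - 1)) *
                 (LBINT x=ereal bt..\<infinity>.
                    (LBINT y=eln (c / K powr (p - 1)) - ereal (Bt * T)..\<infinity>.
                       exp (- ((y + Bt * T) / (p - 1))) * ft x y))))"
    if f: "joint_density P X Y f" and ft: "joint_density Pt Xt Yt ft" and c: "0 \<le> c" for f ft c
  proof -
    interpret D: digital_claim P X Y Z H f K b "B * T"
      by (intro digital_claim.intro digital_claim_axioms.intro PS f K HM H_X Z_Y)
    interpret Dt: digital_claim Pt Xt Yt Z H ft K bt "Bt * T"
      by (intro digital_claim.intro digital_claim_axioms.intro PSt ft K H_Xt Z_Yt) (use HM in \<open>simp add: Pt\<close>)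
    show ?thesis
      unfolding Psi1_lin_def Psi2_lin_def Psi1_pow_def Psi2_pow_def Pt_def[symmetric]
      using D.digital_linear[OF c] Dt.digital_linear[OF c]
        D.digital_power_expectation[OF _ c] Dt.digital_power_cost[OF _ c] by blast
  qed
  then show ?thesis
    using nXY nXYt dens by blast
qed

end
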